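(* Let $0\to I\hookrightarrow A\xrightarrow{\ \pi\ }B\to 0$ be a short exact sequence of $C^*$-algebras, and let $\partial:K_0(B)\to K_1(I)$ be the associated exponential (boundary) map. If $x\in K_0(B)$ is any element such that $x=\varphi_*(b)$ for some $*$-homomorphism $\varphi:q\mathbb{C}\to B$, where $b$ is the canonical generator of $K_0(q\mathbb{C})\cong\mathbb{Z}$, then $\partial(x)=[u]$ in $K_1(I)$ for some unitary $u\in\tilde I$.
   Context: For a $C^*$-algebra $A$, $\tilde A$ denotes its unitization, where a new unit $\mathbb{1}$ is adjoined even if $A$ already has a unit. The $C^*$-algebra $q\mathbb{C}$ is $$q\mathbb{C}=\{f\in C_0((0,1],\mathbf{M}_2)\mid f(1)\text{ is diagonal}\},$$ where $C_0((0,1],\mathbf{M}_2)$ is the algebra of continuous $\mathbf{M}_2(\mathbb{C})$-valued functions on $(0,1]$ vanishing at $0$. With $t$ the coordinate function and $e_{ij}$ the matrix units of $\mathbf{M}_2$, put $h_0=t\otimes e_{11}$, $k_0=t\otimes e_{22}$, $x_0=\sqrt{t-t^2}\otimes e_{21}$ in $q\mathbb{C}$, and let $$P_0=\begin{bmatrix}\mathbb{1}-h_0 & x_0^*\\ x_0 & k_0\end{bmatrix}\in\mathbf{M}_2(\widetilde{q\mathbb{C}}),$$ which is a projection. The canonical generator of $K_0(q\mathbb{C})\cong\mathbb{Z}$ is $b=[P_0]-[\mathbb{1}]$. $K_1(I)$ is described by classes of unitaries in matrix algebras over $\tilde I$. The exponential map $\partial$ is the boundary map $K_0(B)\to K_1(I)$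 in the six-term exact sequence; for a projection $P\in \mathbf{M}_n(\tilde B)$ with self-adjoint lift $T\in \mathbf{M}_n(\tilde A)$, $\partial[P]$ is represented by $e^{2\pi i T}$. *)

theory Defs
  imports "HOL-Analysis.Analysis" "Jordan_Normal_Form.Matrix"
begin

section \<open>C*-algebras\<close>

text \<open>Complex scalar multiplication extends the real one of \<^class>\<open>real_normed_algebra\<close>.
  Homogeneity of the norm for complex scalars is not an axiom because it follows from the
  C*-identity; see \<open>norm_scaleC\<close> below.\<close>

class cstar_algebra = real_normed_algebra + banach +
  fixes scaleC :: "complex \<Rightarrow> 'a \<Rightarrow> 'a" (infixr "*\<^sub>C" 75)
    and star :: "'a \<Rightarrow> 'a"
  assumes scaleC_of_real: "complex_of_real r *\<^sub>C x = r *\<^sub>R x"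
    and scaleC_add_right: "c *\<^sub>C (x + y) = c *\<^sub>C x + c *\<^sub>C y"
    and scaleC_add_left: "(c + d) *\<^sub>C x = c *\<^sub>C x + d *\<^sub>C x"
    and scaleC_scaleC: "c *\<^sub>C d *\<^sub>C x = (c * d) *\<^sub>C x"
    and mult_scaleC_left: "(c *\<^sub>C x) * y = c *\<^sub>C (x * y)"
    and mult_scaleC_right: "x * (c *\<^sub>C y) = c *\<^sub>C (x * y)"
    and star_star: "star (star x) = x"
    and star_add: "star (x + y) = star x + star y"
    and star_scaleC: "star (c *\<^sub>C x) = cnj c *\<^sub>C star x"
    and star_mult: "star (x * y) = star y * star x"
    and cstar_identity: "norm (star x * x) = (norm x)\<^sup>2"

class unital_cstar_algebra = cstar_algebra + real_normed_algebra_1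

definition star_hom :: "('a::cstar_algebra \<Rightarrow> 'b::cstar_algebra) \<Rightarrow> bool" where
  "star_hom f \<longleftrightarrow>
     (\<forall>x y. f (x + y) = f x + f y) \<and> (\<forall>c x. f (c *\<^sub>C x) = c *\<^sub>C f x) \<and>
     (\<forall>x y. f (x * y) = f x * f y) \<and> (\<forall>x. f (star x) = star (f x))"

definition short_exact ::
    "('i::cstar_algebra \<Rightarrow> 'a::cstar_algebra) \<Rightarrow> ('a \<Rightarrow> 'b::cstar_algebra) \<Rightarrow> bool" where
  "short_exact \<iota> \<pi> \<longleftrightarrow> star_hom \<iota> \<and> star_hom \<pi> \<and> inj \<iota> \<and> range \<iota> = {a. \<pi> a = 0} \<and> surj \<pi>"

lemma scaleC_one: "1 *\<^sub>C x = (x :: 'a::cstar_algebra)"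
  using scaleC_of_real[of 1 x] by simp

lemma scaleC_zero_left: "0 *\<^sub>C x = (0 :: 'a::cstar_algebra)"
  using scaleC_of_real[of 0 x] by simp

lemma scaleC_zero_right: "c *\<^sub>C 0 = (0 :: 'a::cstar_algebra)"
  using scaleC_add_right[of c 0 0] by simp

lemma star_zero: "star 0 = (0 :: 'a::cstar_algebra)"
  using star_add[of 0 "0::'a"] by simp

lemma scaleC_scaleR: "c *\<^sub>C r *\<^sub>R x = r *\<^sub>R c *\<^sub>C (x :: 'a::cstar_algebra)"
  unfolding scaleC_of_real[symmetric] scaleC_scaleC by (simp add: mult.commute)

lemma scaleR_scaleC: "r *\<^sub>R c *\<^sub>C x = (complex_of_real r * c) *\<^sub>C (x :: 'a::cstar_algebra)"
  unfolding scaleC_of_real[symmetric] scaleC_scaleC ..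

lemma norm_star: "norm (star x) = norm (x :: 'a::cstar_algebra)"
proof -
  have le: "norm y \<le> norm (star y)" for y :: 'a
  proof (cases "y = 0")
    case False
    have "norm y * norm y \<le> norm (star y) * norm y"
      using norm_mult_ineq[of "star y" y] by (simp add: cstar_identity power2_eq_square)
    with False show ?thesis by simp
  qed simp
  show ?thesis using le[of x] le[of "star x"] by (simp add: star_star)
qed

lemma norm_scaleC: "norm (c *\<^sub>C x) = cmod c * norm (x :: 'a::cstar_algebra)"
proof -
  have "(norm (c *\<^sub>C x))\<^sup>2 = norm ((cnj c * c) *\<^sub>C (star x * x))"
    by (simp add: cstar_identity[symmetric] star_scaleC mult_scaleC_left mult_scaleC_right
        scaleC_scaleC mult.commute)
  also have "cnj c * c = complex_of_real ((cmod c)\<^sup>2)"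
    by (metis complex_norm_square mult.commute of_real_power)
  also have "norm (\<dots> *\<^sub>C (star x * x)) = (cmod c * norm x)\<^sup>2"
    unfolding scaleC_of_real by (simp add: cstar_identity power_mult_distrib)
  finally show ?thesis by (simp add: power2_eq_iff_nonneg)
qed

instantiation complex :: unital_cstar_algebra
begin
definition scaleC_complex :: "complex \<Rightarrow> complex \<Rightarrow> complex" where "scaleC_complex c x = c * x"
definition star_complex :: "complex \<Rightarrow> complex" where "star_complex = cnj"
instance
  by standard (auto simp: scaleC_complex_def star_complex_def scaleR_conv_of_real algebra_simps
      norm_mult power2_eq_square)
end


section \<open>The unitization, with a new unit adjoined in all cases\<close>

datatype 'a unitization = Unitiz (base: 'a) (scal: complex)

text \<open>The functorial map of the datatype, \<^const>\<open>map_unitization\<close>, sends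
  \<open>a + \<lambda>1\<close> to \<open>f a + \<lambda>1\<close>.\<close>

definition lmult :: "'a::cstar_algebra unitization \<Rightarrow> 'a \<Rightarrow> 'a" where
  "lmult x = (\<lambda>y. base x * y + scal x *\<^sub>C y)"

instantiation unitization :: (cstar_algebra) real_normed_algebra_1
begin

definition "0 = Unitiz 0 0"
definition "1 = Unitiz 0 1"
definition "x + y = Unitiz (base x + base y) (scal x + scal y)"
definition "- x = Unitiz (- base x) (- scal x)"
definition "x - y = Unitiz (base x - base y) (scal x - scal y)"
definition "x * y = Unitiz (base x * base y + scal x *\<^sub>C base y + scal y *\<^sub>C base x) (scal x * scal y)"
definition "r *\<^sub>R x = Unitiz (r *\<^sub>R base x) (r *\<^sub>R scal x)"
text \<open>The maximum with \<^term>\<open>cmod (scal x)\<close> is needed only when the algebra already has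
  a unit, where left multiplication alone is not faithful.\<close>
definition "norm x = max (cmod (scal x)) (onorm (lmult x))"
definition "dist x y = norm (x - y :: 'a unitization)"
definition "sgn x = inverse (norm x) *\<^sub>R (x :: 'a unitization)"
definition [code del]: "uniformity = (INF e\<in>{0 <..}. principal {(x, y :: 'a unitization). dist x y < e})"
definition [code del]: "open U \<longleftrightarrow> (\<forall>x\<in>U. \<forall>\<^sub>F (x', y :: 'a unitization) in uniformity. x' = x \<longrightarrow> y \<in> U)"

lemmas unitization_defs = zero_unitization_def one_unitization_def plus_unitization_def
  uminus_unitization_def minus_unitization_def times_unitization_def scaleR_unitization_def

lemma bounded_linear_lmult: "bounded_linear (lmult x)"
proof (rule bounded_linear_intro[where K = "norm (base x) + cmod (scal x)"])
  show "norm (lmult x y) \<le> norm y * (norm (base x) + cmod (scal x))" for y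
    unfolding lmult_def
    by (rule order.trans[OF norm_triangle_ineq])
      (use norm_mult_ineq[of "base x" y] in \<open>simp add: norm_scaleC algebra_simps\<close>)
qed (auto simp: lmult_def algebra_simps scaleC_add_right scaleC_scaleR)

lemma onorm_lmult: "norm (lmult x y) \<le> onorm (lmult x) * norm y"
  by (rule onorm[OF bounded_linear_lmult])

lemma norm_unitization_le: "norm x \<le> norm (base x) + cmod (scal x)"
proof -
  have "onorm (lmult x) \<le> norm (base x) + cmod (scal x)"
  proof (rule onorm_bound)
    show "norm (lmult x y) \<le> (norm (base x) + cmod (scal x)) * norm y" for y
    unfolding lmult_def
    by (rule order.trans[OF norm_triangle_ineq])
      (use norm_mult_ineq[of "base x" y] in \<open>simp add: norm_scaleC algebra_simps\<close>)
  qed simp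
  then show ?thesis by (simp add: norm_unitization_def)
qed

lemma scal_le_norm: "cmod (scal x) \<le> norm x"
  by (simp add: norm_unitization_def)

lemma base_le_norm: "norm (base x) \<le> 2 * norm x"
proof (cases "base x = 0")
  case True
  then show ?thesis by (auto simp: norm_unitization_def le_max_iff_disj)
next
  case False
  let ?a = "base x"
  have "norm ?a * norm ?a = norm (?a * star ?a)"
    using cstar_identity[of "star ?a"] by (simp add: star_star norm_star power2_eq_square)
  also have "?a * star ?a = lmult x (star ?a) - scal x *\<^sub>C star ?a"
    by (simp add: lmult_def)
  also have "norm \<dots> \<le> onorm (lmult x) * norm ?a + cmod (scal x) * norm ?a"
    by (rule order.trans[OF norm_triangle_ineq4])
      (use onorm_lmult[of x "star ?a"] in \<open>simp add: norm_scaleC norm_star\<close>)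
  also have "\<dots> = (onorm (lmult x) + cmod (scal x)) * norm ?a" by (simp add: algebra_simps)
  finally have "norm ?a \<le> onorm (lmult x) + cmod (scal x)" using False by simp
  then show ?thesis by (simp add: norm_unitization_def)
qed

lemma lmult_plus: "lmult (x + y) = (\<lambda>z. lmult x z + lmult y z)"
  by (auto simp: lmult_def unitization_defs algebra_simps scaleC_add_left)

lemma lmult_times: "lmult (x * y) = lmult x \<circ> lmult y"
  by (auto simp: lmult_def unitization_defs algebra_simps scaleC_add_left scaleC_add_right
      mult_scaleC_left mult_scaleC_right scaleC_scaleC fun_eq_iff)

lemma norm_unitization_mult: "norm (x * y) \<le> norm x * norm (y :: 'a unitization)"
proof -
  have "onorm (lmult (x * y)) \<le> onorm (lmult x) * onorm (lmult y)"
    unfolding lmult_times by (rule onorm_compose[OF bounded_linear_lmult bounded_linear_lmult])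
  also have "\<dots> \<le> norm x * norm y"
    unfolding norm_unitization_def
    by (intro mult_mono) (auto simp: onorm_pos_le[OF bounded_linear_lmult] le_max_iff_disj)
  moreover have "cmod (scal (x * y)) \<le> norm x * norm y"
    by (simp add: unitization_defs norm_mult)
      (intro mult_mono scal_le_norm order.trans[OF norm_ge_zero scal_le_norm] norm_ge_zero)
  ultimately show ?thesis by (simp add: norm_unitization_def[of "x * y"])
qed

instance
proof
  fix x y z :: "'a unitization" and r s :: real
  show "x + y + z = x + (y + z)" "x + y = y + x" "0 + x = x" "- x + x = 0" "x - y = x + - y"
    by (auto simp: unitization_defs)
  show "x * y * z = x * (y * z)" "(x + y) * z = x * z + y * z" "x * (y + z) = x * y + x * z"
    by (auto simp: unitization_defs algebra_simps scaleC_add_left scaleC_add_right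
        mult_scaleC_left mult_scaleC_right scaleC_scaleC)
  show "1 * x = x" "x * 1 = x" "(0 :: 'a unitization) \<noteq> 1"
    by (auto simp: unitization_defs scaleC_one scaleC_zero_left scaleC_zero_right)
  show "r *\<^sub>R (x + y) = r *\<^sub>R x + r *\<^sub>R y" "(r + s) *\<^sub>R x = r *\<^sub>R x + s *\<^sub>R x"
    "r *\<^sub>R s *\<^sub>R x = (r * s) *\<^sub>R x" "1 *\<^sub>R x = x"
    by (auto simp: unitization_defs algebra_simps)
  show "r *\<^sub>R x * y = r *\<^sub>R (x * y)" "x * r *\<^sub>R y = r *\<^sub>R (x * y)"
    by (auto simp: unitization_defs algebra_simps scaleC_scaleR scaleR_scaleC ac_simps scaleR_conv_of_real)
  show "dist x y = norm (x - y)" by (rule dist_unitization_def)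
  show "sgn x = inverse (norm x) *\<^sub>R x" by (rule sgn_unitization_def)
  show "uniformity = (INF e\<in>{0 <..}. principal {(x, y :: 'a unitization). dist x y < e})"
    by (rule uniformity_unitization_def)
  show "open U \<longleftrightarrow> (\<forall>x\<in>U. \<forall>\<^sub>F (x', y :: 'a unitization) in uniformity. x' = x \<longrightarrow> y \<in> U)" for U
    by (rule open_unitization_def)
  show "norm x = 0 \<longleftrightarrow> x = 0"
  proof
    assume "norm x = 0"
    with scal_le_norm[of x] base_le_norm[of x] show "x = 0"
      by (cases x) (simp add: unitization_defs)
  next
    assume "x = 0"
    with norm_unitization_le[of x] order.trans[OF norm_ge_zero scal_le_norm[of x]] show "norm x = 0"
      by (simp add: unitization_defs)
  qed
  show "norm (x + y) \<le> norm x + norm y"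
  proof -
    have "onorm (lmult (x + y)) \<le> onorm (lmult x) + onorm (lmult y)"
      unfolding lmult_plus by (rule onorm_triangle[OF bounded_linear_lmult bounded_linear_lmult])
    moreover have "cmod (scal (x + y)) \<le> cmod (scal x) + cmod (scal y)"
      by (simp add: unitization_defs norm_triangle_ineq)
    ultimately show ?thesis unfolding norm_unitization_def by linarith
  qed
  show "norm (r *\<^sub>R x) = \<bar>r\<bar> * norm x"
  proof -
    have "lmult (r *\<^sub>R x) = (\<lambda>y. r *\<^sub>R lmult x y)"
      by (auto simp: lmult_def unitization_defs algebra_simps scaleR_scaleC ac_simps scaleR_conv_of_real)
    then have "onorm (lmult (r *\<^sub>R x)) = \<bar>r\<bar> * onorm (lmult x)"
      by (simp add: onorm_scaleR[OF bounded_linear_lmult])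
    moreover have "cmod (scal (r *\<^sub>R x)) = \<bar>r\<bar> * cmod (scal x)"
      by (simp add: unitization_defs)
    ultimately show ?thesis unfolding norm_unitization_def
      by (simp add: max_mult_distrib_left)
  qed
  show "norm (x * y) \<le> norm x * norm y" by (rule norm_unitization_mult)
  show "norm (1 :: 'a unitization) = 1"
  proof -
    have "onorm (lmult (1 :: 'a unitization)) \<le> 1"
      by (rule onorm_bound) (simp_all add: lmult_def unitization_defs scaleC_one)
    then show ?thesis by (simp add: norm_unitization_def one_unitization_def)
  qed
qed

end

instance unitization :: (cstar_algebra) banach
proof
  fix X :: "nat \<Rightarrow> 'a unitization"
  assume X: "Cauchy X"
  have *: "\<exists>N. \<forall>m\<ge>N. \<forall>n\<ge>N. norm (X m - X n) < e" if "e > 0" for e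
    using X that unfolding Cauchy_def by (simp add: dist_unitization_def)
  have "Cauchy (\<lambda>n. scal (X n))"
    unfolding Cauchy_def dist_norm
  proof (intro allI impI)
    fix e :: real assume "e > 0"
    from *[OF this] obtain N where N: "\<And>m n. m \<ge> N \<Longrightarrow> n \<ge> N \<Longrightarrow> norm (X m - X n) < e" by blast
    have "cmod (scal (X m) - scal (X n)) < e" if "m \<ge> N" "n \<ge> N" for m n
      using N[OF that] scal_le_norm[of "X m - X n"] by (simp add: minus_unitization_def)
    then show "\<exists>M. \<forall>m\<ge>M. \<forall>n\<ge>M. cmod (scal (X m) - scal (X n)) < e" by blast
  qed
  then obtain l where l: "(\<lambda>n. scal (X n)) \<longlonglongrightarrow> l"
    using Cauchy_convergent convergent_def by blast
  have "Cauchy (\<lambda>n. base (X n))"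
    unfolding Cauchy_def dist_norm
  proof (intro allI impI)
    fix e :: real assume "e > 0"
    then have "e / 2 > 0" by simp
    from *[OF this] obtain N where N: "\<And>m n. m \<ge> N \<Longrightarrow> n \<ge> N \<Longrightarrow> norm (X m - X n) < e / 2" by blast
    have "norm (base (X m) - base (X n)) < e" if "m \<ge> N" "n \<ge> N" for m n
      using N[OF that] base_le_norm[of "X m - X n"] by (simp add: minus_unitization_def)
    then show "\<exists>M. \<forall>m\<ge>M. \<forall>n\<ge>M. norm (base (X m) - base (X n)) < e" by blast
  qed
  then obtain a where a: "(\<lambda>n. base (X n)) \<longlonglongrightarrow> a"
    using Cauchy_convergent convergent_def by blast
  have "(\<lambda>n. norm (base (X n) - a) + cmod (scal (X n) - l)) \<longlonglongrightarrow> 0 + 0"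
    using a l by (intro tendsto_add) (auto simp: tendsto_norm_zero_iff LIM_zero_iff)
  then have lim: "(\<lambda>n. norm (base (X n) - a) + cmod (scal (X n) - l)) \<longlonglongrightarrow> 0" by simp
  have le: "dist (X n) (Unitiz a l) \<le> norm (base (X n) - a) + cmod (scal (X n) - l)" for n
    using norm_unitization_le[of "X n - Unitiz a l"]
    by (simp add: dist_unitization_def minus_unitization_def)
  have "(\<lambda>n. dist (X n) (Unitiz a l)) \<longlonglongrightarrow> 0"
    by (rule Lim_null_comparison[OF _ lim]) (use le in \<open>auto simp: dist_unitization_def
        intro!: always_eventually order.trans[OF _ le]\<close>)
  then show "convergent X" unfolding convergent_def tendsto_dist_iff[symmetric] by blast
qed

instantiation unitization :: (cstar_algebra) unital_cstar_algebra
begin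

definition "c *\<^sub>C x = Unitiz (c *\<^sub>C base x) (c * scal x)"
definition "star x = Unitiz (star (base x)) (cnj (scal x))"

lemmas unitization_cdefs = unitization_defs scaleC_unitization_def star_unitization_def

lemma onorm_lmult_star: "(onorm (lmult x))\<^sup>2 \<le> onorm (lmult (star x * x))"
proof -
  have *: "star (lmult x y) * lmult x y = star y * lmult (star x * x) y" for y
    by (simp add: lmult_def unitization_cdefs algebra_simps star_add star_mult star_scaleC
        mult_scaleC_left mult_scaleC_right scaleC_scaleC scaleC_add_left scaleC_add_right)
  have "norm (lmult x y) \<le> sqrt (onorm (lmult (star x * x))) * norm y" for y
  proof -
    have "(norm (lmult x y))\<^sup>2 \<le> norm (star y) * norm (lmult (star x * x) y)"
      unfolding cstar_identity[symmetric] * by (rule norm_mult_ineq)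
    also have "\<dots> \<le> norm y * (onorm (lmult (star x * x)) * norm y)"
      unfolding norm_star by (rule mult_left_mono[OF onorm_lmult]) simp
    finally have "(norm (lmult x y))\<^sup>2 \<le> onorm (lmult (star x * x)) * (norm y)\<^sup>2"
      by (simp add: power2_eq_square algebra_simps)
    then have "sqrt ((norm (lmult x y))\<^sup>2) \<le> sqrt (onorm (lmult (star x * x)) * (norm y)\<^sup>2)"
      by (rule real_sqrt_le_mono)
    then show ?thesis by (simp add: real_sqrt_mult)
  qed
  then have "onorm (lmult x) \<le> sqrt (onorm (lmult (star x * x)))"
    by (rule onorm_bound[rotated]) (simp add: onorm_pos_le[OF bounded_linear_lmult])
  then have "(onorm (lmult x))\<^sup>2 \<le> (sqrt (onorm (lmult (star x * x))))\<^sup>2"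
    by (rule power_mono) (rule onorm_pos_le[OF bounded_linear_lmult])
  then show ?thesis by (simp add: onorm_pos_le[OF bounded_linear_lmult])
qed

lemma norm_unitization_star: "norm (star x * x) = (norm (x :: 'a unitization))\<^sup>2"
proof -
  have nn: "0 \<le> norm x" for x :: "'a unitization"
    by (rule order.trans[OF norm_ge_zero scal_le_norm])
  have sq: "(norm x)\<^sup>2 \<le> norm (star x * x)" for x :: "'a unitization"
  proof -
    have "(cmod (scal x))\<^sup>2 = cmod (scal (star x * x))"
      by (simp add: unitization_cdefs norm_mult power2_eq_square)
    with onorm_lmult_star[of x] show ?thesis
      unfolding norm_unitization_def by (auto simp: max_def)
  qed
  have le: "norm x \<le> norm (star x)" for x :: "'a unitization"
  proof (cases "norm x = 0")
    case False
    have "norm x * norm x \<le> norm (star x) * norm x"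
      using sq[of x] norm_unitization_mult[of "star x" x] by (simp add: power2_eq_square)
    then show ?thesis using False nn[of x] by simp
  qed (simp add: nn)
  have "star (star x) = x"
    by (cases x) (simp add: unitization_cdefs star_star)
  with le[of x] le[of "star x"] have "norm (star x) = norm x" by simp
  then show ?thesis
    using sq[of x] norm_unitization_mult[of "star x" x] by (simp add: power2_eq_square)
qed

instance
proof
  fix x y :: "'a unitization" and r :: real and c d :: complex
  show "complex_of_real r *\<^sub>C x = r *\<^sub>R x" "c *\<^sub>C (x + y) = c *\<^sub>C x + c *\<^sub>C y"
    "(c + d) *\<^sub>C x = c *\<^sub>C x + d *\<^sub>C x" "c *\<^sub>C d *\<^sub>C x = (c * d) *\<^sub>C x"
    "(c *\<^sub>C x) * y = c *\<^sub>C (x * y)" "x * (c *\<^sub>C y) = c *\<^sub>C (x * y)"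
    "star (star x) = x" "star (x + y) = star x + star y" "star (c *\<^sub>C x) = cnj c *\<^sub>C star x"
    "star (x * y) = star y * star x"
    by (auto simp: unitization_cdefs algebra_simps scaleC_add_left scaleC_add_right
        mult_scaleC_left mult_scaleC_right scaleC_scaleC star_star star_add star_scaleC star_mult
        scaleC_of_real scaleR_conv_of_real)
  show "norm (star x * x) = (norm x)\<^sup>2" by (rule norm_unitization_star)
qed

end


section \<open>The C*-algebra qC\<close>

text \<open>The usual infix \<open>$\<close> is also used by the matrix library, hence a separate notation.\<close>

notation Finite_Cartesian_Product.vec_nth (infixl "$h" 90)

text \<open>On \<^typ>\<open>complex^2^2\<close> the matrix product is \<open>**\<close> (the class operation \<open>*\<close> is entrywise), and
  the C*-norm is the operator norm on \<^typ>\<open>complex^2\<close>, not \<^const>\<open>norm\<close>.\<close>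

definition M2_star :: "complex^2^2 \<Rightarrow> complex^2^2" where
  "M2_star A = (\<chi> i j. cnj (A $h j $h i))"

definition M2_norm :: "complex^2^2 \<Rightarrow> real" where
  "M2_norm A = onorm ((*v) A)"

definition M2_unit :: "2 \<Rightarrow> 2 \<Rightarrow> complex^2^2" where
  "M2_unit k l = (\<chi> i j. if i = k \<and> j = l then 1 else 0)"

text \<open>A function in \<open>C\<^sub>0((0,1], M\<^sub>2)\<close> is given as a continuous function on \<open>[0,1]\<close> that is
  \<open>0\<close> at \<open>0\<close>, extended by \<open>0\<close> outside \<open>[0,1]\<close> to make the representation unique.\<close>

typedef qC = "{f :: real \<Rightarrow> complex^2^2. continuous_on {0..1} f \<and> f 0 = 0 \<and>
    (\<forall>i j. i \<noteq> j \<longrightarrow> f 1 $h i $h j = 0) \<and> (\<forall>t. t \<notin> {0..1} \<longrightarrow> f t = 0)}"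
  morphisms qC_fun Abs_qC
  by (rule exI[of _ "\<lambda>_. 0"]) auto

setup_lifting type_definition_qC

lemma M2_bounded_linear: "bounded_linear ((*v) (A :: complex^2^2))"
  by (rule matrix_vector_mul_bounded_linear)

lemma M2_norm_nonneg: "0 \<le> M2_norm A"
  unfolding M2_norm_def by (rule onorm_pos_le[OF M2_bounded_linear])

lemma M2_norm_apply: "norm (A *v x) \<le> M2_norm A * norm x"
  unfolding M2_norm_def by (rule onorm[OF M2_bounded_linear])

lemma M2_norm_add: "M2_norm (A + B) \<le> M2_norm A + M2_norm B"
  unfolding M2_norm_def matrix_vector_mult_add_rdistrib
  by (rule onorm_triangle[OF M2_bounded_linear M2_bounded_linear])

lemma M2_norm_scaleR: "M2_norm (r *\<^sub>R A) = \<bar>r\<bar> * M2_norm A"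
proof -
  have "(*v) (r *\<^sub>R A) = (\<lambda>x. r *\<^sub>R (A *v x))"
    by (simp add: fun_eq_iff matrix_vector_mult_def Finite_Cartesian_Product.vec_eq_iff scaleR_sum_right)
  then show ?thesis
    unfolding M2_norm_def by (simp add: onorm_scaleR[OF M2_bounded_linear])
qed

lemma M2_norm_mult: "M2_norm (A ** B) \<le> M2_norm A * M2_norm B"
  unfolding M2_norm_def using onorm_compose[OF M2_bounded_linear M2_bounded_linear, of A B]
  by (simp add: comp_def matrix_vector_mul_assoc)

lemma M2_inner_star: "inner (A *v x) y = inner x (M2_star A *v y)"
  by (simp add: inner_vec_def matrix_vector_mult_def M2_star_def sum_2 inner_complex_def algebra_simps)

lemma M2_norm_cstar: "M2_norm (M2_star A ** A) = (M2_norm A)\<^sup>2"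
proof -
  have sq: "(M2_norm A)\<^sup>2 \<le> M2_norm (M2_star A ** A)" for A
  proof -
    have "norm (A *v x) \<le> sqrt (M2_norm (M2_star A ** A)) * norm x" for x
    proof -
      have "(norm (A *v x))\<^sup>2 = inner x ((M2_star A ** A) *v x)"
        by (simp add: power2_norm_eq_inner M2_inner_star matrix_vector_mul_assoc)
      also have "\<dots> \<le> norm x * (M2_norm (M2_star A ** A) * norm x)"
        by (rule order.trans[OF norm_cauchy_schwarz mult_left_mono[OF M2_norm_apply]]) simp
      finally have "(norm (A *v x))\<^sup>2 \<le> M2_norm (M2_star A ** A) * (norm x)\<^sup>2"
        by (simp add: power2_eq_square algebra_simps)
      then have "sqrt ((norm (A *v x))\<^sup>2) \<le> sqrt (M2_norm (M2_star A ** A) * (norm x)\<^sup>2)"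
        by (rule real_sqrt_le_mono)
      then show ?thesis by (simp add: real_sqrt_mult)
    qed
    then have "M2_norm A \<le> sqrt (M2_norm (M2_star A ** A))"
      unfolding M2_norm_def[of A] by (rule onorm_bound[rotated]) (simp add: M2_norm_nonneg)
    then have "(M2_norm A)\<^sup>2 \<le> (sqrt (M2_norm (M2_star A ** A)))\<^sup>2"
      by (rule power_mono) (rule M2_norm_nonneg)
    then show ?thesis by (simp add: M2_norm_nonneg)
  qed
  have le: "M2_norm A \<le> M2_norm (M2_star A)" for A
  proof (cases "M2_norm A = 0")
    case False
    have "M2_norm A * M2_norm A \<le> M2_norm (M2_star A) * M2_norm A"
      using sq[of A] M2_norm_mult[of "M2_star A" A] by (simp add: power2_eq_square)
    then show ?thesis using False M2_norm_nonneg[of A] by simp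
  qed (simp add: M2_norm_nonneg)
  have "M2_star (M2_star A) = A" by (simp add: M2_star_def Finite_Cartesian_Product.vec_eq_iff)
  with le[of A] le[of "M2_star A"] have "M2_norm (M2_star A) = M2_norm A" by simp
  then show ?thesis
    using sq[of A] M2_norm_mult[of "M2_star A" A] by (simp add: power2_eq_square)
qed

lemma M2_entry_le: "cmod (A $h i $h j) \<le> norm (A :: complex^2^2)"
  using order.trans[OF Finite_Cartesian_Product.norm_nth_le Finite_Cartesian_Product.norm_nth_le] .

lemma M2_norm_le: "M2_norm A \<le> 4 * norm A"
  unfolding M2_norm_def
proof (rule onorm_bound)
  fix x :: "complex^2"
  have "norm (A *v x) \<le> (\<Sum>i\<in>UNIV. norm ((A *v x) $h i))"
    unfolding norm_vec_def by (rule L2_set_le_sum) simp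
  also have "\<dots> \<le> (\<Sum>i\<in>(UNIV::2 set). 2 * (norm A * norm x))"
  proof (rule sum_mono)
    fix i :: 2
    have "norm ((A *v x) $h i) \<le> (\<Sum>j\<in>UNIV. norm (A $h i $h j * x $h j))"
      unfolding matrix_vector_mult_def by (simp add: norm_sum)
    also have "\<dots> \<le> (\<Sum>j\<in>(UNIV::2 set). norm A * norm x)"
      by (rule sum_mono)
        (auto simp: norm_mult intro!: mult_mono M2_entry_le Finite_Cartesian_Product.norm_nth_le)
    finally show "norm ((A *v x) $h i) \<le> 2 * (norm A * norm x)" by simp
  qed
  finally show "norm (A *v x) \<le> 4 * norm A * norm x" by simp
qed simp

lemma M2_norm_ge: "norm A \<le> 4 * M2_norm A"
proof -
  have entry: "cmod (A $h i $h j) \<le> M2_norm A" for i j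
  proof -
    have "A $h i $h j = (A *v axis j 1) $h i"
      by (simp add: matrix_vector_mult_def axis_def if_distrib if_distribR cong: if_cong)
    also have "cmod \<dots> \<le> norm (A *v axis j 1)" by (rule Finite_Cartesian_Product.norm_nth_le)
    also have "\<dots> \<le> M2_norm A" using M2_norm_apply[of A "axis j 1"] by (simp add: norm_axis_1)
    finally show ?thesis .
  qed
  have "norm A \<le> (\<Sum>i\<in>UNIV. norm (A $h i))"
    unfolding norm_vec_def[of A] by (rule L2_set_le_sum) simp
  also have "\<dots> \<le> (\<Sum>i\<in>(UNIV::2 set). 2 * M2_norm A)"
  proof (rule sum_mono)
    fix i :: 2
    have "norm (A $h i) \<le> (\<Sum>j\<in>UNIV. norm (A $h i $h j))"
      unfolding norm_vec_def[of "A $h i"] by (rule L2_set_le_sum) simp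
    also have "\<dots> \<le> (\<Sum>j\<in>(UNIV::2 set). M2_norm A)" by (rule sum_mono) (rule entry)
    finally show "norm (A $h i) \<le> 2 * M2_norm A" by simp
  qed
  finally show ?thesis by simp
qed

lemma M2_norm_zero: "M2_norm 0 = 0"
  using M2_norm_le[of 0] M2_norm_nonneg[of 0] by simp

instantiation qC :: real_normed_algebra
begin

lift_definition zero_qC :: qC is "\<lambda>t. 0" by auto
lift_definition plus_qC :: "qC \<Rightarrow> qC \<Rightarrow> qC" is "\<lambda>f g t. f t + g t"
  by (auto intro!: continuous_intros)
lift_definition uminus_qC :: "qC \<Rightarrow> qC" is "\<lambda>f t. - f t"
  by (auto intro!: continuous_intros)
lift_definition minus_qC :: "qC \<Rightarrow> qC \<Rightarrow> qC" is "\<lambda>f g t. f t - g t"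
  by (auto intro!: continuous_intros)
lift_definition times_qC :: "qC \<Rightarrow> qC \<Rightarrow> qC" is "\<lambda>f g t. f t ** g t"
proof -
  fix f g :: "real \<Rightarrow> complex^2^2"
  assume f: "continuous_on {0..1} f \<and> f 0 = 0 \<and>
    (\<forall>i j. i \<noteq> j \<longrightarrow> f 1 $h i $h j = 0) \<and> (\<forall>t. t \<notin> {0..1} \<longrightarrow> f t = 0)"
    and g: "continuous_on {0..1} g \<and> g 0 = 0 \<and>
    (\<forall>i j. i \<noteq> j \<longrightarrow> g 1 $h i $h j = 0) \<and> (\<forall>t. t \<notin> {0..1} \<longrightarrow> g t = 0)"
  have z: "(0 :: complex^2^2) ** A = 0" for A :: "complex^2^2"
    by (simp add: matrix_matrix_mult_def Finite_Cartesian_Product.vec_eq_iff)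
  have "continuous_on {0..1} (\<lambda>t. f t ** g t)"
    unfolding matrix_matrix_mult_def using f g
    by (intro continuous_on_vec_lambda) (auto intro!: continuous_intros)
  moreover have "(f 1 ** g 1) $h i $h j = 0" if "i \<noteq> j" for i j
    unfolding matrix_matrix_mult_def using f g that
    by (auto intro!: sum.neutral) metis
  ultimately show "continuous_on {0..1} (\<lambda>t. f t ** g t) \<and> f 0 ** g 0 = 0 \<and>
    (\<forall>i j. i \<noteq> j \<longrightarrow> (f 1 ** g 1) $h i $h j = 0) \<and> (\<forall>t. t \<notin> {0..1} \<longrightarrow> f t ** g t = 0)"
    using f g by (simp add: z)
qed
lift_definition scaleR_qC :: "real \<Rightarrow> qC \<Rightarrow> qC" is "\<lambda>r f t. r *\<^sub>R f t"
  by (auto intro!: continuous_intros)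
definition norm_qC :: "qC \<Rightarrow> real" where "norm f = (SUP t\<in>{0..1}. M2_norm (qC_fun f t))"
definition "dist f g = norm (f - g :: qC)"
definition "sgn f = inverse (norm f) *\<^sub>R (f :: qC)"
definition [code del]: "uniformity = (INF e\<in>{0 <..}. principal {(f, g :: qC). dist f g < e})"
definition [code del]: "open U \<longleftrightarrow> (\<forall>f\<in>U. \<forall>\<^sub>F (f', g :: qC) in uniformity. f' = f \<longrightarrow> g \<in> U)"

lemma qC_bdd: "bdd_above ((\<lambda>t. M2_norm (qC_fun f t)) ` {0..1})"
proof -
  have "continuous_on {0..1} (qC_fun f)" using qC_fun[of f] by simp
  then have "compact (qC_fun f ` {0..1})" by (rule compact_continuous_image) simp
  then obtain B where "\<And>t. t \<in> {0..1} \<Longrightarrow> norm (qC_fun f t) \<le> B"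
    using compact_imp_bounded bounded_iff by (metis image_eqI)
  then show ?thesis
    by (intro bdd_aboveI[of _ "4 * B"]) (use order.trans[OF M2_norm_le] in force)
qed

lemma qC_norm_ge: "M2_norm (qC_fun f t) \<le> norm f"
proof (cases "t \<in> {0..1}")
  case True
  then show ?thesis unfolding norm_qC_def by (rule cSUP_upper[OF _ qC_bdd])
next
  case False
  then have "qC_fun f t = qC_fun f 0" using qC_fun[of f] by auto
  then show ?thesis unfolding norm_qC_def by (auto intro!: cSUP_upper[OF _ qC_bdd])
qed

lemma qC_norm_leI: "(\<And>t. M2_norm (qC_fun f t) \<le> B) \<Longrightarrow> norm f \<le> B"
  unfolding norm_qC_def by (rule cSUP_least) auto

lemma qC_norm_nonneg: "0 \<le> norm (f :: qC)"
  by (rule order.trans[OF M2_norm_nonneg qC_norm_ge])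

lemma norm_qC_mult: "norm (f * g) \<le> norm f * norm (g :: qC)"
proof (rule qC_norm_leI)
  fix t
  have "M2_norm (qC_fun (f * g) t) \<le> M2_norm (qC_fun f t) * M2_norm (qC_fun g t)"
    by (simp add: times_qC.rep_eq M2_norm_mult)
  also have "\<dots> \<le> norm f * norm g"
    by (intro mult_mono qC_norm_ge M2_norm_nonneg qC_norm_nonneg)
  finally show "M2_norm (qC_fun (f * g) t) \<le> norm f * norm g" .
qed

instance
proof
  fix f g h :: qC and r s :: real
  show "f + g + h = f + (g + h)" "f + g = g + f" "0 + f = f" "- f + f = 0" "f - g = f + - g"
    by (transfer; simp add: fun_eq_iff algebra_simps)+
  show "f * g * h = f * (g * h)" "(f + g) * h = f * h + g * h" "f * (g + h) = f * g + f * h"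
    by (transfer; simp add: matrix_mul_assoc matrix_add_ldistrib
        matrix_matrix_mult_def Finite_Cartesian_Product.vec_eq_iff fun_eq_iff sum_2 algebra_simps)+
  show "r *\<^sub>R (f + g) = r *\<^sub>R f + r *\<^sub>R g" "(r + s) *\<^sub>R f = r *\<^sub>R f + s *\<^sub>R f"
    "r *\<^sub>R s *\<^sub>R f = (r * s) *\<^sub>R f" "1 *\<^sub>R f = f"
    by (transfer; simp add: fun_eq_iff algebra_simps)+
  show "r *\<^sub>R f * g = r *\<^sub>R (f * g)" "f * r *\<^sub>R g = r *\<^sub>R (f * g)"
    by (transfer; simp add: matrix_matrix_mult_def Finite_Cartesian_Product.vec_eq_iff fun_eq_iff sum_2 algebra_simps)+
  show "dist f g = norm (f - g)" by (rule dist_qC_def)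
  show "sgn f = inverse (norm f) *\<^sub>R f" by (rule sgn_qC_def)
  show "uniformity = (INF e\<in>{0 <..}. principal {(f, g :: qC). dist f g < e})"
    by (rule uniformity_qC_def)
  show "open U \<longleftrightarrow> (\<forall>f\<in>U. \<forall>\<^sub>F (f', g :: qC) in uniformity. f' = f \<longrightarrow> g \<in> U)" for U
    by (rule open_qC_def)
  show "norm f = 0 \<longleftrightarrow> f = 0"
  proof
    assume "norm f = 0"
    then have "norm (qC_fun f t) \<le> 0" for t
      using M2_norm_ge[of "qC_fun f t"] qC_norm_ge[of f t] by linarith
    then show "f = 0" by (simp add: qC_fun_inject[symmetric] zero_qC.rep_eq fun_eq_iff)
  next
    assume "f = 0"
    then have "norm f \<le> 0" by (intro qC_norm_leI) (simp add: zero_qC.rep_eq M2_norm_zero)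
    then show "norm f = 0" using qC_norm_nonneg[of f] by simp
  qed
  show "norm (f + g) \<le> norm f + norm g"
    by (rule qC_norm_leI, unfold plus_qC.rep_eq, rule order.trans[OF M2_norm_add])
      (intro add_mono qC_norm_ge)
  show "norm (r *\<^sub>R f) = \<bar>r\<bar> * norm f"
  proof -
    have le: "norm (r *\<^sub>R f) \<le> \<bar>r\<bar> * norm f" for r and f :: qC
      by (rule qC_norm_leI) (simp add: scaleR_qC.rep_eq M2_norm_scaleR mult_left_mono qC_norm_ge)
    have "\<bar>r\<bar> * norm f \<le> norm (r *\<^sub>R f)"
    proof (cases "r = 0")
      case False
      have "inverse r *\<^sub>R r *\<^sub>R f = f"
        using False by transfer simp
      then have "norm f \<le> \<bar>inverse r\<bar> * norm (r *\<^sub>R f)" using le[of "inverse r" "r *\<^sub>R f"] by simp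
      then show ?thesis using False by (simp add: field_simps)
    qed (simp add: qC_norm_nonneg)
    with le[of r f] show ?thesis by simp
  qed
  show "norm (f * g) \<le> norm f * norm g" by (rule norm_qC_mult)
qed

end

lemma qC_complete:
  assumes X: "Cauchy (X :: nat \<Rightarrow> qC)"
  shows "\<exists>l. (\<lambda>n. norm (X n - l)) \<longlonglongrightarrow> 0"
proof -
  have *: "\<exists>N. \<forall>m\<ge>N. \<forall>n\<ge>N. norm (X m - X n) < e" if "e > 0" for e
    using X that unfolding Cauchy_def by (simp add: dist_qC_def)
  have "uniformly_Cauchy_on UNIV (\<lambda>n. qC_fun (X n))"
  proof (rule uniformly_Cauchy_onI)
    fix e :: real assume "e > 0"
    then have "e / 4 > 0" by simp
    from *[OF this] obtain N where N: "\<And>m n. m \<ge> N \<Longrightarrow> n \<ge> N \<Longrightarrow> norm (X m - X n) < e / 4" by blast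
    have "dist (qC_fun (X m) t) (qC_fun (X n) t) < e" if "m \<ge> N" "n \<ge> N" for m n t
      using N[OF that] M2_norm_ge[of "qC_fun (X m - X n) t"] qC_norm_ge[of "X m - X n" t]
      by (simp add: dist_norm minus_qC.rep_eq)
    then show "\<exists>M. \<forall>x\<in>UNIV. \<forall>m\<ge>M. \<forall>n\<ge>M. dist (qC_fun (X m) x) (qC_fun (X n) x) < e" by blast
  qed
  then have "uniformly_convergent_on UNIV (\<lambda>n. qC_fun (X n))"
    by (rule Cauchy_uniformly_convergent)
  then obtain l where l: "uniform_limit UNIV (\<lambda>n. qC_fun (X n)) l sequentially"
    unfolding uniformly_convergent_on_def by blast
  have pt: "(\<lambda>n. qC_fun (X n) t) \<longlonglongrightarrow> l t" for t
    using tendsto_uniform_limitI[OF l] by simp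
  have "continuous_on {0..1} l"
    by (rule uniform_limit_theorem[OF _ uniform_limit_on_subset[OF l]])
      (use qC_fun in \<open>auto intro!: always_eventually\<close>)
  moreover have "l 0 = 0"
    using LIMSEQ_unique[OF pt[of 0], of 0] qC_fun by simp
  moreover have "l 1 $h i $h j = 0" if "i \<noteq> j" for i j
    using LIMSEQ_unique[OF tendsto_vec_nth[OF tendsto_vec_nth[OF pt[of 1]]], of i j 0] qC_fun that
    by simp
  moreover have "l t = 0" if "t \<notin> {0..1}" for t
    using LIMSEQ_unique[OF pt[of t], of 0] qC_fun that by simp
  ultimately have "qC_fun (Abs_qC l) = l"
    by (intro Abs_qC_inverse) auto
  note rep = this
  have "(\<lambda>n. norm (X n - Abs_qC l)) \<longlonglongrightarrow> 0"
  proof (rule LIMSEQ_I)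
    fix e :: real assume "e > 0"
    then have "e / 8 > 0" by simp
    with uniform_limitD[OF l] obtain N where
      N: "\<And>n t. n \<ge> N \<Longrightarrow> dist (qC_fun (X n) t) (l t) < e / 8"
      unfolding eventually_sequentially by (metis UNIV_I)
    have "norm (X n - Abs_qC l) \<le> e / 2" if "n \<ge> N" for n
    proof (rule qC_norm_leI)
      show "M2_norm (qC_fun (X n - Abs_qC l) t) \<le> e / 2" for t
        using N[OF that, of t] M2_norm_le[of "qC_fun (X n) t - l t"]
        by (simp add: minus_qC.rep_eq rep dist_norm)
    qed
    with \<open>e > 0\<close> have "norm (norm (X n - Abs_qC l) - 0) < e" if "n \<ge> N" for n
      using that qC_norm_nonneg[of "X n - Abs_qC l"] by force
    then show "\<exists>N. \<forall>n\<ge>N. norm (norm (X n - Abs_qC l) - 0) < e" by blast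
  qed
  then show ?thesis by blast
qed

instance qC :: banach
proof
  fix X :: "nat \<Rightarrow> qC"
  assume "Cauchy X"
  from qC_complete[OF this] obtain l where "(\<lambda>n. dist (X n) l) \<longlonglongrightarrow> 0"
    unfolding dist_qC_def by blast
  then show "convergent X" unfolding convergent_def tendsto_dist_iff[symmetric] by blast
qed

instantiation qC :: cstar_algebra
begin

lift_definition scaleC_qC :: "complex \<Rightarrow> qC \<Rightarrow> qC" is "\<lambda>c f t. \<chi> i j. c * f t $h i $h j"
  by (elim conjE, intro conjI continuous_on_vec_lambda continuous_on_mult continuous_on_const
      continuous_on_component)
    (simp_all add: Finite_Cartesian_Product.vec_eq_iff)
lift_definition star_qC :: "qC \<Rightarrow> qC" is "\<lambda>f t. M2_star (f t)"
  by (unfold M2_star_def, elim conjE, intro conjI continuous_on_vec_lambda continuous_on_cnj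
      continuous_on_component)
    (auto simp: Finite_Cartesian_Product.vec_eq_iff)

instance
proof
  fix f g :: qC and r :: real and c d :: complex
  show "complex_of_real r *\<^sub>C f = r *\<^sub>R f" "c *\<^sub>C (f + g) = c *\<^sub>C f + c *\<^sub>C g"
    "(c + d) *\<^sub>C f = c *\<^sub>C f + d *\<^sub>C f" "c *\<^sub>C d *\<^sub>C f = (c * d) *\<^sub>C f"
    by (transfer; simp add: Finite_Cartesian_Product.vec_eq_iff fun_eq_iff algebra_simps
        scaleR_conv_of_real[where 'a = complex])+
  show "(c *\<^sub>C f) * g = c *\<^sub>C (f * g)" "f * (c *\<^sub>C g) = c *\<^sub>C (f * g)"
    by (transfer; simp add: matrix_matrix_mult_def Finite_Cartesian_Product.vec_eq_iff fun_eq_iff sum_2 algebra_simps)+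
  show "star (star f) = f" "star (f + g) = star f + star g" "star (c *\<^sub>C f) = cnj c *\<^sub>C star f"
    "star (f * g) = star g * star f"
    by (transfer; simp add: M2_star_def matrix_matrix_mult_def Finite_Cartesian_Product.vec_eq_iff fun_eq_iff sum_2 algebra_simps)+
  show "norm (star f * f) = (norm f)\<^sup>2"
  proof -
    have rep: "qC_fun (star f * f) t = M2_star (qC_fun f t) ** qC_fun f t" for t
      by (simp add: times_qC.rep_eq star_qC.rep_eq)
    have sq: "M2_norm (qC_fun (star f * f) t) = (M2_norm (qC_fun f t))\<^sup>2" for t
      by (simp add: rep M2_norm_cstar)
    have "norm (star f * f) \<le> (norm f)\<^sup>2"
      by (rule qC_norm_leI) (simp add: sq power_mono[OF qC_norm_ge M2_norm_nonneg])
    moreover have "norm f \<le> sqrt (norm (star f * f))"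
    proof (rule qC_norm_leI)
      show "M2_norm (qC_fun f t) \<le> sqrt (norm (star f * f))" for t
        using qC_norm_ge[of "star f * f" t] by (simp add: sq real_le_rsqrt)
    qed
    then have "(norm f)\<^sup>2 \<le> (sqrt (norm (star f * f)))\<^sup>2"
      by (rule power_mono) (rule qC_norm_nonneg)
    ultimately show ?thesis by (simp add: qC_norm_nonneg)
  qed
qed

end

lemma continuous_on_if_mem: "continuous_on S f \<Longrightarrow> continuous_on S (\<lambda>t. if t \<in> S then f t else 0)"
  by (rule continuous_on_eq) auto

lift_definition h0 :: qC is "\<lambda>t. if t \<in> {0..1} then t *\<^sub>R M2_unit 1 1 else 0"
  by (intro conjI continuous_on_if_mem continuous_intros) (auto simp: M2_unit_def)
lift_definition k0 :: qC is "\<lambda>t. if t \<in> {0..1} then t *\<^sub>R M2_unit 2 2 else 0"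
  by (intro conjI continuous_on_if_mem continuous_intros) (auto simp: M2_unit_def)
lift_definition x0 :: qC is "\<lambda>t. if t \<in> {0..1} then sqrt (t - t\<^sup>2) *\<^sub>R M2_unit 2 1 else 0"
  by (intro conjI continuous_on_if_mem continuous_intros) (auto simp: M2_unit_def)


section \<open>K-theory\<close>

text \<open>Matrices of all finite sizes are matrices of type \<^typ>\<open>'a mat\<close>. The degenerate size
  \<open>0\<close> is allowed; it represents the class \<open>0\<close> of both K-groups.\<close>

definition mat_star :: "'a::cstar_algebra mat \<Rightarrow> 'a mat" where
  "mat_star A = transpose_mat (map_mat star A)"

definition mat_sum :: "'a::zero mat \<Rightarrow> 'a mat \<Rightarrow> 'a mat" (infixr "\<oplus>\<^sub>m" 65) where
  "A \<oplus>\<^sub>m B = four_block_mat A (0\<^sub>m (dim_row A) (dim_col B)) (0\<^sub>m (dim_row B) (dim_col A)) B"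

text \<open>The series converges in the norm of the matrix algebra, which for finite matrices is
  entrywise convergence.\<close>

definition mat_exp :: "'a::unital_cstar_algebra mat \<Rightarrow> 'a mat" where
  "mat_exp A = Matrix.mat (dim_row A) (dim_row A)
     (\<lambda>ij. \<Sum>k. (A ^\<^sub>m k) $$ ij /\<^sub>R fact k)"

subsection \<open>The group K0\<close>

definition projections :: "'a::unital_cstar_algebra mat set" where
  "projections = {P. \<exists>n. P \<in> carrier_mat n n \<and> mat_star P = P \<and> P * P = P}"

definition mvn :: "'a::unital_cstar_algebra mat \<Rightarrow> 'a mat \<Rightarrow> bool" where
  "mvn P Q \<longleftrightarrow> (\<exists>V \<in> carrier_mat (dim_row Q) (dim_row P). mat_star V * V = P \<and> V * mat_star V = Q)"

text \<open>\<open>K00\<close> is the Grothendieck group of the semigroup of Murray--von Neumann classes of projections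
  over a unital algebra; the pair \<open>(P, Q)\<close> stands for the formal difference \<open>[P] - [Q]\<close>.\<close>

definition K00_rel :: "(('a::unital_cstar_algebra mat \<times> 'a mat) \<times> ('a mat \<times> 'a mat)) set" where
  "K00_rel = {((P, Q), (P', Q')). P \<in> projections \<and> Q \<in> projections \<and>
     P' \<in> projections \<and> Q' \<in> projections \<and>
     (\<exists>R \<in> projections. mvn (P \<oplus>\<^sub>m Q' \<oplus>\<^sub>m R) (P' \<oplus>\<^sub>m Q \<oplus>\<^sub>m R))}"

definition K00_diff :: "'a::unital_cstar_algebra mat \<Rightarrow> 'a mat \<Rightarrow> ('a mat \<times> 'a mat) set" where
  "K00_diff P Q = K00_rel `` {(P, Q)}"

definition K00 :: "('a::unital_cstar_algebra mat \<times> 'a mat) set monoid" where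
  "K00 = \<lparr>carrier = (projections \<times> projections) // K00_rel,
     mult = (\<lambda>X Y. \<Union>(P, Q)\<in>X. \<Union>(P', Q')\<in>Y. K00_diff (P \<oplus>\<^sub>m P') (Q \<oplus>\<^sub>m Q')),
     one = K00_diff (0\<^sub>m 0 0) (0\<^sub>m 0 0)\<rparr>"

definition K00_map :: "('a::unital_cstar_algebra \<Rightarrow> 'b::unital_cstar_algebra) \<Rightarrow>
    ('a mat \<times> 'a mat) set \<Rightarrow> ('b mat \<times> 'b mat) set" where
  "K00_map f X = (\<Union>(P, Q)\<in>X. K00_diff (map_mat f P) (map_mat f Q))"

definition K0 :: "('a::cstar_algebra unitization mat \<times> 'a unitization mat) set monoid" where
  "K0 = K00\<lparr>carrier := {X \<in> carrier K00. K00_map scal X = \<one>\<^bsub>K00\<^esub>}\<rparr>"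

definition K0_map :: "('a::cstar_algebra \<Rightarrow> 'b::cstar_algebra) \<Rightarrow>
    ('a unitization mat \<times> 'a unitization mat) set \<Rightarrow>
    ('b unitization mat \<times> 'b unitization mat) set" where
  "K0_map f = K00_map (map_unitization f)"

subsection \<open>The canonical generator of K0(qC)\<close>

definition P0 :: "qC unitization mat" where
  "P0 = mat_of_rows_list 2
     [[1 - Unitiz h0 0, Unitiz (star x0) 0],
      [Unitiz x0 0,     Unitiz k0 0]]"

definition qC_generator :: "(qC unitization mat \<times> qC unitization mat) set" where
  "qC_generator = K00_diff P0 (1\<^sub>m 1)"

lemma star_minus: "star (- x) = - star (x :: 'a::cstar_algebra)"
  using star_add[of x "- x"] by (simp add: star_zero eq_neg_iff_add_eq_0 add.commute)

lemma scaleC_minus: "c *\<^sub>C (- x) = - (c *\<^sub>C (x :: 'a::cstar_algebra))"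
  using scaleC_add_right[of c x "- x"] by (simp add: scaleC_zero_right eq_neg_iff_add_eq_0 add.commute)

lemma P0_projection: "P0 \<in> projections"
proof -
  have [simp]: "star h0 = h0" "star k0 = k0"
    by (transfer; auto simp: fun_eq_iff M2_star_def M2_unit_def Finite_Cartesian_Product.vec_eq_iff)+
  have abs_t: "\<bar>t - t * t\<bar> = t - t * t" if "0 \<le> t" "t \<le> 1" for t :: real
    using that by (simp add: mult_left_le)
  note qC_simps = fun_eq_iff M2_star_def M2_unit_def matrix_matrix_mult_def sum_2 forall_2
    Finite_Cartesian_Product.vec_eq_iff
  have hh: "h0 * h0 = h0 - star x0 * x0"
    by transfer (auto simp: qC_simps complex_eq_iff abs_t power2_eq_square)
  have kk: "k0 * k0 = k0 - x0 * star x0"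
    by transfer (auto simp: qC_simps complex_eq_iff abs_t power2_eq_square)
  have hx: "h0 * star x0 = star x0 * k0" and xh: "x0 * h0 = k0 * x0"
    by (transfer; auto simp: qC_simps complex_eq_iff)+
  have P0_alt: "P0 = Matrix.mat 2 2 (\<lambda>(i, j). if i = 0
      then (if j = 0 then Unitiz (- h0) 1 else Unitiz (star x0) 0)
      else (if j = 0 then Unitiz x0 0 else Unitiz k0 0))"
    unfolding P0_def by (rule eq_matI)
      (auto simp: mat_of_rows_list_def less_2_cases_iff one_unitization_def minus_unitization_def)
  have "mat_star P0 = P0"
    unfolding P0_alt by (rule eq_matI)
      (auto simp: mat_star_def star_unitization_def star_star star_minus)
  moreover have "P0 * P0 = P0"
    unfolding P0_alt by (rule eq_matI)
      (auto simp: times_mat_def scalar_prod_def less_2_cases_iff numeral_2_eq_2 unitization_defs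
        scaleC_one scaleC_zero_left scaleC_minus hh kk hx xh)
  moreover have "P0 \<in> carrier_mat 2 2"
    unfolding P0_alt by simp
  ultimately show ?thesis unfolding projections_def by blast
qed

subsection \<open>The group K1\<close>

definition unitaries :: "'a::unital_cstar_algebra mat set" where
  "unitaries = {u. \<exists>n. u \<in> carrier_mat n n \<and> mat_star u * u = 1\<^sub>m n \<and> u * mat_star u = 1\<^sub>m n}"

definition unitary_homotopic :: "'a::unital_cstar_algebra mat \<Rightarrow> 'a mat \<Rightarrow> bool" where
  "unitary_homotopic u v \<longleftrightarrow> (\<exists>n (c :: real \<Rightarrow> 'a mat).
     (\<forall>t\<in>{0..1}. c t \<in> carrier_mat n n \<inter> unitaries) \<and> c 0 = u \<and> c 1 = v \<and>
     (\<forall>i<n. \<forall>j<n. continuous_on {0..1} (\<lambda>t. c t $$ (i, j))))"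

definition K1_rel :: "('a::unital_cstar_algebra mat \<times> 'a mat) set" where
  "K1_rel = {(u, v). u \<in> unitaries \<and> v \<in> unitaries \<and>
     (\<exists>k \<ge> max (dim_row u) (dim_row v).
        unitary_homotopic (u \<oplus>\<^sub>m 1\<^sub>m (k - dim_row u)) (v \<oplus>\<^sub>m 1\<^sub>m (k - dim_row v)))}"

definition K1_class :: "'a::cstar_algebra unitization mat \<Rightarrow> 'a unitization mat set" where
  "K1_class u = K1_rel `` {u}"

definition K1 :: "'a::cstar_algebra unitization mat set monoid" where
  "K1 = \<lparr>carrier = unitaries // K1_rel,
     mult = (\<lambda>X Y. \<Union>u\<in>X. \<Union>v\<in>Y. K1_class (u \<oplus>\<^sub>m v)),
     one = K1_class (1\<^sub>m 1)\<rparr>"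

subsection \<open>The exponential map\<close>

text \<open>\<open>exp_rep \<iota> \<pi> P u\<close>: for some self-adjoint lift \<open>T\<close> of the projection \<open>P\<close>, the matrix \<open>u\<close> is
  \<open>e\<^bsup>2\<pi>iT\<^esup>\<close>, viewed in matrices over the unitization of the ideal along \<open>\<iota>\<close>.\<close>

definition exp_rep :: "('i::cstar_algebra \<Rightarrow> 'a::cstar_algebra) \<Rightarrow> ('a \<Rightarrow> 'b::cstar_algebra) \<Rightarrow>
    'b unitization mat \<Rightarrow> 'i unitization mat \<Rightarrow> bool" where
  "exp_rep \<iota> \<pi> P u \<longleftrightarrow> u \<in> unitaries \<and> (\<exists>T. mat_star T = T \<and> map_mat (map_unitization \<pi>) T = P \<and>
     map_mat (map_unitization \<iota>) u = mat_exp (map_mat (scaleC (2 * complex_of_real pi * \<i>)) T))"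

text \<open>The value at \<open>[P] - [Q]\<close> is \<open>\<partial>[P] - \<partial>[Q]\<close>; it does not depend on the choice of
  representatives and lifts, so the description below denotes the unique such element.\<close>

definition exp_map :: "('i::cstar_algebra \<Rightarrow> 'a::cstar_algebra) \<Rightarrow> ('a \<Rightarrow> 'b::cstar_algebra) \<Rightarrow>
    ('b unitization mat \<times> 'b unitization mat) set \<Rightarrow> 'i unitization mat set" where
  "exp_map \<iota> \<pi> x = (THE y. \<exists>P Q u v. (P, Q) \<in> x \<and> exp_rep \<iota> \<pi> P u \<and> exp_rep \<iota> \<pi> Q v \<and>
     y = K1_class u \<otimes>\<^bsub>K1\<^esub> inv\<^bsub>K1\<^esub> K1_class v)"

end

theory Submission
  imports Defs
begin

text \<open>The difference \<open>P\<^sub>0 - e\<^sub>1\<^sub>1\<close> has entries in the corners cut out by the orthogonal elements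
  \<open>h\<^sub>0\<close> and \<open>k\<^sub>0\<close> of qC. The images of these under \<open>\<phi>\<close> lift to orthogonal elements of \<open>A\<close>, as the
  positive and negative parts of a self-adjoint lift, and \<open>x\<^sub>0\<close> lifts to the corner between them. So
  \<open>P = \<phi>(P\<^sub>0)\<close> has a self-adjoint lift \<open>T\<close> for which the entries of \<open>e\<^sup>2\<^sup>\<pi>\<^sup>i\<^sup>T - 1\<close> again lie in
  the corners. By orthogonality, \<open>1\<close> plus the sum of these four entries is a unitary \<open>u\<close>, and rotating the
  second coordinate into the first joins \<open>e\<^sup>2\<^sup>\<pi>\<^sup>i\<^sup>T\<close> to \<open>u \<oplus> 1\<close>.

  That the class depends only on \<open>x\<close> comes from lifting, entrywise, the standard path of projections
  between \<open>P \<oplus> 0\<close> and \<open>0 \<oplus> Q\<close> for Murray--von Neumann equivalent \<open>P\<close>, \<open>Q\<close>. All analysis rests on the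
  binomial series of \<open>\<surd>(1 - z)\<close>: it writes a self-adjoint contraction as the real part of a unitary, so
  that unital *-homomorphisms are contractive, and it computes the absolute value of a self-adjoint
  element.\<close>

section \<open>Square roots and automatic continuity\<close>

text \<open>The exponential of a lift of a 2 by 2 projection is a priori only a 2 by 2 unitary. What
  allows size one is that \<open>P0\<close> minus its scalar part is supported on corners that are
  orthogonal in qC itself, and not merely by position in the matrix. With d_ij the entries of the
  exponential minus 1, the products star(d_ij) d_kl with i different from k, and d_ij star(d_kl)
  with j different from l, vanish; hence the sum of all d_ij obeys the same unitarity relations as
  the matrix of the d_ij. The scalar part diag(1, 0) of \<open>P0\<close> and the subtracted class
  of 1 exponentiate to 1 and leave no trace. \<open>exp_map\<close> is a definite description over
  all representatives and lifts, so the value at one convenient pair settles nothing before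
  uniqueness is known. The homotopies for uniqueness are built over A and pulled back to I, which
  uses that the unitized inclusion is isometric.\<close>

lemma gbinomial_nonpos_alternating:
  fixes a :: real
  assumes "a \<le> 0"
  shows "0 \<le> (- 1) ^ n * (a gchoose n)"
proof (induction n)
  case (Suc n)
  \<comment> \<open>In the recurrence the factor \<open>a - real n\<close> is nonpositive, so each
    step reverses the sign.\<close>
  have "real (Suc n) * (a gchoose Suc n) = (a - real n) * (a gchoose n)"
    using gbinomial_mult_1[of a n] by (simp add: algebra_simps)
  then have "real (Suc n) * ((- 1) ^ Suc n * (a gchoose Suc n)) =
      (real n - a) * ((- 1) ^ n * (a gchoose n))"
    by (metis (no_types, opaque_lifting) minus_diff_eq mult.left_commute mult_minus_left mult_minus1
        power_Suc)
  also have "\<dots> \<ge> 0" using Suc assms by simp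
  finally show ?case by (auto simp: zero_le_mult_iff mult_le_0_iff simp del: of_nat_Suc)
qed simp

text \<open>Past the constant term all coefficients of the series of \<surd>(1 - z) are nonpositive:
  absorption lowers the exponent 1/2 to -1/2, where the signs alternate.\<close>

lemma gbinomial_half_abs:
  assumes "0 < n"
  shows "\<bar>(1/2 :: real) gchoose n\<bar> = - ((1/2 gchoose n) * (- 1) ^ n)"
proof -
  from assms obtain k where n: "n = Suc k" using gr0_implies_Suc by blast
  have "real (Suc k) * ((1/2 :: real) gchoose Suc k) = 1/2 * ((1/2 - 1) gchoose k)"
    using gbinomial_absorption[of k "1/2 :: real"] by simp
  then have "real (Suc k) * ((- 1) ^ k * ((1/2 :: real) gchoose Suc k)) = 1/2 * ((- 1) ^ k * ((-
      1/2) gchoose k))"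
    by (simp add: mult.left_commute)
  also have "\<dots> \<ge> 0" using gbinomial_nonpos_alternating[of "- 1/2" k] by simp
  finally have nonneg: "0 \<le> (- 1) ^ k * ((1/2 :: real) gchoose Suc k)"
    by (simp add: zero_le_mult_iff)
  have "\<bar>(1/2 :: real) gchoose n\<bar> = \<bar>(- 1) ^ k * ((1/2 :: real) gchoose Suc k)\<bar>"
    by (simp add: n abs_mult)
  also have "\<dots> = (- 1) ^ k * ((1/2 :: real) gchoose Suc k)" using nonneg by (rule abs_of_nonneg)
  finally show ?thesis by (simp add: n)
qed

text \<open>These are the partial sums of the series of \<surd>(1 - z) at the endpoint z = 1. They
  telescope to \<open>(- 1) ^ m * (1/2 - 1 gchoose m)\<close>, again with a nonpositive upper
  index.\<close>

lemma gbinomial_half_partial_sum_nonneg: "0 \<le> (\<Sum>k<n. ((1/2 :: real) gchoose k) * (- 1) ^ k)"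
proof (cases n)
  case (Suc m)
  then show ?thesis
    using gbinomial_nonpos_alternating[of "1/2 - 1" m]
    by (simp add: lessThan_Suc_atMost gbinomial_sum_lower_neg)
qed simp

text \<open>The ratio of consecutive coefficients tends to 1 in absolute value, so the ratio test
  decides nothing. Since only the zeroth coefficient is positive, the sums of absolute values are 2
  minus the nonnegative endpoint sums.\<close>

lemma summable_gbinomial_half: "summable (\<lambda>n. \<bar>(1/2 :: real) gchoose n\<bar>)"
proof (rule summableI_nonneg_bounded)
  fix n
  \<comment> \<open>At \<open>k = 0\<close> the signed coefficient is 1, and 2 - 1 restores its
    absolute value.\<close>
  have "\<bar>(1/2 :: real) gchoose k\<bar> = (if k = 0 then 2 else 0) - (1/2 gchoose k) * (- 1) ^ k" for k
    by (cases "k = 0") (simp_all add: gbinomial_half_abs)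
  then have "(\<Sum>k<n. \<bar>(1/2 :: real) gchoose k\<bar>) =
      (\<Sum>k<n. if k = 0 then 2 else 0) - (\<Sum>k<n. (1/2 gchoose k) * (- 1) ^ k)"
    by (simp add: sum_subtractf)
  also have "\<dots> \<le> 2"
    using gbinomial_half_partial_sum_nonneg[of n] by (simp add: sum.delta)
  finally show "(\<Sum>k<n. \<bar>(1/2 :: real) gchoose k\<bar>) \<le> 2" .
qed simp

text \<open>As a power series in \<open>a - 1\<close> it passes through bounded unital
  homomorphisms, stays in closed unital subalgebras containing \<open>a\<close>, and inherits
  commutation and self-adjointness, all without spectral calculus.\<close>

definition msqrt :: "'a::{real_normed_algebra_1,banach} \<Rightarrow> 'a" where
  "msqrt a = (\<Sum>n. (1/2 gchoose n) *\<^sub>R (a - 1) ^ n)"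

text \<open>The binomial coefficients are absolutely summable, so the series also converges on the
  boundary of the unit ball; this is what makes \<open>msqrt (a * a)\<close> available as a modulus of every
  self-adjoint contraction.\<close>

lemma summable_msqrt:
  fixes a :: "'a::{real_normed_algebra_1,banach}"
  assumes "norm (a - 1) \<le> 1"
  shows "summable (\<lambda>n. norm ((1/2 gchoose n) *\<^sub>R (a - 1) ^ n))"
proof (rule summable_comparison_test'[OF summable_gbinomial_half])
  fix n :: nat
  have "norm ((a - 1) ^ n) \<le> 1"
    using norm_power_ineq[of "a - 1" n] power_le_one[of "norm (a - 1)" n] assms by simp
  then show "norm (norm ((1/2 gchoose n) *\<^sub>R (a - 1) ^ n)) \<le> \<bar>(1/2 :: real) gchoose n\<bar>"
    by (simp add: mult_left_le)
qed

text \<open>Absolute convergence permits the Cauchy product, whose coefficients are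
  \<open>1 gchoose k\<close> by Vandermonde; only the terms of 1 + (a - 1) survive.\<close>

lemma msqrt_square:
  fixes a :: "'a::{real_normed_algebra_1,banach}"
  assumes "norm (a - 1) \<le> 1"
  shows "msqrt a * msqrt a = a"
proof -
  have "msqrt a * msqrt a = (\<Sum>k. \<Sum>i\<le>k. ((1/2 gchoose i) *\<^sub>R (a - 1) ^ i) *
      ((1/2 gchoose (k - i)) *\<^sub>R (a - 1) ^ (k - i)))"
    unfolding msqrt_def by (rule Cauchy_product) (rule summable_msqrt[OF assms])+
  also have "\<dots> = (\<Sum>k. ((1 :: real) gchoose k) *\<^sub>R (a - 1) ^ k)"
  proof (rule suminf_cong)
    fix k
    have "(\<Sum>i\<le>k. ((1/2 gchoose i) *\<^sub>R (a - 1) ^ i) * ((1/2 gchoose (k - i)) *\<^sub>R (a - 1) ^ (k - i)))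
        = (\<Sum>i\<le>k. ((1/2 gchoose i) * (1/2 gchoose (k - i))) *\<^sub>R (a - 1) ^ k)"
      by (rule sum.cong) (simp_all flip: power_add)
    also have "\<dots> = ((1 :: real) gchoose k) *\<^sub>R (a - 1) ^ k"
      using gbinomial_Vandermonde[of "1/2 :: real" "1/2" k]
      by (simp add: atMost_atLeast0 flip: scaleR_sum_left)
    finally show "(\<Sum>i\<le>k. ((1/2 gchoose i) *\<^sub>R (a - 1) ^ i) * ((1/2 gchoose (k - i)) *\<^sub>R (a - 1) ^ (k
        - i)))
        = ((1 :: real) gchoose k) *\<^sub>R (a - 1) ^ k" .
  qed
  also have "\<dots> = (\<Sum>k\<in>{0, 1}. ((1 :: real) gchoose k) *\<^sub>R (a - 1) ^ k)"
  proof (rule suminf_finite)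
    fix k :: nat assume "k \<notin> {0, 1}"
    then have "(1 :: real) gchoose k = 0"
      using binomial_gbinomial[of 1 k, where 'a = real] by (simp add: binomial_eq_0)
    then show "((1 :: real) gchoose k) *\<^sub>R (a - 1) ^ k = 0" by simp
  qed simp
  also have "\<dots> = a" by simp
  finally show ?thesis .
qed

lemma bounded_linear_msqrt:
  fixes a :: "'a::{real_normed_algebra_1,banach}" and f :: "'a \<Rightarrow> 'b::real_normed_vector"
  assumes "bounded_linear f" "norm (a - 1) \<le> 1"
  shows "f (msqrt a) = (\<Sum>n. (1/2 gchoose n) *\<^sub>R f ((a - 1) ^ n))"
proof -
  interpret bounded_linear f by fact
  show ?thesis
    unfolding msqrt_def using suminf[OF summable_norm_cancel[OF summable_msqrt[OF assms(2)]]]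
    by (simp add: scaleR)
qed

lemma msqrt_commute:
  fixes a b :: "'a::{real_normed_algebra_1,banach}"
  assumes "norm (a - 1) \<le> 1" "a * b = b * a"
  shows "msqrt a * b = b * msqrt a"
proof -
  have "b * (a - 1) ^ n = (a - 1) ^ n * b" for n
    by (rule power_commuting_commutes[symmetric]) (simp add: algebra_simps assms)
  then show ?thesis
    using bounded_linear_msqrt[OF bounded_linear_mult_left assms(1), of b]
      bounded_linear_msqrt[OF bounded_linear_mult_right assms(1), of b] by simp
qed

lemma msqrt_hom:
  fixes f :: "'a::{real_normed_algebra_1,banach} \<Rightarrow> 'b::{real_normed_algebra_1,banach}"
  assumes "bounded_linear f" "\<And>x y. f (x * y) = f x * f y" "f 1 = 1" "norm (a - 1) \<le> 1"
  shows "f (msqrt a) = msqrt (f a)"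
proof -
  interpret bounded_linear f by fact
  have "f ((a - 1) ^ n) = (f a - 1) ^ n" for n
    by (induction n) (simp_all add: assms diff)
  then show ?thesis
    by (simp add: bounded_linear_msqrt[OF assms(1,4)] msqrt_def[of "f a"])
qed

text \<open>Squaring leaves the sign open. Since the coefficients of the positive powers of 1 - y
  are nonpositive, the sum at \<open>y\<close> dominates the sum at 0, which is a limit of
  nonnegative partial sums.\<close>

lemma msqrt_real:
  assumes "0 \<le> y" "y \<le> 1"
  shows "msqrt y = sqrt y"
proof -
  have n: "norm (y - 1) \<le> 1" using assms by simp
  have le: "((1/2 :: real) gchoose k) * (- 1) ^ k \<le> (1/2 gchoose k) * (y - 1) ^ k" for k
  proof (cases "k = 0")
    case False
    have eq: "(y - 1) ^ k = (- 1) ^ k * (1 - y) ^ k"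
      by (simp flip: power_mult_distrib)
    have "\<bar>(1/2 :: real) gchoose k\<bar> * (1 - y) ^ k \<le> \<bar>1/2 gchoose k\<bar> * 1"
      using assms by (intro mult_left_mono power_le_one) auto
    with False show ?thesis by (simp add: gbinomial_half_abs eq)
  qed simp
  have s1: "summable (\<lambda>k. ((1/2 :: real) gchoose k) * (y - 1) ^ k)"
    using summable_norm_cancel[OF summable_msqrt[OF n]] by simp
  have s2: "summable (\<lambda>k. ((1/2 :: real) gchoose k) * (- 1) ^ k)"
    using summable_norm_cancel[OF summable_msqrt[of "0 :: real"]] by simp
  have "0 \<le> (\<Sum>k. ((1/2 :: real) gchoose k) * (- 1) ^ k)"
    by (rule LIMSEQ_le_const[OF summable_LIMSEQ[OF s2]]) (use gbinomial_half_partial_sum_nonneg in blast)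
  also have "\<dots> \<le> msqrt y" unfolding msqrt_def real_scaleR_def by (rule suminf_le[OF le s2 s1])
  finally have "0 \<le> msqrt y" .
  then show ?thesis using msqrt_square[OF n] by (metis real_sqrt_abs2 abs_of_nonneg)
qed

section \<open>Self-adjoint contractions as real parts of unitaries\<close>

lemma star_scaleR: "star (r *\<^sub>R x) = r *\<^sub>R star (x :: 'a::cstar_algebra)"
  by (simp add: star_scaleC flip: scaleC_of_real)

lemma bounded_linear_star: "bounded_linear (star :: 'a::cstar_algebra \<Rightarrow> 'a)"
  by (rule bounded_linear_intro[where K = 1]) (simp_all add: star_add star_scaleR norm_star)

lemma bounded_linear_scaleC: "bounded_linear ((*\<^sub>C) c :: 'a::cstar_algebra \<Rightarrow> 'a)"
  by (rule bounded_linear_intro[where K = "cmod c"])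
    (simp_all add: scaleC_add_right scaleC_scaleR norm_scaleC mult.commute)

lemma bounded_linear_scaleC_left: "bounded_linear (\<lambda>c. c *\<^sub>C (x :: 'a::cstar_algebra))"
  by (rule bounded_linear_intro[where K = "norm x"])
    (simp_all add: scaleC_add_left scaleR_scaleC norm_scaleC scaleR_conv_of_real)

lemmas star_diff = linear_diff[OF bounded_linear.linear[OF bounded_linear_star]]
lemmas star_sum = linear_sum[OF bounded_linear.linear[OF bounded_linear_star]]
lemmas scaleC_sum = linear_sum[OF bounded_linear.linear[OF bounded_linear_scaleC]]

lemma star_one: "star 1 = (1 :: 'a::unital_cstar_algebra)"
  by (metis mult.left_neutral mult.right_neutral star_mult star_star)

lemma star_power: "star (x ^ n) = star x ^ n" for x :: "'a::unital_cstar_algebra"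
  by (induction n) (simp_all add: star_one star_mult power_commutes)

lemma star_msqrt:
  fixes a :: "'a::unital_cstar_algebra"
  assumes "norm (a - 1) \<le> 1" "star a = a"
  shows "star (msqrt a) = msqrt a"
  by (subst bounded_linear_msqrt[OF bounded_linear_star assms(1)])
    (simp add: star_power star_diff star_one assms(2) msqrt_def)

lemma unitary_norm_le:
  fixes u :: "'a::unital_cstar_algebra"
  assumes "star u * u = 1"
  shows "norm u \<le> 1"
proof -
  have "(norm u)\<^sup>2 = 1" using cstar_identity[of u] assms by simp
  then show ?thesis using norm_ge_zero[of u] by (auto simp: power2_eq_1_iff)
qed

text \<open>\<open>a + ic\<close> is unitary, hence its real and imaginary parts are contractions.\<close>

lemma norm_le_if_squares_sum_one:
  fixes a c :: "'a::unital_cstar_algebra"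
  assumes "star a = a" "star c = c" "a * c = c * a" "a * a + c * c = 1"
  shows "norm a \<le> 1"
proof -
  define u where "u = a + \<i> *\<^sub>C c"
  have su: "star u = a + (- \<i>) *\<^sub>C c"
    by (simp add: u_def star_add star_scaleC assms)
  have uu: "star u * u = 1" "star (star u) * star u = 1"
    unfolding su unfolding u_def using assms
    by (simp_all add: star_add star_scaleC algebra_simps mult_scaleC_left mult_scaleC_right scaleC_scaleC
        scaleC_add_right scaleC_one flip: scaleC_add_left)
      (simp_all add: scaleC_one scaleC_zero_left flip: scaleC_add_left add.assoc)
  have "\<i> *\<^sub>C c + (- \<i>) *\<^sub>C c = 0" by (simp add: scaleC_zero_left flip: scaleC_add_left)
  then have "u + star u = 2 *\<^sub>R a" unfolding su unfolding u_def by (simp add: scaleR_2 algebra_simps)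
  then have "2 * norm a = norm (u + star u)" by simp
  also have "\<dots> \<le> 1 + 1"
    by (rule norm_triangle_le) (intro add_mono unitary_norm_le uu)
  finally show ?thesis by simp
qed

text \<open>Converse to \<open>norm_le_if_squares_sum_one\<close>. Being contractive is thus
  expressed by algebraic relations between \<open>a\<close> and a second element \<open>c\<close>,
  and homomorphisms preserve these; this is how norm bounds are transported.\<close>

lemma sqrt_complement:
  fixes a :: "'a::unital_cstar_algebra"
  assumes "star a = a" "norm a \<le> 1"
  defines "c \<equiv> msqrt (1 - a * a)"
  shows "star c = c" "a * c = c * a" "a * a + c * c = 1"
proof -
  have "norm (a * a) \<le> 1"
    using norm_mult_ineq[of a a] mult_le_one[OF assms(2) norm_ge_zero assms(2)] by linarith
  then have n: "norm (1 - a * a - 1) \<le> 1" by simp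
  show "star c = c"
    unfolding c_def by (rule star_msqrt[OF n]) (simp add: star_diff star_one star_mult assms)
  show "a * c = c * a"
    unfolding c_def by (rule msqrt_commute[OF n, symmetric]) (simp add: algebra_simps)
  show "a * a + c * c = 1" unfolding c_def by (simp add: msqrt_square[OF n])
qed

text \<open>The roles of \<open>a\<close> and its complement \<open>c\<close> can be exchanged, so
  \<open>c\<close> is a contraction too, and a * a - 1 = - c * c. This places \<open>a * a\<close>
  in the domain of \<open>msqrt\<close>.\<close>

lemma norm_one_minus_square_le:
  fixes a :: "'a::unital_cstar_algebra"
  assumes "star a = a" "norm a \<le> 1"
  shows "norm (a * a - 1) \<le> 1"
proof -
  let ?c = "msqrt (1 - a * a)"
  note c = sqrt_complement[OF assms]
  have "norm ?c \<le> 1"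
    by (rule norm_le_if_squares_sum_one[of _ a]) (use c assms in \<open>simp_all add: add.commute\<close>)
  then have "norm (?c * ?c) \<le> 1"
    using norm_mult_ineq[of ?c ?c] mult_le_one[of "norm ?c" "norm ?c"] by simp
  moreover have "a * a - 1 = - (?c * ?c)" using c(3) by (simp add: algebra_simps)
  ultimately show ?thesis by simp
qed

section \<open>Norms under *-homomorphisms\<close>

lemma
  assumes "star_hom f"
  shows star_hom_add: "f (x + y) = f x + f y"
    and star_hom_scaleC: "f (c *\<^sub>C x) = c *\<^sub>C f x"
    and star_hom_mult: "f (x * y) = f x * f y"
    and star_hom_star: "f (star x) = star (f x)"
  using assms unfolding star_hom_def by auto

lemma star_hom_scaleR: "star_hom f \<Longrightarrow> f (r *\<^sub>R x) = r *\<^sub>R f x"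
  by (simp add: star_hom_scaleC flip: scaleC_of_real)

lemma star_hom_linear: "star_hom f \<Longrightarrow> linear f"
  by (rule linearI) (simp_all add: star_hom_add star_hom_scaleR)

lemma star_hom_zero: "star_hom f \<Longrightarrow> f 0 = 0"
  using linear_0[OF star_hom_linear] .

lemma star_hom_diff: "star_hom f \<Longrightarrow> f (x - y) = f x - f y"
  using linear_diff[OF star_hom_linear] .

lemma star_hom_id: "star_hom (\<lambda>x. x)"
  by (simp add: star_hom_def)

text \<open>The C*-identity reduces the comparison to the self-adjoint element
  \<open>star x * x\<close>, which is then rescaled. With two homomorphisms the argument serves both
  directions: \<open>g\<close> the identity gives contractivity, \<open>f\<close> the identity gives
  the lower bound.\<close>

lemma norm_le_if_selfadjoint_norm_le_one:
  fixes f :: "'a::cstar_algebra \<Rightarrow> 'b::cstar_algebra" and g :: "'a \<Rightarrow> 'c::cstar_algebra"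
  assumes f: "star_hom f" and g: "star_hom g" and "\<And>x. g x = 0 \<Longrightarrow> f x = 0"
    and le_one: "\<And>x. star x = x \<Longrightarrow> norm (g x) \<le> 1 \<Longrightarrow> norm (f x) \<le> 1"
  shows "norm (f x) \<le> norm (g x)"
proof (cases "g x = 0")
  case False
  let ?y = "star x * x"
  have ny: "norm (g ?y) = (norm (g x))\<^sup>2"
    using g by (simp add: star_hom_mult star_hom_star cstar_identity)
  have "norm (f (inverse (norm (g ?y)) *\<^sub>R ?y)) \<le> 1"
    by (rule le_one) (use False ny g in \<open>simp_all add: star_scaleR star_mult star_star star_hom_scaleR\<close>)
  then have "norm (f ?y) \<le> norm (g ?y)" using False ny f by (simp add: star_hom_scaleR field_simps)
  then have "(norm (f x))\<^sup>2 \<le> (norm (g x))\<^sup>2"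
    using ny f by (simp add: star_hom_mult star_hom_star cstar_identity)
  then show ?thesis by (simp add: power2_le_iff_abs_le)
qed (use assms in simp)

lemma unital_star_hom_contractive:
  fixes f :: "'a::unital_cstar_algebra \<Rightarrow> 'b::unital_cstar_algebra"
  assumes f: "star_hom f" "f 1 = 1"
  shows "norm (f x) \<le> norm x"
proof (rule norm_le_if_selfadjoint_norm_le_one[OF f(1) star_hom_id])
  fix a :: 'a assume a: "star a = a" "norm a \<le> 1"
  note c = sqrt_complement[OF a]
  show "norm (f a) \<le> 1"
    by (rule norm_le_if_squares_sum_one[of _ "f (msqrt (1 - a * a))"])
      (use a c f in \<open>simp_all flip: star_hom_star star_hom_mult star_hom_add\<close>)
qed (use f star_hom_zero in simp)

lemma unital_star_hom_bounded_linear: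
  fixes f :: "'a::unital_cstar_algebra \<Rightarrow> 'b::unital_cstar_algebra"
  assumes f: "star_hom f" "f 1 = 1"
  shows "bounded_linear f"
  by (rule bounded_linear_intro[where K = 1])
    (use f unital_star_hom_contractive[OF f] in \<open>simp_all add: star_hom_add star_hom_scaleR\<close>)

lemma msqrt_in_closed:
  fixes a :: "'a::{real_normed_algebra_1,banach}"
  assumes "norm (a - 1) \<le> 1" "closed S" "a - 1 \<in> S" "1 \<in> S"
    and "\<And>x y. x \<in> S \<Longrightarrow> y \<in> S \<Longrightarrow> x + y \<in> S" "\<And>x y. x \<in> S \<Longrightarrow> y \<in> S \<Longrightarrow> x * y \<in> S"
    and "\<And>r x. x \<in> S \<Longrightarrow> r *\<^sub>R x \<in> S"
  shows "msqrt a \<in> S"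
proof -
  have pow: "(a - 1) ^ n \<in> S" for n by (induction n) (auto intro: assms)
  have "0 \<in> S" using assms(7)[OF assms(4), of 0] by simp
  then have "(\<Sum>k<n. (1/2 gchoose k) *\<^sub>R (a - 1) ^ k) \<in> S" for n
    by (induction n) (auto intro: assms pow)
  then show ?thesis
    unfolding msqrt_def
    by (rule closed_sequentially[OF assms(2) _ summable_LIMSEQ[OF summable_norm_cancel[OF
        summable_msqrt[OF assms(1)]]]])
qed

text \<open>The contractivity argument run backwards. The complement of \<open>f a\<close> is a
  limit of polynomials in \<open>f a\<close>, so closedness keeps it in the range; its preimage
  \<open>k\<close> satisfies the same relations with \<open>a\<close> by injectivity.\<close>

lemma unital_star_hom_inj_isometric:
  fixes f :: "'a::unital_cstar_algebra \<Rightarrow> 'b::unital_cstar_algebra"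
  assumes f: "star_hom f" "f 1 = 1" and "inj f" "closed (range f)"
  shows "norm (f x) = norm x"
proof (rule antisym[OF unital_star_hom_contractive[OF f]])
  have le: "norm a \<le> 1" if a: "star a = a" "norm (f a) \<le> 1" for a
  proof -
    have fa: "star (f a) = f a" using a f by (simp flip: star_hom_star)
    note c = sqrt_complement[OF fa a(2)]
    have "msqrt (1 - f a * f a) \<in> range f"
    proof (rule msqrt_in_closed)
      have "norm (f a * f a) \<le> 1"
        using norm_mult_ineq[of "f a" "f a"] mult_le_one[OF a(2) norm_ge_zero a(2)] by linarith
      then show "norm (1 - f a * f a - 1) \<le> 1" by simp
      have "1 - f a * f a - 1 = f ((- 1) *\<^sub>R (a * a))"
        by (simp only: star_hom_scaleR[OF f(1)] star_hom_mult[OF f(1)]) simp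
      then show "1 - f a * f a - 1 \<in> range f" by blast
      show "1 \<in> range f" using f(2) by (metis rangeI)
    qed (use assms in \<open>auto simp flip: star_hom_add star_hom_mult star_hom_scaleR\<close>)
    then obtain k where k: "f k = msqrt (1 - f a * f a)" by (metis imageE)
    show ?thesis
    proof (rule norm_le_if_squares_sum_one[of _ k])
      show "star k = k" "a * k = k * a" "a * a + k * k = 1"
        by (rule injD[OF \<open>inj f\<close>]; use c k f in \<open>simp add: star_hom_star star_hom_mult star_hom_add\<close>)+
    qed (rule a)
  qed
  show "norm x \<le> norm (f x)"
    by (rule norm_le_if_selfadjoint_norm_le_one[OF star_hom_id f(1)])
      (use le \<open>inj f\<close> star_hom_zero[OF f(1)] in \<open>auto, metis injD\<close>)
qed

section \<open>Matrices over a unital C*-algebra\<close>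

lemma index_mult_mat_sum:
  assumes "A \<in> carrier_mat n m" "B \<in> carrier_mat m k" "i < n" "j < k"
  shows "(A * B) $$ (i, j) = (\<Sum>l<m. A $$ (i, l) * B $$ (l, j))"
  using assms by (simp add: scalar_prod_def lessThan_atLeast0)

lemma mat_star_carrier [simp]: "A \<in> carrier_mat n m \<Longrightarrow> mat_star A \<in> carrier_mat m n"
  by (simp add: mat_star_def)

lemma mat_star_dim [simp]: "dim_row (mat_star A) = dim_col A" "dim_col (mat_star A) = dim_row A"
  by (simp_all add: mat_star_def)

lemma mat_star_index [simp]: "i < dim_col A \<Longrightarrow> j < dim_row A \<Longrightarrow> mat_star A $$ (i, j) = star (A $$ (j, i))"
  by (simp add: mat_star_def)

lemma mat_star_mat_star [simp]: "mat_star (mat_star A) = A"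
  by (rule eq_matI) (simp_all add: star_star)

lemma mat_star_mult:
  assumes "A \<in> carrier_mat n m" "B \<in> carrier_mat m k"
  shows "mat_star (A * B) = mat_star B * mat_star A"
proof (rule eq_matI)
  fix i j assume "i < dim_row (mat_star B * mat_star A)" "j < dim_col (mat_star B * mat_star A)"
  with assms have ij: "i < k" "j < n" by auto
  have "mat_star (A * B) $$ (i, j) = star (\<Sum>l<m. A $$ (j, l) * B $$ (l, i))"
    using assms ij by (simp add: index_mult_mat_sum[OF assms ij(2,1)] del: index_mult_mat(1))
  also have "\<dots> = (\<Sum>l<m. mat_star B $$ (i, l) * mat_star A $$ (l, j))"
    using assms ij by (simp add: star_sum star_mult)
  also have "\<dots> = (mat_star B * mat_star A) $$ (i, j)"
    using index_mult_mat_sum[OF mat_star_carrier[OF assms(2)] mat_star_carrier[OF assms(1)] ij] by simp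
  finally show "mat_star (A * B) $$ (i, j) = (mat_star B * mat_star A) $$ (i, j)" .
qed (use assms in auto)

lemma mat_star_one [simp]: "mat_star (1\<^sub>m n :: 'a::unital_cstar_algebra mat) = 1\<^sub>m n"
  by (rule eq_matI) (simp_all add: star_one star_zero)

lemma mat_star_zero [simp]: "mat_star (0\<^sub>m n m :: 'a::cstar_algebra mat) = 0\<^sub>m m n"
  by (rule eq_matI) (simp_all add: star_zero)

lemma mat_star_four_block:
  assumes "A \<in> carrier_mat n1 m1" "B \<in> carrier_mat n1 m2" "C \<in> carrier_mat n2 m1" "D \<in> carrier_mat n2 m2"
  shows "mat_star (four_block_mat A B C D) =
    four_block_mat (mat_star A) (mat_star C) (mat_star B) (mat_star D)"
  by (rule eq_matI) (use assms in auto)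

lemma map_mat_scaleC_mult:
  fixes A B :: "'a::unital_cstar_algebra mat"
  assumes "A \<in> carrier_mat n m" "B \<in> carrier_mat m k"
  shows "map_mat ((*\<^sub>C) a) A * map_mat ((*\<^sub>C) b) B = map_mat ((*\<^sub>C) (a * b)) (A * B)"
  by (rule eq_matI)
    (use assms in \<open>auto simp: scalar_prod_def mult_scaleC_left mult_scaleC_right scaleC_scaleC
        scaleC_sum mult.commute\<close>)

lemma map_mat_hom_mult:
  fixes f :: "'a::semiring_0 \<Rightarrow> 'b::semiring_0"
  assumes f: "\<And>x y. f (x + y) = f x + f y" "\<And>x y. f (x * y) = f x * f y" "f 0 = 0"
    and AB: "A \<in> carrier_mat n m" "B \<in> carrier_mat m k"
  shows "map_mat f (A * B) = map_mat f A * map_mat f B"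
proof -
  have "f (sum g S) = (\<Sum>x\<in>S. f (g x))" for g and S :: "nat set"
    by (induction S rule: infinite_finite_induct) (simp_all add: f)
  then show ?thesis
    by (intro eq_matI) (use AB in \<open>auto simp: scalar_prod_def f\<close>)
qed

lemma map_mat_star_hom_mult:
  assumes "star_hom f" "A \<in> carrier_mat n m" "B \<in> carrier_mat m k"
  shows "map_mat f (A * B) = map_mat f A * map_mat f B"
  by (rule map_mat_hom_mult[OF _ _ _ assms(2,3)])
    (use assms(1) in \<open>simp_all add: star_hom_add star_hom_mult star_hom_zero\<close>)

lemma map_mat_star_hom_star: "star_hom f \<Longrightarrow> map_mat f (mat_star A) = mat_star (map_mat f A)"
  by (rule eq_matI) (simp_all add: star_hom_star)

lemma map_mat_one: "f 0 = 0 \<Longrightarrow> f 1 = 1 \<Longrightarrow> map_mat f (1\<^sub>m n) = 1\<^sub>m n"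
  by (rule eq_matI) simp_all

lemma map_mat_inj:
  assumes "inj f" "map_mat f A = map_mat f B"
  shows "A = B"
proof (rule eq_matI)
  show dims: "dim_row A = dim_row B" "dim_col A = dim_col B"
    using arg_cong[OF assms(2), of dim_row] arg_cong[OF assms(2), of dim_col] by simp_all
  fix i j assume "i < dim_row B" "j < dim_col B"
  then have "f (A $$ (i, j)) = f (B $$ (i, j))"
    using arg_cong[OF assms(2), of "\<lambda>M. M $$ (i, j)"] dims by simp
  then show "A $$ (i, j) = B $$ (i, j)" by (rule injD[OF assms(1)])
qed

lemma mat_sum_dim [simp]:
  "dim_row (A \<oplus>\<^sub>m B) = dim_row A + dim_row B" "dim_col (A \<oplus>\<^sub>m B) = dim_col A + dim_col B"
  by (simp_all add: mat_sum_def)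

lemma mat_sum_carrier [simp]:
  "A \<in> carrier_mat n1 m1 \<Longrightarrow> B \<in> carrier_mat n2 m2 \<Longrightarrow> A \<oplus>\<^sub>m B \<in> carrier_mat (n1 + n2) (m1 + m2)"
  by (simp add: mat_sum_def)

lemma mat_sum_assoc: "(A \<oplus>\<^sub>m B) \<oplus>\<^sub>m C = A \<oplus>\<^sub>m (B \<oplus>\<^sub>m C)"
  unfolding mat_sum_def by (rule assoc_four_block_mat[symmetric])

lemma mat_sum_one [simp]: "1\<^sub>m n \<oplus>\<^sub>m 1\<^sub>m m = (1\<^sub>m (n + m) :: 'a::semiring_1 mat)"
  unfolding mat_sum_def by simp

lemma mat_sum_one_0 [simp]: "A \<oplus>\<^sub>m 1\<^sub>m 0 = A"
  unfolding mat_sum_def by (rule eq_matI) auto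

lemma mat_sum_mult:
  fixes A B C D :: "'a::semiring_1 mat"
  assumes "A \<in> carrier_mat n n" "B \<in> carrier_mat m m" "C \<in> carrier_mat n n" "D \<in> carrier_mat m m"
  shows "(A \<oplus>\<^sub>m B) * (C \<oplus>\<^sub>m D) = (A * C) \<oplus>\<^sub>m (B * D)"
  unfolding mat_sum_def using assms
  by (subst mult_four_block_mat[of _ n n _ m _ m _ _ n _ m]) auto

lemma mat_star_sum:
  "A \<in> carrier_mat n n \<Longrightarrow> B \<in> carrier_mat m m \<Longrightarrow> mat_star (A \<oplus>\<^sub>m B) = mat_star A \<oplus>\<^sub>m mat_star B"
  unfolding mat_sum_def by (subst mat_star_four_block[of _ n n _ m _ m]) (auto)

lemma map_mat_sum: "f 0 = 0 \<Longrightarrow> map_mat f (A \<oplus>\<^sub>m B) = map_mat f A \<oplus>\<^sub>m map_mat f B"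
  by (rule eq_matI) (auto simp: mat_sum_def)


section \<open>The group K1\<close>

definition unitaries_dim :: "nat \<Rightarrow> 'a::unital_cstar_algebra mat set" where
  "unitaries_dim n = {u \<in> carrier_mat n n. mat_star u * u = 1\<^sub>m n \<and> u * mat_star u = 1\<^sub>m n}"

lemma unitaries_dimD:
  assumes "u \<in> unitaries_dim n"
  shows "u \<in> carrier_mat n n" "mat_star u * u = 1\<^sub>m n" "u * mat_star u = 1\<^sub>m n"
  using assms by (simp_all add: unitaries_dim_def)

lemma unitaries_dim_eq: "carrier_mat n n \<inter> unitaries = unitaries_dim n"
  unfolding unitaries_def unitaries_dim_def using carrier_matD(1) by blast

lemma unitaries_iff: "u \<in> unitaries \<longleftrightarrow> u \<in> unitaries_dim (dim_row u)"
  unfolding unitaries_def unitaries_dim_def using carrier_matD(1) by blast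

lemma unitaries_dim_unitaries: "u \<in> unitaries_dim n \<Longrightarrow> u \<in> unitaries"
  using unitaries_dim_eq by blast

lemma one_unitaries_dim [simp]: "1\<^sub>m n \<in> unitaries_dim n"
  by (simp add: unitaries_dim_def)

lemma mat_star_unitaries_dim: "u \<in> unitaries_dim n \<Longrightarrow> mat_star u \<in> unitaries_dim n"
  by (simp add: unitaries_dim_def)

lemma mult_unitaries_dim:
  assumes "u \<in> unitaries_dim n" "v \<in> unitaries_dim n"
  shows "u * v \<in> unitaries_dim n"
proof -
  note u = unitaries_dimD[OF assms(1)] and v = unitaries_dimD[OF assms(2)]
  note c = u(1) v(1) mat_star_carrier[OF u(1)] mat_star_carrier[OF v(1)]
  have "(mat_star v * mat_star u) * (u * v) = mat_star v * ((mat_star u * u) * v)"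
    using c by (simp add: assoc_mult_mat[of _ n n _ n _ n] del: u v)
  moreover have "(u * v) * (mat_star v * mat_star u) = u * ((v * mat_star v) * mat_star u)"
    using c by (simp add: assoc_mult_mat[of _ n n _ n _ n] mult_carrier_mat[of _ n n] del: u v)
  ultimately show ?thesis
    using c by (simp add: unitaries_dim_def mat_star_mult[OF u(1) v(1)] u v mult_carrier_mat[of _ n n])
qed

lemma sum_unitaries_dim:
  assumes "u \<in> unitaries_dim n" "v \<in> unitaries_dim m"
  shows "u \<oplus>\<^sub>m v \<in> unitaries_dim (n + m)"
proof -
  note u = unitaries_dimD[OF assms(1)] and v = unitaries_dimD[OF assms(2)]
  show ?thesis
    using u v
    by (simp add: unitaries_dim_def mat_star_sum[OF u(1) v(1)] mat_sum_mult[of _ n _ m])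
qed

section \<open>Paths of unitaries and operations on them\<close>

definition unitary_path :: "nat \<Rightarrow> (real \<Rightarrow> 'a::unital_cstar_algebra mat) \<Rightarrow> bool" where
  "unitary_path n c \<longleftrightarrow> (\<forall>t\<in>{0..1}. c t \<in> unitaries_dim n) \<and>
    (\<forall>i<n. \<forall>j<n. continuous_on {0..1} (\<lambda>t. c t $$ (i, j)))"

lemma unitary_pathD:
  assumes "unitary_path n c"
  shows "t \<in> {0..1} \<Longrightarrow> c t \<in> unitaries_dim n"
    and "t \<in> {0..1} \<Longrightarrow> c t \<in> carrier_mat n n"
    and "i < n \<Longrightarrow> j < n \<Longrightarrow> continuous_on {0..1} (\<lambda>t. c t $$ (i, j))"
  using assms unfolding unitary_path_def by (auto intro: unitaries_dimD(1))

lemma unitary_homotopicI: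
  fixes c :: "real \<Rightarrow> 'a::unital_cstar_algebra mat"
  assumes "\<And>t. t \<in> {0..1} \<Longrightarrow> c t \<in> unitaries_dim n" "c 0 = u" "c 1 = v"
    and "\<And>i j. i < n \<Longrightarrow> j < n \<Longrightarrow> continuous_on {0..1} (\<lambda>t. c t $$ (i, j))"
  shows "unitary_homotopic u v"
  unfolding unitary_homotopic_def unitaries_dim_eq
  by (rule exI[of _ n], rule exI[of _ c]) (use assms in simp)

lemma unitary_homotopicE:
  assumes "unitary_homotopic u v" "u \<in> carrier_mat n n"
  obtains c where "unitary_path n c" "c 0 = u" "c 1 = v"
proof -
  obtain m c where c: "unitary_path m c" "c 0 = u" "c 1 = v"
    using assms(1) unfolding unitary_homotopic_def unitary_path_def unitaries_dim_eq by force
  have "u \<in> carrier_mat m m" using c(2) unitary_pathD(2)[OF c(1), of 0] by simp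
  with assms(2) have "m = n" by auto
  with c that show ?thesis by blast
qed

lemma unitary_homotopic_refl:
  assumes "u \<in> unitaries_dim n"
  shows "unitary_homotopic u u"
  by (rule unitary_homotopicI[where c = "\<lambda>_. u"]) (use assms in auto)

lemma unitary_homotopic_dim:
  assumes "unitary_homotopic u v" "u \<in> carrier_mat n n"
  shows "v \<in> unitaries_dim n" "u \<in> unitaries_dim n"
  by (rule unitary_homotopicE[OF assms]; use unitary_pathD(1)[of n _ 0] unitary_pathD(1)[of n _ 1]
      in force)+

lemma unitary_homotopic_sym:
  assumes "unitary_homotopic u v" "u \<in> carrier_mat n n"
  shows "unitary_homotopic v u"
proof -
  obtain c where c: "unitary_path n c" "c 0 = u" "c 1 = v"
    by (rule unitary_homotopicE[OF assms])
  show ?thesis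
  proof (rule unitary_homotopicI[where c = "\<lambda>t. c (1 - t)"])
    fix i j assume "i < n" "j < n"
    then show "continuous_on {0..1} (\<lambda>t. c (1 - t) $$ (i, j))"
      by (intro continuous_on_compose2[OF unitary_pathD(3)[OF c(1)]] continuous_intros) auto
  qed (use c unitary_pathD(1)[OF c(1)] in auto)
qed

lemma unitary_homotopic_trans:
  assumes "unitary_homotopic u v" "unitary_homotopic v w" "u \<in> carrier_mat n n"
  shows "unitary_homotopic u w"
proof -
  obtain c where c: "unitary_path n c" "c 0 = u" "c 1 = v"
    by (rule unitary_homotopicE[OF assms(1,3)])
  have "v \<in> carrier_mat n n" using unitary_homotopic_dim(1)[OF assms(1,3)] by (rule unitaries_dimD)
  then obtain d where d: "unitary_path n d" "d 0 = v" "d 1 = w"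
    by (rule unitary_homotopicE[OF assms(2)])
  show ?thesis
  proof (rule unitary_homotopicI[where c = "\<lambda>t. if t \<le> 1/2 then c (2 * t) else d (2 * t - 1)"])
    fix i j assume ij: "i < n" "j < n"
    have "continuous_on {0..1} ((\<lambda>t. c t $$ (i, j)) +++ (\<lambda>t. d t $$ (i, j)))"
      by (rule continuous_on_joinpaths[OF unitary_pathD(3)[OF c(1) ij] unitary_pathD(3)[OF d(1) ij]])
        (simp add: pathfinish_def pathstart_def c d)
    then show "continuous_on {0..1} (\<lambda>t. (if t \<le> 1/2 then c (2 * t) else d (2 * t - 1)) $$ (i, j))"
      by (simp add: joinpaths_def if_distrib[of "\<lambda>A. A $$ (i, j)"])
  qed (use c d unitary_pathD(1)[OF c(1)] unitary_pathD(1)[OF d(1)] in auto)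
qed

lemma continuous_on_mult_mat:
  fixes c d :: "real \<Rightarrow> 'a::real_normed_algebra mat"
  assumes "\<And>t. t \<in> S \<Longrightarrow> c t \<in> carrier_mat n m" "\<And>t. t \<in> S \<Longrightarrow> d t \<in> carrier_mat m k"
    and "\<And>l. l < m \<Longrightarrow> continuous_on S (\<lambda>t. c t $$ (i, l))"
    and "\<And>l. l < m \<Longrightarrow> continuous_on S (\<lambda>t. d t $$ (l, j))"
    and ij: "i < n" "j < k"
  shows "continuous_on S (\<lambda>t. (c t * d t) $$ (i, j))"
proof -
  have "continuous_on S (\<lambda>t. \<Sum>l<m. c t $$ (i, l) * d t $$ (l, j))"
    by (intro continuous_intros assms) auto
  moreover have "\<And>t. t \<in> S \<Longrightarrow> (c t * d t) $$ (i, j) = (\<Sum>l<m. c t $$ (i, l) * d t $$ (l, j))"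
    by (rule index_mult_mat_sum[OF assms(1,2) ij])
  ultimately show ?thesis by (subst continuous_on_cong[OF refl]) auto
qed

lemma continuous_on_four_block:
  assumes "\<And>t. t \<in> S \<Longrightarrow> A t \<in> carrier_mat n1 m1" "\<And>t. t \<in> S \<Longrightarrow> D t \<in> carrier_mat n2 m2"
    and "\<And>i j. i < n1 \<Longrightarrow> j < m1 \<Longrightarrow> continuous_on S (\<lambda>t. A t $$ (i, j))"
    and "\<And>i j. i < n1 \<Longrightarrow> j < m2 \<Longrightarrow> continuous_on S (\<lambda>t. B t $$ (i, j))"
    and "\<And>i j. i < n2 \<Longrightarrow> j < m1 \<Longrightarrow> continuous_on S (\<lambda>t. C t $$ (i, j))"
    and "\<And>i j. i < n2 \<Longrightarrow> j < m2 \<Longrightarrow> continuous_on S (\<lambda>t. D t $$ (i, j))"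
    and ij: "i < n1 + n2" "j < m1 + m2"
  shows "continuous_on S (\<lambda>t. four_block_mat (A t) (B t) (C t) (D t) $$ (i, j))"
proof -
  have "continuous_on S (\<lambda>t. if i < n1
    then if j < m1 then A t $$ (i, j) else B t $$ (i, j - m1)
    else if j < m1 then C t $$ (i - n1, j) else D t $$ (i - n1, j - m1))"
    using ij by (cases "i < n1"; cases "j < m1") (auto intro!: assms)
  moreover have "\<And>t. t \<in> S \<Longrightarrow> four_block_mat (A t) (B t) (C t) (D t) $$ (i, j) = (if i < n1
    then if j < m1 then A t $$ (i, j) else B t $$ (i, j - m1)
    else if j < m1 then C t $$ (i - n1, j) else D t $$ (i - n1, j - m1))"
    using ij by (simp add: carrier_matD[OF assms(1)] carrier_matD[OF assms(2)])
  ultimately show ?thesis by (subst continuous_on_cong[OF refl]) auto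
qed

lemma unitary_homotopic_mult:
  assumes "unitary_homotopic u u'" "unitary_homotopic v v'" "u \<in> carrier_mat n n" "v \<in> carrier_mat n n"
  shows "unitary_homotopic (u * v) (u' * v')"
proof -
  obtain c where c: "unitary_path n c" "c 0 = u" "c 1 = u'"
    by (rule unitary_homotopicE[OF assms(1,3)])
  obtain d where d: "unitary_path n d" "d 0 = v" "d 1 = v'"
    by (rule unitary_homotopicE[OF assms(2,4)])
  show ?thesis
    by (rule unitary_homotopicI[where c = "\<lambda>t. c t * d t" and n = n])
      (use c d unitary_pathD[OF c(1)] unitary_pathD[OF d(1)] in
        \<open>auto intro!: mult_unitaries_dim continuous_on_mult_mat[of _ _ n n _ n]\<close>)
qed

lemma unitary_homotopic_sum:
  assumes "unitary_homotopic u u'" "unitary_homotopic v v'" "u \<in> carrier_mat n n" "v \<in> carrier_mat m m"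
  shows "unitary_homotopic (u \<oplus>\<^sub>m v) (u' \<oplus>\<^sub>m v')"
proof -
  obtain c where c: "unitary_path n c" "c 0 = u" "c 1 = u'"
    by (rule unitary_homotopicE[OF assms(1,3)])
  obtain d where d: "unitary_path m d" "d 0 = v" "d 1 = v'"
    by (rule unitary_homotopicE[OF assms(2,4)])
  note cd = unitary_pathD(2)[OF c(1)] unitary_pathD(2)[OF d(1)]
  show ?thesis
  proof (rule unitary_homotopicI[where c = "\<lambda>t. c t \<oplus>\<^sub>m d t" and n = "n + m"])
    fix i j assume ij: "i < n + m" "j < n + m"
    have "continuous_on {0..1} (\<lambda>t. four_block_mat (c t) (0\<^sub>m n m) (0\<^sub>m m n) (d t) $$ (i, j))"
      by (rule continuous_on_four_block[of _ _ n n _ m m]) (use cd unitary_pathD(3)[OF c(1)]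
          unitary_pathD(3)[OF d(1)] ij in auto)
    then show "continuous_on {0..1} (\<lambda>t. (c t \<oplus>\<^sub>m d t) $$ (i, j))"
      by (rule continuous_on_eq) (simp add: mat_sum_def carrier_matD[OF cd(1)] carrier_matD[OF cd(2)])
  qed (use c d unitary_pathD(1)[OF c(1)] unitary_pathD(1)[OF d(1)] in \<open>auto intro: sum_unitaries_dim\<close>)
qed

text \<open>A self-adjoint unitary \<open>J\<close> is joined to \<open>1\<close> by the unitaries \<open>(1 + z)/2 + (1 - z)/2 J\<close> with
  \<open>z\<close> on the upper half circle.\<close>

lemma unitary_homotopic_conj_symmetry:
  fixes u J :: "'a::unital_cstar_algebra mat"
  assumes u: "u \<in> unitaries_dim n" and J: "J \<in> carrier_mat n n" "mat_star J = J" "J * J = 1\<^sub>m n"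
  shows "unitary_homotopic u (J * u * J)"
proof -
  define \<alpha> \<beta> :: "real \<Rightarrow> complex" where "\<alpha> t = (1 + cis (pi * t)) / 2" and "\<beta> t = (1 - cis (pi * t))
      / 2" for t
  define W where "W t = map_mat ((*\<^sub>C) (\<alpha> t)) (1\<^sub>m n) + map_mat ((*\<^sub>C) (\<beta> t)) J" for t
  have W: "W t \<in> carrier_mat n n" for t using J(1) by (simp add: W_def)
  have sW: "mat_star (W t) = map_mat ((*\<^sub>C) (cnj (\<alpha> t))) (1\<^sub>m n) + map_mat ((*\<^sub>C) (cnj (\<beta> t))) J" for t
  proof (rule eq_matI)
    fix i j assume "i < dim_row (map_mat ((*\<^sub>C) (cnj (\<alpha> t))) (1\<^sub>m n) + map_mat ((*\<^sub>C) (cnj (\<beta> t))) J)"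
      "j < dim_col (map_mat ((*\<^sub>C) (cnj (\<alpha> t))) (1\<^sub>m n) + map_mat ((*\<^sub>C) (cnj (\<beta> t))) J)"
    with J(1) have ij: "i < n" "j < n" by auto
    have "star (J $$ (j, i)) = mat_star J $$ (i, j)" using J(1) ij by simp
    then have "star (J $$ (j, i)) = J $$ (i, j)" by (simp only: J(2))
    then show "mat_star (W t) $$ (i, j) =
        (map_mat ((*\<^sub>C) (cnj (\<alpha> t))) (1\<^sub>m n) + map_mat ((*\<^sub>C) (cnj (\<beta> t))) J) $$ (i, j)"
      using J(1) ij carrier_matD[OF W] by (simp add: W_def star_add star_scaleC star_one star_zero)
  qed (use J(1) carrier_matD[OF W] in auto)
  \<comment> \<open>Because \<open>J\<close> squares to 1, these combinations multiply as in the
    group algebra of the group of order two, and unitarity of \<open>W t\<close> becomes two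
    identities between coefficients.\<close>
  have prod: "(map_mat ((*\<^sub>C) a) (1\<^sub>m n) + map_mat ((*\<^sub>C) b) J) * (map_mat ((*\<^sub>C) c) (1\<^sub>m n) +
      map_mat ((*\<^sub>C) d) J)
      = map_mat ((*\<^sub>C) (a * c + b * d)) (1\<^sub>m n) + map_mat ((*\<^sub>C) (a * d + b * c)) J" for a b c d
  proof -
    have "(map_mat ((*\<^sub>C) a) (1\<^sub>m n) + map_mat ((*\<^sub>C) b) J) * (map_mat ((*\<^sub>C) c) (1\<^sub>m n) + map_mat
        ((*\<^sub>C) d) J)
      = (map_mat ((*\<^sub>C) (a * c)) (1\<^sub>m n) + map_mat ((*\<^sub>C) (b * c)) J) +
        (map_mat ((*\<^sub>C) (a * d)) J + map_mat ((*\<^sub>C) (b * d)) (1\<^sub>m n))"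
      using J(1,3)
      by (simp add: add_mult_distrib_mat[of _ n n _ _ n] mult_add_distrib_mat[of _ n n _ n]
          map_mat_scaleC_mult[of _ n n _ n])
    also have "\<dots> = map_mat ((*\<^sub>C) (a * c + b * d)) (1\<^sub>m n) + map_mat ((*\<^sub>C) (a * d + b * c)) J"
      using J(1) by (intro eq_matI) (auto simp: scaleC_add_left scaleC_zero_right)
    finally show ?thesis .
  qed
  have coeff: "cnj (\<alpha> t) * \<alpha> t + cnj (\<beta> t) * \<beta> t = 1" "cnj (\<alpha> t) * \<beta> t + cnj (\<beta> t) * \<alpha> t = 0" for t
  proof -
    have z: "cis (pi * t) * cnj (cis (pi * t)) = 1" by (simp add: cis_cnj cis_mult)
    have "cnj (\<alpha> t) * \<alpha> t + cnj (\<beta> t) * \<beta> t = (1 + cis (pi * t) * cnj (cis (pi * t))) / 2"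
      "cnj (\<alpha> t) * \<beta> t + cnj (\<beta> t) * \<alpha> t = (1 - cis (pi * t) * cnj (cis (pi * t))) / 2"
      unfolding \<alpha>_def \<beta>_def complex_cnj_divide complex_cnj_add complex_cnj_diff complex_cnj_one
        complex_cnj_numeral by (simp_all add: field_simps del: cis_cnj)
    then show "cnj (\<alpha> t) * \<alpha> t + cnj (\<beta> t) * \<beta> t = 1" "cnj (\<alpha> t) * \<beta> t + cnj (\<beta> t) * \<alpha> t = 0"
      unfolding z by simp_all
  qed
  have one: "map_mat ((*\<^sub>C) 1) (1\<^sub>m n) + map_mat ((*\<^sub>C) 0) J = 1\<^sub>m n"
    using J(1) by (intro eq_matI) (auto simp: scaleC_one scaleC_zero_left)
  have WU: "W t \<in> unitaries_dim n" for t
  proof -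
    have "mat_star (W t) * W t = 1\<^sub>m n"
      unfolding sW unfolding W_def prod using coeff[of t] one by simp
    moreover have "W t * mat_star (W t) = 1\<^sub>m n"
      unfolding sW unfolding W_def prod using coeff[of t] one by (simp add: mult.commute
          add.commute[of "\<alpha> t * _"])
    ultimately show ?thesis using W by (simp add: unitaries_dim_def)
  qed
  have "W 0 = 1\<^sub>m n" "W 1 = J"
    using J(1) by (auto intro!: eq_matI simp: W_def \<alpha>_def \<beta>_def scaleC_one scaleC_zero_left cis_pi)
  moreover have "mat_star J = J" by fact
  moreover have "u \<in> carrier_mat n n" using u by (rule unitaries_dimD)
  ultimately have ends: "W 0 * u * mat_star (W 0) = u" "W 1 * u * mat_star (W 1) = J * u * J" by simp_all
  show ?thesis
  proof (rule unitary_homotopicI[where c = "\<lambda>t. W t * u * mat_star (W t)" and n = n])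
    fix i j assume ij: "i < n" "j < n"
    have Wc: "continuous_on {0..1} (\<lambda>t. W t $$ (k, l))" if "k < n" "l < n" for k l
      using that J(1) unfolding W_def \<alpha>_def \<beta>_def
      by (simp only: index_add_mat index_map_mat index_one_mat carrier_matD)
        (auto intro!: continuous_intros bounded_linear.continuous_on[OF bounded_linear_scaleC_left])
    show "continuous_on {0..1} (\<lambda>t. (W t * u * mat_star (W t)) $$ (i, j))"
      using ij W unitaries_dimD(1)[OF u]
      by (intro continuous_on_mult_mat[of _ _ n n _ n])
        (auto intro!: Wc continuous_on_mult_mat[of _ _ n n _ n] bounded_linear.continuous_on[OF
            bounded_linear_star]
          simp: carrier_matD[OF W])
  qed (use ends u WU in \<open>auto intro!: mult_unitaries_dim mat_star_unitaries_dim\<close>)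
qed

text \<open>The permutation exchanging two blocks of different sizes need not be an involution,
  whereas the full reversal always is a self-adjoint unitary and so can be joined to 1 by
  \<open>unitary_homotopic_conj_symmetry\<close>.\<close>

definition rev_perm_mat :: "nat \<Rightarrow> 'a::zero_neq_one mat" where
  "rev_perm_mat n = Matrix.mat n n (\<lambda>(i, j). if i + j + 1 = n then 1 else 0)"

definition rev_mat :: "'a mat \<Rightarrow> 'a mat" where
  "rev_mat A = Matrix.mat (dim_row A) (dim_col A) (\<lambda>(i, j). A $$ (dim_row A - 1 - i, dim_col A - 1 - j))"

lemma rev_perm_mat_mult_left:
  fixes A :: "'a::semiring_1 mat"
  assumes "A \<in> carrier_mat n m" "i < n" "j < m"
  shows "(rev_perm_mat n * A) $$ (i, j) = A $$ (n - 1 - i, j)"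
proof -
  have "(rev_perm_mat n * A) $$ (i, j) = (\<Sum>l<n. (if l = n - 1 - i then 1 else 0) * A $$ (l, j))"
    by (subst index_mult_mat_sum[of _ n n _ m]) (use assms in \<open>auto simp: rev_perm_mat_def intro!:
        sum.cong\<close>)
  then show ?thesis using assms by (simp add: sum.delta if_distrib[of "\<lambda>x. x * _"] cong: if_cong)
qed

lemma rev_perm_mat_mult_right:
  fixes A :: "'a::semiring_1 mat"
  assumes "A \<in> carrier_mat n m" "i < n" "j < m"
  shows "(A * rev_perm_mat m) $$ (i, j) = A $$ (i, m - 1 - j)"
proof -
  have "(A * rev_perm_mat m) $$ (i, j) = (\<Sum>l<m. A $$ (i, l) * (if l = m - 1 - j then 1 else 0))"
    by (subst index_mult_mat_sum[of _ n m _ m]) (use assms in \<open>auto simp: rev_perm_mat_def intro!: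
        sum.cong\<close>)
  then show ?thesis using assms by (simp add: sum.delta if_distrib[of "\<lambda>x. _ * x"] cong: if_cong)
qed

lemma unitary_homotopic_rev:
  fixes u :: "'a::unital_cstar_algebra mat"
  assumes u: "u \<in> unitaries_dim n"
  shows "unitary_homotopic u (rev_mat u)"
proof -
  let ?J = "rev_perm_mat n :: 'a mat"
  have J: "?J \<in> carrier_mat n n" by (simp add: rev_perm_mat_def)
  have uc: "u \<in> carrier_mat n n" using u by (rule unitaries_dimD)
  have "?J * ?J = 1\<^sub>m n"
  proof (rule eq_matI)
    fix i j assume "i < dim_row (1\<^sub>m n :: 'a mat)" "j < dim_col (1\<^sub>m n :: 'a mat)"
    then have ij: "i < n" "j < n" by auto
    show "(?J * ?J) $$ (i, j) = 1\<^sub>m n $$ (i, j)"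
      unfolding rev_perm_mat_mult_left[OF J ij] using ij by (auto simp: rev_perm_mat_def)
  qed (use J in auto)
  moreover have "mat_star ?J = ?J"
    by (rule eq_matI) (auto simp: rev_perm_mat_def star_one star_zero)
  ultimately have "unitary_homotopic u (?J * u * ?J)"
    using unitary_homotopic_conj_symmetry[OF u J] by blast
  also have "?J * u * ?J = rev_mat u"
  proof (rule eq_matI)
    fix i j assume "i < dim_row (rev_mat u)" "j < dim_col (rev_mat u)"
    then have ij: "i < n" "j < n" using uc by (auto simp: rev_mat_def)
    then have "(?J * u * ?J) $$ (i, j) = u $$ (n - 1 - i, n - 1 - j)"
      by (subst rev_perm_mat_mult_right[of _ n n], use J uc in simp)
        (auto simp: rev_perm_mat_mult_left[OF uc])
    then show "(?J * u * ?J) $$ (i, j) = rev_mat u $$ (i, j)"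
      using ij uc by (auto simp: rev_mat_def)
  qed (use J uc in \<open>auto simp: rev_mat_def\<close>)
  finally show ?thesis .
qed

lemma rev_mat_sum:
  assumes "u \<in> carrier_mat n n" "v \<in> carrier_mat m m"
  shows "rev_mat (u \<oplus>\<^sub>m v) = rev_mat v \<oplus>\<^sub>m rev_mat u"
  by (rule eq_matI) (use assms in \<open>auto simp: rev_mat_def mat_sum_def intro!: arg_cong2[of _ _ _ _
      "\<lambda>i j. _ $$ (i, j)"]\<close>)

text \<open>Reversing the order of all indices, and then within both blocks, exchanges the blocks.\<close>

lemma unitary_homotopic_swap:
  assumes u: "u \<in> unitaries_dim n" and v: "v \<in> unitaries_dim m"
  shows "unitary_homotopic (u \<oplus>\<^sub>m v) (v \<oplus>\<^sub>m u)"
proof -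
  have uc: "u \<in> carrier_mat n n" and vc: "v \<in> carrier_mat m m"
    using u v by (auto intro: unitaries_dimD)
  have "unitary_homotopic (u \<oplus>\<^sub>m v) (rev_mat v \<oplus>\<^sub>m rev_mat u)"
    using unitary_homotopic_rev[OF sum_unitaries_dim[OF u v]] by (simp add: rev_mat_sum[OF uc vc])
  moreover have "unitary_homotopic (v \<oplus>\<^sub>m u) (rev_mat v \<oplus>\<^sub>m rev_mat u)"
    by (rule unitary_homotopic_sum[OF unitary_homotopic_rev[OF v] unitary_homotopic_rev[OF u] vc uc])
  ultimately show ?thesis
    using unitary_homotopic_trans unitary_homotopic_sym mat_sum_carrier[OF uc vc] mat_sum_carrier[OF
        vc uc]
    by blast
qed

section \<open>Stable homotopy and the group structure\<close>

lemma K1_relI: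
  assumes "u \<in> unitaries_dim n" "v \<in> unitaries_dim m" "n + a = m + b"
    and "unitary_homotopic (u \<oplus>\<^sub>m 1\<^sub>m a) (v \<oplus>\<^sub>m 1\<^sub>m b)"
  shows "(u, v) \<in> K1_rel"
proof -
  have "dim_row u = n" "dim_row v = m" using assms(1,2) unitaries_dimD(1) by blast+
  then have "n + a - dim_row u = a" "n + a - dim_row v = b" "max (dim_row u) (dim_row v) \<le> n + a"
    using assms(3) by auto
  then show ?thesis
    unfolding K1_rel_def using assms(4) unitaries_dim_unitaries[OF assms(1)]
        unitaries_dim_unitaries[OF assms(2)]
    by (auto intro!: exI[of _ "n + a"])
qed

lemma K1_relE:
  assumes "(u, v) \<in> K1_rel"
  obtains n m a b where "u \<in> unitaries_dim n" "v \<in> unitaries_dim m" "n + a = m + b"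
    "unitary_homotopic (u \<oplus>\<^sub>m 1\<^sub>m a) (v \<oplus>\<^sub>m 1\<^sub>m b)"
proof -
  obtain k where "k \<ge> max (dim_row u) (dim_row v)"
    "unitary_homotopic (u \<oplus>\<^sub>m 1\<^sub>m (k - dim_row u)) (v \<oplus>\<^sub>m 1\<^sub>m (k - dim_row v))"
    and "u \<in> unitaries" "v \<in> unitaries"
    using assms unfolding K1_rel_def by blast
  then show ?thesis
    using that[of "dim_row u" "dim_row v" "k - dim_row u" "k - dim_row v"] unitaries_iff by auto
qed

lemma K1_rel_homotopic:
  assumes "unitary_homotopic u v" "u \<in> unitaries_dim n"
  shows "(u, v) \<in> K1_rel"
  using K1_relI[OF assms(2) unitary_homotopic_dim(1)[OF assms(1) unitaries_dimD(1)[OF assms(2)]]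
      refl, of 0] assms(1)
  by simp

lemma K1_rel_sum_one:
  assumes "u \<in> unitaries_dim n"
  shows "(u \<oplus>\<^sub>m 1\<^sub>m k, u) \<in> K1_rel"
  by (rule K1_relI[where a = 0 and b = k])
    (use assms sum_unitaries_dim[OF assms one_unitaries_dim, of k] in
      \<open>simp_all add: unitary_homotopic_refl\<close>)

lemma K1_rel_sym:
  assumes "(u, v) \<in> K1_rel"
  shows "(v, u) \<in> K1_rel"
proof -
  obtain n m a b where *: "u \<in> unitaries_dim n" "v \<in> unitaries_dim m" "n + a = m + b"
    "unitary_homotopic (u \<oplus>\<^sub>m 1\<^sub>m a) (v \<oplus>\<^sub>m 1\<^sub>m b)"
    using assms by (rule K1_relE)
  have "unitary_homotopic (v \<oplus>\<^sub>m 1\<^sub>m b) (u \<oplus>\<^sub>m 1\<^sub>m a)"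
    by (rule unitary_homotopic_sym[OF *(4)]) (rule mat_sum_carrier[OF unitaries_dimD(1)[OF *(1)]
        one_carrier_mat])
  then show ?thesis by (rule K1_relI[OF *(2,1) *(3)[symmetric]])
qed

lemma K1_rel_trans:
  assumes "(u, v) \<in> K1_rel" "(v, w) \<in> K1_rel"
  shows "(u, w) \<in> K1_rel"
proof -
  from assms obtain n m a b m' l c d where 1: "u \<in> unitaries_dim n" "v \<in> unitaries_dim m" "n + a = m + b"
    "unitary_homotopic (u \<oplus>\<^sub>m 1\<^sub>m a) (v \<oplus>\<^sub>m 1\<^sub>m b)"
    and 2: "v \<in> unitaries_dim m'" "w \<in> unitaries_dim l" "m' + c = l + d"
    "unitary_homotopic (v \<oplus>\<^sub>m 1\<^sub>m c) (w \<oplus>\<^sub>m 1\<^sub>m d)"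
    by (elim K1_relE)
  have m': "m' = m" using carrier_matD(1)[OF unitaries_dimD(1)[OF 1(2)]] carrier_matD(1)[OF
      unitaries_dimD(1)[OF 2(1)]] by simp
  have cu: "u \<oplus>\<^sub>m 1\<^sub>m a \<in> carrier_mat (n + a) (n + a)" and cv: "v \<oplus>\<^sub>m 1\<^sub>m c \<in> carrier_mat (m + c) (m
      + c)"
    and cu': "u \<oplus>\<^sub>m 1\<^sub>m (a + c) \<in> carrier_mat (n + (a + c)) (n + (a + c))"
    using 1(1,2)[THEN unitaries_dimD(1)] by auto
  \<comment> \<open>The given homotopies meet at different paddings of \<open>v\<close>; both are
    enlarged so that they pass through \<open>v \<oplus>\<^sub>m 1\<^sub>m (b + c)\<close>.\<close>
  have "unitary_homotopic (u \<oplus>\<^sub>m 1\<^sub>m (a + c)) (v \<oplus>\<^sub>m 1\<^sub>m (b + c))"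
    using unitary_homotopic_sum[OF 1(4) unitary_homotopic_refl cu, of "1\<^sub>m c" c c]
    by (simp add: mat_sum_assoc)
  moreover have "unitary_homotopic (v \<oplus>\<^sub>m 1\<^sub>m (b + c)) (w \<oplus>\<^sub>m 1\<^sub>m (d + b))"
    using unitary_homotopic_sum[OF 2(4) unitary_homotopic_refl cv, of "1\<^sub>m b" b b]
    by (simp add: mat_sum_assoc add.commute)
  ultimately have "unitary_homotopic (u \<oplus>\<^sub>m 1\<^sub>m (a + c)) (w \<oplus>\<^sub>m 1\<^sub>m (d + b))"
    using unitary_homotopic_trans[OF _ _ cu'] by blast
  then show ?thesis
    by (rule K1_relI[OF 1(1) 2(2), rotated]) (use 1(3) 2(3) m' in simp)
qed

lemma equiv_K1_rel: "equiv unitaries K1_rel"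
proof (rule equivI)
  show "K1_rel \<subseteq> unitaries \<times> unitaries" unfolding K1_rel_def by blast
  show "refl_on unitaries K1_rel"
    by (rule refl_onI) (auto simp: unitaries_iff intro: K1_rel_homotopic unitary_homotopic_refl)
  show "sym K1_rel" by (rule symI) (rule K1_rel_sym)
  show "trans K1_rel" by (rule transI) (rule K1_rel_trans)
qed

lemma K1_rel_swap:
  assumes "u \<in> unitaries" "v \<in> unitaries"
  shows "(u \<oplus>\<^sub>m v, v \<oplus>\<^sub>m u) \<in> K1_rel"
  using assms unfolding unitaries_iff by (metis K1_rel_homotopic unitary_homotopic_swap
      sum_unitaries_dim)

lemma K1_rel_sum_left:
  assumes "(u, u') \<in> K1_rel" "v \<in> unitaries"
  shows "(v \<oplus>\<^sub>m u, v \<oplus>\<^sub>m u') \<in> K1_rel"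
proof -
  from assms(1) obtain n m a b where *: "u \<in> unitaries_dim n" "u' \<in> unitaries_dim m" "n + a = m + b"
    "unitary_homotopic (u \<oplus>\<^sub>m 1\<^sub>m a) (u' \<oplus>\<^sub>m 1\<^sub>m b)"
    by (rule K1_relE)
  have v: "v \<in> unitaries_dim (dim_row v)" using assms(2) by (simp add: unitaries_iff)
  have cu: "u \<oplus>\<^sub>m 1\<^sub>m a \<in> carrier_mat (n + a) (n + a)" using *(1)[THEN unitaries_dimD(1)] by auto
  show ?thesis
    by (rule K1_relI[OF sum_unitaries_dim[OF v *(1)] sum_unitaries_dim[OF v *(2)], of a b])
      (use unitary_homotopic_sum[OF unitary_homotopic_refl[OF v] *(4) unitaries_dimD(1)[OF v] cu] *(3)
        in \<open>simp_all add: mat_sum_assoc\<close>)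
qed

lemma sum_unitaries: "u \<in> unitaries \<Longrightarrow> v \<in> unitaries \<Longrightarrow> u \<oplus>\<^sub>m v \<in> unitaries"
  using sum_unitaries_dim unitaries_dim_unitaries unfolding unitaries_iff[of u] unitaries_iff[of v]
      by blast

lemma K1_rel_unitaries: "(u, v) \<in> K1_rel \<Longrightarrow> u \<in> unitaries" "(u, v) \<in> K1_rel \<Longrightarrow> v \<in> unitaries"
  unfolding K1_rel_def by blast+

text \<open>Padding sits at the right end, so only the right summand can be replaced directly; the
  left one is reached by swapping.\<close>

lemma K1_rel_sum:
  assumes "(u, u') \<in> K1_rel" "(v, v') \<in> K1_rel"
  shows "(u \<oplus>\<^sub>m v, u' \<oplus>\<^sub>m v') \<in> K1_rel"
proof -
  note U = K1_rel_unitaries[OF assms(1)] K1_rel_unitaries[OF assms(2)]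
  have "(u \<oplus>\<^sub>m v, u \<oplus>\<^sub>m v') \<in> K1_rel" by (rule K1_rel_sum_left[OF assms(2) U(1)])
  moreover have "(u \<oplus>\<^sub>m v', v' \<oplus>\<^sub>m u) \<in> K1_rel" by (rule K1_rel_swap[OF U(1,4)])
  moreover have "(v' \<oplus>\<^sub>m u, v' \<oplus>\<^sub>m u') \<in> K1_rel" by (rule K1_rel_sum_left[OF assms(1) U(4)])
  moreover have "(v' \<oplus>\<^sub>m u', u' \<oplus>\<^sub>m v') \<in> K1_rel" by (rule K1_rel_swap[OF U(4,2)])
  ultimately show ?thesis using K1_rel_trans by blast
qed

text \<open>Whitehead's argument: diag(u*, u) = diag(u*, 1) diag(1, u), and the second factor is
  homotopic to diag(u, 1), which leaves the identity.\<close>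

lemma K1_rel_sum_star:
  assumes u: "u \<in> unitaries_dim n"
  shows "(mat_star u \<oplus>\<^sub>m u, 1\<^sub>m (n + n)) \<in> K1_rel"
proof -
  have us: "mat_star u \<in> unitaries_dim n" by (rule mat_star_unitaries_dim[OF u])
  note c = unitaries_dimD(1)[OF u] unitaries_dimD(1)[OF us]
  have "unitary_homotopic ((mat_star u \<oplus>\<^sub>m 1\<^sub>m n) * (1\<^sub>m n \<oplus>\<^sub>m u)) ((mat_star u \<oplus>\<^sub>m 1\<^sub>m n) * (u \<oplus>\<^sub>m
      1\<^sub>m n))"
    by (rule unitary_homotopic_mult[OF unitary_homotopic_refl[OF sum_unitaries_dim[OF us
        one_unitaries_dim]]
          unitary_homotopic_swap[OF one_unitaries_dim u]]) (use c in auto)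
  then have "unitary_homotopic (mat_star u \<oplus>\<^sub>m u) (1\<^sub>m (n + n))"
    using c unitaries_dimD(2)[OF u] by (simp add: mat_sum_mult[of _ n _ n])
  then show ?thesis by (rule K1_rel_homotopic) (rule sum_unitaries_dim[OF us u])
qed

lemma K1_class_eq_iff:
  assumes "u \<in> unitaries" "v \<in> unitaries"
  shows "K1_class u = K1_class v \<longleftrightarrow> (u, v) \<in> K1_rel"
  unfolding K1_class_def using eq_equiv_class_iff[OF equiv_K1_rel assms] .

lemma K1_class_mult:
  assumes "u \<in> unitaries" "v \<in> unitaries"
  shows "K1_class u \<otimes>\<^bsub>K1\<^esub> K1_class v = K1_class (u \<oplus>\<^sub>m v)"
proof -
  have "congruent2 K1_rel K1_rel (\<lambda>u v. K1_class (u \<oplus>\<^sub>m v))"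
    by (rule congruent2I') (simp add: K1_class_eq_iff K1_rel_unitaries sum_unitaries K1_rel_sum)
  from UN_equiv_class2[OF equiv_K1_rel equiv_K1_rel this assms] show ?thesis
    by (simp add: K1_def K1_class_def)
qed

lemma K1_class_carrier: "u \<in> unitaries \<Longrightarrow> K1_class u \<in> carrier K1"
  unfolding K1_class_def K1_def by (simp add: quotientI)

lemma K1_carrierE:
  assumes "X \<in> carrier K1"
  obtains u where "u \<in> unitaries" "X = K1_class u"
  using assms unfolding K1_class_def K1_def by (auto elim: quotientE)

lemma one_unitaries: "1\<^sub>m n \<in> unitaries"
  by (simp add: unitaries_iff)

lemma K1_class_one: "K1_class (1\<^sub>m n) = \<one>\<^bsub>K1\<^esub>"
proof -
  have "(1\<^sub>m n, 1\<^sub>m 1) \<in> K1_rel"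
    by (rule K1_relI[of _ n _ 1 1 n]) (auto intro: unitary_homotopic_refl[of _ "Suc n"])
  then have "K1_class (1\<^sub>m n) = K1_class (1\<^sub>m 1)" by (simp add: K1_class_eq_iff one_unitaries)
  then show ?thesis by (simp add: K1_def)
qed

text \<open>\<open>exp_map\<close> is formed with \<open>inv\<close> in \<open>K1\<close>, so the
  group laws come before any evaluation of it.\<close>

lemma comm_group_K1: "comm_group K1"
proof (rule comm_groupI)
  fix X Y Z :: "'a unitization mat set" assume "X \<in> carrier K1" "Y \<in> carrier K1" "Z \<in> carrier K1"
  then obtain u v w where [simp]: "u \<in> unitaries" "v \<in> unitaries" "w \<in> unitaries"
    and [simp]: "X = K1_class u" "Y = K1_class v" "Z = K1_class w"
    by (metis K1_carrierE)
  show "X \<otimes>\<^bsub>K1\<^esub> Y \<otimes>\<^bsub>K1\<^esub> Z = X \<otimes>\<^bsub>K1\<^esub> (Y \<otimes>\<^bsub>K1\<^esub> Z)"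
    by (simp add: K1_class_mult sum_unitaries mat_sum_assoc)
next
  fix X Y :: "'a unitization mat set" assume "X \<in> carrier K1" "Y \<in> carrier K1"
  then obtain u v where [simp]: "u \<in> unitaries" "v \<in> unitaries"
    and [simp]: "X = K1_class u" "Y = K1_class v"
    by (metis K1_carrierE)
  show "X \<otimes>\<^bsub>K1\<^esub> Y \<in> carrier K1" by (simp add: K1_class_mult sum_unitaries K1_class_carrier)
  show "X \<otimes>\<^bsub>K1\<^esub> Y = Y \<otimes>\<^bsub>K1\<^esub> X"
    by (simp add: K1_class_mult sum_unitaries K1_class_eq_iff K1_rel_swap)
next
  show "\<one>\<^bsub>K1\<^esub> \<in> carrier K1" using K1_class_carrier[OF one_unitaries, of 1] by (simp only: K1_class_one)
next
  fix X :: "'a unitization mat set" assume "X \<in> carrier K1"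
  then obtain u where u: "u \<in> unitaries" and X: "X = K1_class u" by (metis K1_carrierE)
  have ud: "u \<in> unitaries_dim (dim_row u)" using u by (simp add: unitaries_iff)
  have "K1_class (1\<^sub>m 1 \<oplus>\<^sub>m u) = K1_class u"
    using K1_rel_trans[OF K1_rel_swap[OF one_unitaries u] K1_rel_sum_one[OF ud]] u
    by (simp add: K1_class_eq_iff sum_unitaries one_unitaries)
  then show "\<one>\<^bsub>K1\<^esub> \<otimes>\<^bsub>K1\<^esub> X = X"
    using K1_class_mult[OF one_unitaries u, of 1] by (simp add: X K1_class_one)
  have us: "mat_star u \<in> unitaries" using mat_star_unitaries_dim[OF ud] by (rule unitaries_dim_unitaries)
  have "K1_class (mat_star u \<oplus>\<^sub>m u) = \<one>\<^bsub>K1\<^esub>"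
    using K1_rel_sum_star[OF ud] unfolding K1_class_one[symmetric, of "dim_row u + dim_row u"]
    by (simp add: K1_class_eq_iff sum_unitaries us u one_unitaries)
  then have "K1_class (mat_star u) \<otimes>\<^bsub>K1\<^esub> X = \<one>\<^bsub>K1\<^esub>" by (simp add: X K1_class_mult us u)
  then show "\<exists>Y\<in>carrier K1. Y \<otimes>\<^bsub>K1\<^esub> X = \<one>\<^bsub>K1\<^esub>" using K1_class_carrier[OF us] by blast
qed

section \<open>Exponentials of matrices\<close>

abbreviation mat_cexp :: "complex \<Rightarrow> 'a::unital_cstar_algebra mat \<Rightarrow> 'a mat" where
  "mat_cexp c A \<equiv> mat_exp (map_mat ((*\<^sub>C) c) A)"

lemma map_mat_scaleC_pow:
  fixes A :: "'a::unital_cstar_algebra mat"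
  assumes A: "A \<in> carrier_mat n n"
  shows "map_mat ((*\<^sub>C) c) A ^\<^sub>m k = map_mat ((*\<^sub>C) (c ^ k)) (A ^\<^sub>m k)"
proof (induction k)
  case 0
  show ?case using A by (intro eq_matI) (auto simp: scaleC_one)
next
  case (Suc k)
  then show ?case using A by (simp add: map_mat_scaleC_mult[of _ n n _ n] mult.commute)
qed

lemma mat_exp_dim [simp]: "dim_row (mat_exp A) = dim_row A" "dim_col (mat_exp A) = dim_row A"
  by (simp_all add: mat_exp_def)

lemma mat_cexp_carrier [simp]: "A \<in> carrier_mat n n \<Longrightarrow> mat_cexp c A \<in> carrier_mat n n"
  by (simp add: mat_exp_def)

lemma mat_cexp_index:
  fixes A :: "'a::unital_cstar_algebra mat"
  assumes "A \<in> carrier_mat n n" "i < n" "j < n"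
  shows "mat_cexp c A $$ (i, j) = (\<Sum>k. (c ^ k /\<^sub>R fact k) *\<^sub>C (A ^\<^sub>m k) $$ (i, j))"
proof -
  have eq: "(x *\<^sub>C y) /\<^sub>R r = (x /\<^sub>R r) *\<^sub>C y" for x r and y :: 'a
    unfolding scaleR_scaleC by (simp only: scaleR_conv_of_real)
  have "A ^\<^sub>m k \<in> carrier_mat n n" for k using assms(1) by simp
  from carrier_matD[OF this] show ?thesis
    using assms by (simp add: mat_exp_def map_mat_scaleC_pow[OF assms(1)] eq)
qed

text \<open>Entrywise substitute for submultiplicativity of a matrix norm, with
  \<open>real n * B\<close> in the role of the norm; geometric growth is enough against the
  factorials.\<close>

lemma norm_pow_mat_le:
  fixes A :: "'a::unital_cstar_algebra mat"
  assumes A: "A \<in> carrier_mat n n" "\<And>i j. i < n \<Longrightarrow> j < n \<Longrightarrow> norm (A $$ (i, j)) \<le> B"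
    and ij: "i < n" "j < n"
  shows "norm ((A ^\<^sub>m k) $$ (i, j)) \<le> (real n * B) ^ k"
  using ij
proof (induction k arbitrary: i j)
  case 0
  then show ?case using A(1) by simp
next
  case (Suc k)
  have Ak: "A ^\<^sub>m k \<in> carrier_mat n n" using A(1) by simp
  have "norm ((A ^\<^sub>m Suc k) $$ (i, j)) = norm (\<Sum>l<n. (A ^\<^sub>m k) $$ (i, l) * A $$ (l, j))"
    using index_mult_mat_sum[OF Ak A(1) Suc.prems] by simp
  also have "\<dots> \<le> (\<Sum>l<n. (real n * B) ^ k * B)"
  proof (rule sum_norm_le)
    fix l assume "l \<in> {..<n}"
    then have l: "norm ((A ^\<^sub>m k) $$ (i, l)) \<le> (real n * B) ^ k" "norm (A $$ (l, j)) \<le> B"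
      using Suc A(2) by auto
    show "norm ((A ^\<^sub>m k) $$ (i, l) * A $$ (l, j)) \<le> (real n * B) ^ k * B"
      by (rule order.trans[OF norm_mult_ineq mult_mono[OF l]])
        (use order.trans[OF norm_ge_zero l(1)] in simp_all)
  qed
  finally show ?case by (simp add: algebra_simps)
qed

lemma norm_mat_cexp_term_le:
  fixes A :: "'a::unital_cstar_algebra mat"
  assumes A: "A \<in> carrier_mat n n" "\<And>i j. i < n \<Longrightarrow> j < n \<Longrightarrow> norm (A $$ (i, j)) \<le> B"
    and ij: "i < n" "j < n"
  shows "norm ((c ^ k /\<^sub>R fact k) *\<^sub>C (A ^\<^sub>m k) $$ (i, j)) \<le> (cmod c * (real n * B)) ^ k /\<^sub>R fact k"
  using mult_left_mono[OF norm_pow_mat_le[OF assms, of k], of "cmod c ^ k"]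
  by (simp add: norm_scaleC norm_power power_mult_distrib field_simps)

lemma summable_mat_cexp:
  fixes A :: "'a::unital_cstar_algebra mat"
  assumes "A \<in> carrier_mat n n" "i < n" "j < n"
  shows "summable (\<lambda>k. norm ((c ^ k /\<^sub>R fact k) *\<^sub>C (A ^\<^sub>m k) $$ (i, j)))"
proof -
  define B where "B = (\<Sum>i<n. \<Sum>j<n. norm (A $$ (i, j)))"
  have B: "norm (A $$ (i, j)) \<le> B" if "i < n" "j < n" for i j
  proof -
    have "norm (A $$ (i, j)) \<le> (\<Sum>j<n. norm (A $$ (i, j)))"
      by (rule member_le_sum) (use that in auto)
    also have "\<dots> \<le> B"
      unfolding B_def by (rule member_le_sum[of _ _ "\<lambda>i. \<Sum>j<n. norm (A $$ (i, j))"]) (use that in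
          \<open>auto intro: sum_nonneg\<close>)
    finally show ?thesis .
  qed
  show ?thesis
    by (rule summable_comparison_test'[OF summable_exp_generic[of "cmod c * (real n * B)"]])
      (use norm_mat_cexp_term_le[OF assms(1) B assms(2,3)] in simp)
qed

text \<open>Both factors are series in the same matrix, so the Cauchy products of the entries
  collect to \<open>A ^\<^sub>m k\<close> times a scalar, and the scalars are the terms of the
  complex exponential at \<open>c + d\<close>.\<close>

lemma mat_cexp_add:
  fixes A :: "'a::unital_cstar_algebra mat"
  assumes A: "A \<in> carrier_mat n n"
  shows "mat_cexp c A * mat_cexp d A = mat_cexp (c + d) A"
proof (rule eq_matI)
  fix i j assume "i < dim_row (mat_cexp (c + d) A)" "j < dim_col (mat_cexp (c + d) A)"
  then have ij: "i < n" "j < n" using mat_cexp_carrier[OF A, of "c + d"] by auto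
  let ?e = "\<lambda>c k. c ^ k /\<^sub>R fact k :: complex"
  have Ak: "A ^\<^sub>m k \<in> carrier_mat n n" for k using A by simp
  have pow: "A ^\<^sub>m p * A ^\<^sub>m q = A ^\<^sub>m (p + q)" for p q
  proof (induction q)
    case (Suc q)
    then show ?case using assoc_mult_mat[OF Ak[of p] Ak[of q] A] by simp
  qed (use A in simp)
  have "(mat_cexp c A * mat_cexp d A) $$ (i, j) =
      (\<Sum>l<n. mat_cexp c A $$ (i, l) * mat_cexp d A $$ (l, j))"
    using index_mult_mat_sum[OF mat_cexp_carrier[OF A] mat_cexp_carrier[OF A] ij] .
  also have "\<dots> = (\<Sum>l<n. \<Sum>k. \<Sum>p\<le>k. (?e c p *\<^sub>C (A ^\<^sub>m p) $$ (i, l)) * (?e d (k - p) *\<^sub>C (A ^\<^sub>m (k -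
      p)) $$ (l, j)))"
  proof (rule sum.cong[OF refl])
    fix l assume "l \<in> {..<n}"
    then show "mat_cexp c A $$ (i, l) * mat_cexp d A $$ (l, j) = (\<Sum>k. \<Sum>p\<le>k. (?e c p *\<^sub>C (A ^\<^sub>m p) $$
        (i, l)) * (?e d (k - p) *\<^sub>C (A ^\<^sub>m (k - p)) $$ (l, j)))"
      using ij by (simp only: mat_cexp_index[OF A] lessThan_iff Cauchy_product summable_mat_cexp[OF A])
  qed
  also have "\<dots> = (\<Sum>k. \<Sum>l<n. \<Sum>p\<le>k. (?e c p *\<^sub>C (A ^\<^sub>m p) $$ (i, l)) * (?e d (k - p) *\<^sub>C (A ^\<^sub>m (k -
      p)) $$ (l, j)))"
    by (rule suminf_sum[symmetric])
      (use ij sums_summable[OF Cauchy_product_sums[OF summable_mat_cexp[OF A] summable_mat_cexp[OF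
          A]]] in auto)
  also have "\<dots> = (\<Sum>k. ?e (c + d) k *\<^sub>C (A ^\<^sub>m k) $$ (i, j))"
  proof (rule suminf_cong)
    fix k
    have "(\<Sum>l<n. \<Sum>p\<le>k. (?e c p *\<^sub>C (A ^\<^sub>m p) $$ (i, l)) * (?e d (k - p) *\<^sub>C (A ^\<^sub>m (k - p)) $$ (l, j)))
      = (\<Sum>p\<le>k. (?e c p * ?e d (k - p)) *\<^sub>C (\<Sum>l<n. (A ^\<^sub>m p) $$ (i, l) * (A ^\<^sub>m (k - p)) $$ (l, j)))"
      by (subst sum.swap) (simp only: mult_scaleC_left mult_scaleC_right scaleC_scaleC scaleC_sum
          mult.commute)
    also have "\<dots> = (\<Sum>p\<le>k. (?e c p * ?e d (k - p)) *\<^sub>C (A ^\<^sub>m k) $$ (i, j))"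
      by (rule sum.cong[OF refl]) (simp only: index_mult_mat_sum[OF Ak Ak ij, symmetric] pow
          atMost_iff le_add_diff_inverse)
    also have "\<dots> = (\<Sum>p\<le>k. ?e c p * ?e d (k - p)) *\<^sub>C (A ^\<^sub>m k) $$ (i, j)"
      by (rule linear_sum[OF bounded_linear.linear[OF bounded_linear_scaleC_left], symmetric])
    also have "(\<Sum>p\<le>k. ?e c p * ?e d (k - p)) = ?e (c + d) k"
      by (rule exp_series_add_commuting[symmetric]) (rule mult.commute)
    finally show "(\<Sum>l<n. \<Sum>p\<le>k. (?e c p *\<^sub>C (A ^\<^sub>m p) $$ (i, l)) * (?e d (k - p) *\<^sub>C (A ^\<^sub>m (k - p))
        $$ (l, j)))
      = ?e (c + d) k *\<^sub>C (A ^\<^sub>m k) $$ (i, j)" .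
  qed
  also have "\<dots> = mat_cexp (c + d) A $$ (i, j)" by (rule mat_cexp_index[OF A ij, symmetric])
  finally show "(mat_cexp c A * mat_cexp d A) $$ (i, j) = mat_cexp (c + d) A $$ (i, j)" .
qed (use A in auto)

text \<open>If the powers of \<open>A\<close> are a constant matrix \<open>D\<close> up to the terms \<open>R k\<close>, then at \<open>2\<pi>i\<close> the
  constant part contributes only through the zeroth power.\<close>

lemma mat_cexp_2pi_index:
  fixes A :: "'a::unital_cstar_algebra mat"
  assumes A: "A \<in> carrier_mat n n" "i < n" "j < n"
    and R: "\<And>k. 0 < k \<Longrightarrow> (A ^\<^sub>m k) $$ (i, j) = D + R k" and R0: "R 0 = 0"
  shows "mat_cexp (2 * complex_of_real pi * \<i>) A $$ (i, j) =
    1\<^sub>m n $$ (i, j) + (\<Sum>k. ((2 * complex_of_real pi * \<i>) ^ k /\<^sub>R fact k) *\<^sub>C R k)"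
    and "summable (\<lambda>k. ((2 * complex_of_real pi * \<i>) ^ k /\<^sub>R fact k) *\<^sub>C R k)"
proof -
  let ?c = "2 * complex_of_real pi * \<i>"
  let ?e = "\<lambda>k. ?c ^ k /\<^sub>R fact k :: complex"
  \<comment> \<open>The zeroth power is the identity and not the constant part \<open>D\<close>;
    this is the one-off correction. The terms with \<open>D\<close> add up to \<open>D\<close>
    itself because exp(2 pi i) = 1.\<close>
  define X where "X = 1\<^sub>m n $$ (i, j) - D"
  have exp1: "exp ?c = 1"
    using exp_two_pi_i by (simp add: mult.commute mult.left_commute)
  have s: "summable (\<lambda>k. ?e k *\<^sub>C (A ^\<^sub>m k) $$ (i, j))"
    by (rule summable_norm_cancel[OF summable_mat_cexp[OF A]])
  have D: "(\<lambda>k. ?e k *\<^sub>C D) sums D"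
    using bounded_linear.sums[OF bounded_linear_scaleC_left exp_converges[of ?c]] by (simp add: exp1
        scaleC_one)
  have X: "(\<lambda>k. if k = 0 then X else 0) sums X" using sums_single[of 0 "\<lambda>_. X"] by simp
  have eq: "?e k *\<^sub>C R k = ?e k *\<^sub>C (A ^\<^sub>m k) $$ (i, j) - ?e k *\<^sub>C D - (if k = 0 then X else 0)" for k
  proof (cases "k = 0")
    case True
    then show ?thesis using A by (simp add: R0 X_def scaleC_zero_right scaleC_one)
  next
    case False
    then show ?thesis by (simp add: R scaleC_add_right)
  qed
  have "(\<lambda>k. ?e k *\<^sub>C R k) sums (mat_cexp ?c A $$ (i, j) - D - X)"
    unfolding eq mat_cexp_index[OF A] by (intro sums_diff summable_sums s D X)
  then show "summable (\<lambda>k. ?e k *\<^sub>C R k)"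
    "mat_cexp ?c A $$ (i, j) = 1\<^sub>m n $$ (i, j) + (\<Sum>k. ?e k *\<^sub>C R k)"
    by (simp_all add: sums_iff X_def)
qed

lemma mat_cexp_projection:
  assumes P: "P \<in> carrier_mat n n" "P * P = P"
  shows "mat_cexp (2 * complex_of_real pi * \<i>) P = 1\<^sub>m n"
proof (rule eq_matI)
  fix i j assume "i < dim_row (1\<^sub>m n :: 'a mat)" "j < dim_col (1\<^sub>m n :: 'a mat)"
  then have ij: "i < n" "j < n" by auto
  have pow: "P ^\<^sub>m Suc k = P" for k
    by (induction k) (use P in simp_all)
  have "(P ^\<^sub>m k) $$ (i, j) = P $$ (i, j) + 0" if "0 < k" for k
    using pow[of "k - 1"] that by simp
  from mat_cexp_2pi_index(1)[OF P(1) ij this]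
  show "mat_cexp (2 * complex_of_real pi * \<i>) P $$ (i, j) = 1\<^sub>m n $$ (i, j)"
    by (simp add: scaleC_zero_right)
qed (use P in auto)

lemma pow_mat_star:
  fixes A :: "'a::unital_cstar_algebra mat"
  assumes A: "A \<in> carrier_mat n n"
  shows "mat_star (A ^\<^sub>m k) = mat_star A ^\<^sub>m k"
proof (induction k)
  case (Suc k)
  have comm: "B * B ^\<^sub>m k = B ^\<^sub>m k * B" if B: "B \<in> carrier_mat n n" for B :: "'a mat"
  proof (induction k)
    case (Suc k)
    then show ?case using assoc_mult_mat[OF B pow_carrier_mat[OF B] B, of k] by simp
  qed (use B in simp)
  show ?case
    using mat_star_mult[OF pow_carrier_mat[OF A] A, of k] comm[OF mat_star_carrier[OF A]] Suc by simp
qed (use A in simp)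

lemma mat_star_cexp:
  fixes A :: "'a::unital_cstar_algebra mat"
  assumes A: "A \<in> carrier_mat n n"
  shows "mat_star (mat_cexp c A) = mat_cexp (cnj c) (mat_star A)"
proof (rule eq_matI)
  fix i j assume "i < dim_row (mat_cexp (cnj c) (mat_star A))" "j < dim_col (mat_cexp (cnj c)
      (mat_star A))"
  then have ij: "i < n" "j < n" using mat_cexp_carrier[OF mat_star_carrier[OF A], of "cnj c"] by auto
  have "mat_star (mat_cexp c A) $$ (i, j) = star (mat_cexp c A $$ (j, i))"
    using carrier_matD[OF mat_cexp_carrier[OF A, of c]] ij by simp
  also have "\<dots> = (\<Sum>k. star ((c ^ k /\<^sub>R fact k) *\<^sub>C (A ^\<^sub>m k) $$ (j, i)))"
    unfolding mat_cexp_index[OF A ij(2,1)]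
    by (rule bounded_linear.suminf[OF bounded_linear_star summable_norm_cancel[OF
        summable_mat_cexp[OF A ij(2,1)]]])
  also have "\<dots> = (\<Sum>k. (cnj c ^ k /\<^sub>R fact k) *\<^sub>C (mat_star A ^\<^sub>m k) $$ (i, j))"
    using ij carrier_matD[OF pow_carrier_mat[OF A]]
    by (simp add: star_scaleC flip: pow_mat_star[OF A])
  also have "\<dots> = mat_cexp (cnj c) (mat_star A) $$ (i, j)"
    by (rule mat_cexp_index[OF mat_star_carrier[OF A] ij, symmetric])
  finally show "mat_star (mat_cexp c A) $$ (i, j) = mat_cexp (cnj c) (mat_star A) $$ (i, j)" .
qed (use A in auto)

lemma mat_cexp_unitary:
  fixes T :: "'a::unital_cstar_algebra mat"
  assumes T: "T \<in> carrier_mat n n" "mat_star T = T"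
  shows "mat_cexp (2 * complex_of_real pi * \<i>) T \<in> unitaries_dim n"
proof -
  let ?c = "2 * complex_of_real pi * \<i>"
  have "mat_star (mat_cexp ?c T) = mat_cexp (- ?c) T"
    using mat_star_cexp[OF T(1), of ?c] T(2) by simp
  moreover have "mat_cexp 0 T = 1\<^sub>m n"
  proof -
    \<comment> \<open>The scalar 0 applied to \<open>T\<close> and the scalar 2 pi i applied to the
      zero projection give the same matrix.\<close>
    have "mat_cexp 0 T = mat_cexp (2 * complex_of_real pi * \<i>) (0\<^sub>m n n)"
      using T(1) by (intro arg_cong[of _ _ mat_exp] eq_matI) (auto simp: scaleC_zero_left
          scaleC_zero_right)
    also have "\<dots> = 1\<^sub>m n" by (rule mat_cexp_projection) simp_all
    finally show ?thesis .
  qed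
  ultimately show ?thesis
    using mat_cexp_add[OF T(1), of "- ?c" ?c] mat_cexp_add[OF T(1), of ?c "- ?c"] T(1)
    by (simp add: unitaries_dim_def)
qed

lemma mat_cexp_hom:
  assumes f: "star_hom f" "f 1 = 1" and A: "A \<in> carrier_mat n n"
  shows "map_mat f (mat_cexp c A) = mat_cexp c (map_mat f A)"
proof (rule eq_matI)
  have fA: "map_mat f A \<in> carrier_mat n n" using A by simp
  fix i j assume "i < dim_row (mat_cexp c (map_mat f A))" "j < dim_col (mat_cexp c (map_mat f A))"
  then have ij: "i < n" "j < n" using mat_cexp_carrier[OF fA, of c] by auto
  have pow: "map_mat f A ^\<^sub>m k = map_mat f (A ^\<^sub>m k)" for k
  proof (induction k)
    case 0
    show ?case using A by (simp add: map_mat_one[of f] f star_hom_zero)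
  next
    case (Suc k)
    then show ?case using map_mat_star_hom_mult[OF f(1) pow_carrier_mat[OF A] A, of k] by simp
  qed
  have "map_mat f (mat_cexp c A) $$ (i, j) = f (mat_cexp c A $$ (i, j))"
    using carrier_matD[OF mat_cexp_carrier[OF A, of c]] ij by simp
  also have "\<dots> = (\<Sum>k. f ((c ^ k /\<^sub>R fact k) *\<^sub>C (A ^\<^sub>m k) $$ (i, j)))"
    unfolding mat_cexp_index[OF A ij]
    by (rule bounded_linear.suminf[OF unital_star_hom_bounded_linear[OF f] summable_norm_cancel[OF
        summable_mat_cexp[OF A ij]]])
  also have "\<dots> = (\<Sum>k. (c ^ k /\<^sub>R fact k) *\<^sub>C (map_mat f A ^\<^sub>m k) $$ (i, j))"
    unfolding pow using ij carrier_matD[OF pow_carrier_mat[OF A]]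
    by (simp add: star_hom_scaleC[OF f(1)])
  also have "\<dots> = mat_cexp c (map_mat f A) $$ (i, j)"
    by (rule mat_cexp_index[OF fA ij, symmetric])
  finally show "map_mat f (mat_cexp c A) $$ (i, j) = mat_cexp c (map_mat f A) $$ (i, j)" .
qed (use A in auto)

lemma mat_sum_index:
  assumes "i < dim_row A + dim_row B" "j < dim_col A + dim_col B"
  shows "(A \<oplus>\<^sub>m B) $$ (i, j) = (if i < dim_row A then if j < dim_col A then A $$ (i, j) else 0
    else if j < dim_col A then 0 else B $$ (i - dim_row A, j - dim_col A))"
  using assms by (simp add: mat_sum_def)

lemma mat_cexp_sum:
  fixes A B :: "'a::unital_cstar_algebra mat"
  assumes A: "A \<in> carrier_mat n n" and B: "B \<in> carrier_mat m m"
  shows "mat_cexp c (A \<oplus>\<^sub>m B) = mat_cexp c A \<oplus>\<^sub>m mat_cexp c B"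
proof (rule eq_matI)
  note AB = mat_sum_carrier[OF A B]
  fix i j assume "i < dim_row (mat_cexp c A \<oplus>\<^sub>m mat_cexp c B)" "j < dim_col (mat_cexp c A \<oplus>\<^sub>m
      mat_cexp c B)"
  then have ij: "i < n + m" "j < n + m"
    using carrier_matD[OF mat_cexp_carrier[OF A, of c]] carrier_matD[OF mat_cexp_carrier[OF B, of
        c]] by auto
  have pow: "(A \<oplus>\<^sub>m B) ^\<^sub>m k = A ^\<^sub>m k \<oplus>\<^sub>m B ^\<^sub>m k" for k
  proof (induction k)
    case (Suc k)
    then show ?case using mat_sum_mult[OF pow_carrier_mat[OF A] pow_carrier_mat[OF B] A B] by simp
  qed (use A B in simp)
  show "mat_cexp c (A \<oplus>\<^sub>m B) $$ (i, j) = (mat_cexp c A \<oplus>\<^sub>m mat_cexp c B) $$ (i, j)"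
    unfolding mat_cexp_index[OF AB ij] pow
    using ij carrier_matD[OF pow_carrier_mat[OF A]] carrier_matD[OF pow_carrier_mat[OF B]]
      carrier_matD[OF A] carrier_matD[OF B]
    by (simp add: mat_sum_index mat_cexp_index[OF A] mat_cexp_index[OF B] scaleC_zero_right)
qed (use A B in auto)

text \<open>Compactness of \<open>S\<close> bounds all entries of all \<open>T t\<close> by one
  \<open>B\<close>, so the exponential series converges uniformly on \<open>S\<close>.\<close>

lemma continuous_on_mat_cexp:
  fixes T :: "real \<Rightarrow> 'a::unital_cstar_algebra mat"
  assumes T: "\<And>t. t \<in> S \<Longrightarrow> T t \<in> carrier_mat n n" and "compact S"
    and cont: "\<And>i j. i < n \<Longrightarrow> j < n \<Longrightarrow> continuous_on S (\<lambda>t. T t $$ (i, j))"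
    and ij: "i < n" "j < n"
  shows "continuous_on S (\<lambda>t. mat_cexp c (T t) $$ (i, j))"
proof -
  have "\<exists>B. \<forall>t\<in>S. norm (T t $$ (i, j)) \<le> B" if "i < n" "j < n" for i j
    using compact_imp_bounded[OF compact_continuous_image[OF cont[OF that] \<open>compact S\<close>]]
    by (auto simp: bounded_iff)
  then obtain b where b: "\<And>i j t. i < n \<Longrightarrow> j < n \<Longrightarrow> t \<in> S \<Longrightarrow> norm (T t $$ (i, j)) \<le> b i j"
    by metis
  define B where "B = (\<Sum>i<n. \<Sum>j<n. \<bar>b i j\<bar>)"
  have B: "norm (T t $$ (i, j)) \<le> B" if "t \<in> S" "i < n" "j < n" for i j t
  proof -
    have "norm (T t $$ (i, j)) \<le> \<bar>b i j\<bar>" using b[OF that(2,3,1)] by linarith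
    also have "\<dots> \<le> (\<Sum>j<n. \<bar>b i j\<bar>)"
      by (rule member_le_sum) (use that in auto)
    also have "\<dots> \<le> B"
      unfolding B_def by (rule member_le_sum[of _ _ "\<lambda>i. \<Sum>j<n. \<bar>b i j\<bar>"]) (use that in \<open>auto intro:
          sum_nonneg\<close>)
    finally show ?thesis .
  qed
  have pow: "continuous_on S (\<lambda>t. (T t ^\<^sub>m k) $$ (i, j))" if "i < n" "j < n" for i j k
    using that
  proof (induction k arbitrary: i j)
    case 0
    have "continuous_on S (\<lambda>t. 1\<^sub>m n $$ (i, j) :: 'a)" by simp
    then show ?case by (rule continuous_on_eq) (use carrier_matD[OF T] in simp)
  next
    case (Suc k)
    then show ?case
      using continuous_on_mult_mat[of S "\<lambda>t. T t ^\<^sub>m k" n n T n i j] T cont by simp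
  qed
  have "uniform_limit S (\<lambda>N t. \<Sum>k<N. (c ^ k /\<^sub>R fact k) *\<^sub>C (T t ^\<^sub>m k) $$ (i, j))
      (\<lambda>t. \<Sum>k. (c ^ k /\<^sub>R fact k) *\<^sub>C (T t ^\<^sub>m k) $$ (i, j)) sequentially"
    by (rule Weierstrass_m_test[OF _ summable_exp_generic[of "cmod c * (real n * B)"]])
      (rule norm_mat_cexp_term_le[OF T B ij])
  then have "continuous_on S (\<lambda>t. \<Sum>k. (c ^ k /\<^sub>R fact k) *\<^sub>C (T t ^\<^sub>m k) $$ (i, j))"
    by (rule uniform_limit_theorem[rotated])
      (auto intro!: always_eventually continuous_on_sum bounded_linear.continuous_on[OF
          bounded_linear_scaleC] pow ij)
  then show ?thesis
    by (rule continuous_on_eq) (simp add: mat_cexp_index[OF T ij])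
qed

section \<open>The exponential map\<close>

lemma map_mat_indexD:
  assumes "map_mat f X = Y" "X \<in> carrier_mat n m" "i < n" "j < m"
  shows "f (X $$ (i, j)) = Y $$ (i, j)"
  using assms(2-) by (auto simp flip: assms(1))

text \<open>Adding \<open>mat_star w\<close> on both sides turns the common summand into something
  homotopic to 1. This disposes of the auxiliary projection in \<open>K00_rel\<close> after
  exponentiation.\<close>

lemma K1_rel_cancel:
  assumes "(x \<oplus>\<^sub>m w, y \<oplus>\<^sub>m w) \<in> K1_rel" "x \<in> unitaries" "y \<in> unitaries" "w \<in> unitaries"
  shows "(x, y) \<in> K1_rel"
proof -
  have w: "w \<in> unitaries_dim (dim_row w)" using assms(4) by (simp add: unitaries_iff)
  have ws: "mat_star w \<in> unitaries" using mat_star_unitaries_dim[OF w] by (rule unitaries_dim_unitaries)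
  have ww: "(w \<oplus>\<^sub>m mat_star w, 1\<^sub>m (dim_row w + dim_row w)) \<in> K1_rel"
    using K1_rel_sum_star[OF w] K1_rel_swap[OF assms(4) ws] by (rule K1_rel_trans[rotated])
  have absorb: "(z \<oplus>\<^sub>m (w \<oplus>\<^sub>m mat_star w), z) \<in> K1_rel" if "z \<in> unitaries" for z
    using K1_rel_trans[OF K1_rel_sum_left[OF ww that] K1_rel_sum_one] that by (simp add: unitaries_iff)
  have "(mat_star w, mat_star w) \<in> K1_rel"
    using equiv_K1_rel ws by (meson equivE refl_onD)
  then have "(x \<oplus>\<^sub>m (w \<oplus>\<^sub>m mat_star w), y \<oplus>\<^sub>m (w \<oplus>\<^sub>m mat_star w)) \<in> K1_rel"
    using K1_rel_sum[OF assms(1)] by (simp flip: mat_sum_assoc)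
  then show ?thesis
    using absorb assms(2,3) K1_rel_trans K1_rel_sym by metis
qed

section \<open>Projections and Murray--von Neumann equivalence\<close>

lemma projectionsE:
  assumes "P \<in> projections"
  obtains n where "P \<in> carrier_mat n n" "mat_star P = P" "P * P = P"
  using assms unfolding projections_def by blast

lemma projections_sum:
  assumes "P \<in> projections" "Q \<in> projections"
  shows "P \<oplus>\<^sub>m Q \<in> projections"
proof -
  obtain n where P: "P \<in> carrier_mat n n" "mat_star P = P" "P * P = P" using assms(1) by (rule
      projectionsE)
  obtain m where Q: "Q \<in> carrier_mat m m" "mat_star Q = Q" "Q * Q = Q" using assms(2) by (rule
      projectionsE)
  have "P \<oplus>\<^sub>m Q \<in> carrier_mat (n + m) (n + m)" using P(1) Q(1) by simp
  moreover have "mat_star (P \<oplus>\<^sub>m Q) = P \<oplus>\<^sub>m Q" using P Q by (simp add: mat_star_sum)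
  moreover have "(P \<oplus>\<^sub>m Q) * (P \<oplus>\<^sub>m Q) = P \<oplus>\<^sub>m Q" using P Q by (simp add: mat_sum_mult[of _ n _ m])
  ultimately show ?thesis unfolding projections_def by blast
qed

lemma one_projection: "1\<^sub>m n \<in> projections"
  unfolding projections_def by (auto intro!: exI[of _ n])

lemma mvn_refl: "P \<in> projections \<Longrightarrow> mvn P P"
  unfolding mvn_def by (elim projectionsE, rule bexI[of _ P]) auto

text \<open>The witness is \<open>V * P\<close> for a given implementing matrix \<open>V\<close>;
  for it the two absorption relations follow from associativity and idempotence.\<close>

lemma mvn_partial_isometry:
  assumes "mvn P Q" and P: "P \<in> carrier_mat n n" "mat_star P = P" "P * P = P"
    and Q: "Q \<in> carrier_mat m m" "Q * Q = Q"
  obtains V where "V \<in> carrier_mat m n" "mat_star V * V = P" "V * mat_star V = Q" "V * P = V" "Q * V = V"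
proof -
  obtain V where V: "V \<in> carrier_mat m n" "mat_star V * V = P" "V * mat_star V = Q"
    using assms(1) carrier_matD(1)[OF P(1)] carrier_matD(1)[OF Q(1)] unfolding mvn_def by auto
  let ?W = "mat_star V"
  have W: "?W \<in> carrier_mat n m" using V(1) by simp
  have VP: "V * P \<in> carrier_mat m n" "P * ?W \<in> carrier_mat n m" using V(1) W P(1) by auto
  have star: "mat_star (V * P) = P * ?W" using mat_star_mult[OF V(1) P(1)] P(2) by simp
  have "mat_star (V * P) * (V * P) = P * (?W * (V * P))"
    unfolding star by (rule assoc_mult_mat[OF P(1) W VP(1)])
  also have "?W * (V * P) = P" using assoc_mult_mat[OF W V(1) P(1)] V(2) P(3) by simp
  finally have 1: "mat_star (V * P) * (V * P) = P" using P(3) by simp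
  have PW: "P * (P * ?W) = P * ?W" using assoc_mult_mat[OF P(1) P(1) W] P(3) by simp
  have "(V * P) * mat_star (V * P) = V * (P * (P * ?W))"
    unfolding star by (rule assoc_mult_mat[OF V(1) P(1) VP(2)])
  also have "\<dots> = V * ((?W * V) * ?W)" unfolding PW V(2) ..
  also have "\<dots> = V * (?W * Q)" unfolding assoc_mult_mat[OF W V(1) W] V(3) ..
  also have "\<dots> = Q" using assoc_mult_mat[OF V(1) W Q(1)] V(3) Q(2) by simp
  finally have 2: "(V * P) * mat_star (V * P) = Q" .
  have 3: "V * P * P = V * P" using assoc_mult_mat[OF V(1) P(1) P(1)] P(3) by simp
  have "Q * (V * P) = V * (?W * (V * P))"
    unfolding V(3)[symmetric] by (rule assoc_mult_mat[OF V(1) W VP(1)])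
  also have "?W * (V * P) = P" using assoc_mult_mat[OF W V(1) P(1)] V(2) P(3) by simp
  finally have 4: "Q * (V * P) = V * P" .
  show ?thesis by (rule that[OF VP(1) 1 2 3 4])
qed

abbreviation scaleR_mat :: "real \<Rightarrow> 'a::real_normed_vector mat \<Rightarrow> 'a mat" where
  "scaleR_mat r A \<equiv> map_mat ((*\<^sub>R) r) A"

lemma scaleR_mat_mult:
  fixes A B :: "'a::real_normed_algebra mat"
  assumes "A \<in> carrier_mat n m" "B \<in> carrier_mat m k"
  shows "scaleR_mat a A * scaleR_mat b B = scaleR_mat (a * b) (A * B)"
  by (rule eq_matI) (use assms in \<open>auto simp: scalar_prod_def scaleR_sum_right mult.commute\<close>)

lemma scaleR_mat_add: "scaleR_mat a A + scaleR_mat b A = scaleR_mat (a + b) A"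
  by (rule eq_matI) (auto simp: scaleR_add_left)

text \<open>The path \<open>R t = W\<^sub>t W\<^sub>t\<^sup>*\<close>, with \<open>W\<^sub>t\<close> the column of \<open>\<surd>(1 - t) P\<close> and \<open>\<surd>t V\<close>, joins
  \<open>P \<oplus> 0\<close> to \<open>0 \<oplus> Q\<close>. Since its entries are polynomial in \<open>P\<close>, \<open>V\<close>, \<open>Q\<close>, it lifts entrywise.\<close>

lemma rotation_projection:
  fixes P Q V :: "'b::cstar_algebra mat"
  assumes P: "P \<in> carrier_mat n n" "mat_star P = P" "P * P = P"
    and Q: "Q \<in> carrier_mat m m" "mat_star Q = Q" "Q * Q = Q"
    and V: "V \<in> carrier_mat m n" "mat_star V * V = P" "V * mat_star V = Q" "V * P = V" "Q * V = V"
    and t: "0 \<le> t" "t \<le> 1"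
  defines "R \<equiv> four_block_mat (scaleR_mat (1 - t) P) (scaleR_mat (sqrt (t * (1 - t))) (mat_star V))
    (scaleR_mat (sqrt (t * (1 - t))) V) (scaleR_mat t Q)"
  shows "R \<in> carrier_mat (n + m) (n + m)" "R * R = R"
proof -
  have W: "mat_star V \<in> carrier_mat n m" using V(1) by simp
  have PW: "P * mat_star V = mat_star V" using mat_star_mult[OF V(1) P(1)] P(2) V(4) by simp
  have WQ: "mat_star V * Q = mat_star V" using mat_star_mult[OF Q(1) V(1)] Q(2) V(5) by simp
  show "R \<in> carrier_mat (n + m) (n + m)"
    unfolding R_def using P(1) Q(1) by simp
  have q: "sqrt (t * (1 - t)) * sqrt (t * (1 - t)) = t * (1 - t)" "\<bar>t * (1 - t)\<bar> = t * (1 - t)"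
    using t by simp_all
  have "R * R = four_block_mat
    (scaleR_mat ((1 - t) * (1 - t)) P + scaleR_mat (t * (1 - t)) P)
    (scaleR_mat ((1 - t) * sqrt (t * (1 - t))) (mat_star V) + scaleR_mat (sqrt (t * (1 - t)) * t)
        (mat_star V))
    (scaleR_mat (sqrt (t * (1 - t)) * (1 - t)) V + scaleR_mat (t * sqrt (t * (1 - t))) V)
    (scaleR_mat (t * (1 - t)) Q + scaleR_mat (t * t) Q)"
    unfolding R_def using P Q V W
    by (subst mult_four_block_mat[of _ n n _ m _ m _ _ n _ m])
      (simp_all add: scaleR_mat_mult[of _ n n _ n] scaleR_mat_mult[of _ n n _ m]
        scaleR_mat_mult[of _ n m _ m] scaleR_mat_mult[of _ n m _ n] scaleR_mat_mult[of _ m n _ n]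
        scaleR_mat_mult[of _ m n _ m] scaleR_mat_mult[of _ m m _ m] scaleR_mat_mult[of _ m m _ n] PW WQ q
        del: real_sqrt_mult)
  also have "\<dots> = R"
    unfolding scaleR_mat_add R_def by (simp add: algebra_simps)
  finally show "R * R = R" .
qed

text \<open>The situation after unitizing a short exact sequence: the ideal is then the kernel only up
  to scalars.\<close>

locale unital_extension =
  fixes F :: "'i::unital_cstar_algebra \<Rightarrow> 'a::unital_cstar_algebra"
    and G :: "'a \<Rightarrow> 'b::unital_cstar_algebra"
  assumes F: "star_hom F" "F 1 = 1" and inj_F: "inj F" and norm_F: "norm (F x) = norm x"
    and G: "star_hom G" "G 1 = 1" and surj_G: "surj G"
    and range_F: "G a = c *\<^sub>C 1 \<Longrightarrow> a \<in> range F"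
begin

abbreviation F_inv :: "'a \<Rightarrow> 'i" where
  "F_inv \<equiv> inv_into UNIV F"

abbreviation exp2pi :: "'a mat \<Rightarrow> 'a mat" where
  "exp2pi T \<equiv> mat_cexp (2 * complex_of_real pi * \<i>) T"

text \<open>This is \<open>exp_rep\<close> when \<open>F\<close> and \<open>G\<close> are the
  unitizations of the maps of a short exact sequence.\<close>

definition exp_lift :: "'b mat \<Rightarrow> 'i mat \<Rightarrow> bool" where
  "exp_lift P u \<longleftrightarrow> u \<in> unitaries \<and>
    (\<exists>T. mat_star T = T \<and> map_mat G T = P \<and> map_mat F u = exp2pi T)"

lemma F_F_inv: "a \<in> range F \<Longrightarrow> F (F_inv a) = a"
  by (rule f_inv_into_f)

lemma unitary_pullback:
  assumes X: "X \<in> unitaries_dim n" and r: "\<And>i j. i < n \<Longrightarrow> j < n \<Longrightarrow> X $$ (i, j) \<in> range F"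
  shows "map_mat F_inv X \<in> unitaries_dim n" "map_mat F (map_mat F_inv X) = X"
proof -
  note Xd = unitaries_dimD[OF X]
  show eq: "map_mat F (map_mat F_inv X) = X"
    by (rule eq_matI) (use Xd(1) r in \<open>auto simp: F_F_inv\<close>)
  let ?u = "map_mat F_inv X"
  have u: "?u \<in> carrier_mat n n" "mat_star ?u \<in> carrier_mat n n" using Xd(1) by simp_all
  have "map_mat F (mat_star ?u * ?u) = map_mat F (1\<^sub>m n)" "map_mat F (?u * mat_star ?u) = map_mat F
      (1\<^sub>m n)"
    unfolding map_mat_star_hom_mult[OF F(1) u(2,1)] map_mat_star_hom_mult[OF F(1) u]
      map_mat_star_hom_star[OF F(1)] eq
    using Xd by (simp_all add: map_mat_one[of F] F star_hom_zero)
  then show "?u \<in> unitaries_dim n"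
    using u by (simp add: unitaries_dim_def map_mat_inj[OF inj_F])
qed

text \<open>Under \<open>G\<close> the exponential becomes that of a projection at 2 pi i, hence the
  identity, and elements over scalars come from the ideal side.\<close>

lemma exp2pi_range:
  assumes T: "T \<in> carrier_mat n n" and P: "map_mat G T = P" "P * P = P" and ij: "i < n" "j < n"
  shows "exp2pi T $$ (i, j) \<in> range F"
proof -
  have Pc: "P \<in> carrier_mat n n" using T P(1) by auto
  have "map_mat G (exp2pi T) = 1\<^sub>m n"
    using mat_cexp_hom[OF G T] mat_cexp_projection[OF Pc P(2)] P(1) by simp
  then have "G (exp2pi T $$ (i, j)) = 1\<^sub>m n $$ (i, j)"
    by (rule map_mat_indexD[OF _ mat_cexp_carrier[OF T] ij])
  also have "\<dots> = (if i = j then 1 else 0) *\<^sub>C 1"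
    using ij by (simp add: scaleC_one scaleC_zero_left)
  finally show ?thesis by (rule range_F)
qed

lemma lift_selfadjoint:
  assumes "star b = b"
  obtains a where "star a = a" "G a = b"
proof -
  obtain a where a: "G a = b" using surj_G by (metis surjD)
  show ?thesis
  proof (rule that[of "(1/2) *\<^sub>R (a + star a)"])
    show "star ((1/2) *\<^sub>R (a + star a)) = (1/2) *\<^sub>R (a + star a)"
      by (simp add: star_scaleR star_add star_star add.commute)
    show "G ((1/2) *\<^sub>R (a + star a)) = b"
      using assms a G(1) by (simp add: star_hom_scaleR star_hom_add star_hom_star flip: scaleR_2)
  qed
qed

lemma lift_mat:
  assumes "P \<in> carrier_mat n m"
  obtains T where "T \<in> carrier_mat n m" "map_mat G T = P"
proof (rule that)
  show "map_mat (inv_into UNIV G) P \<in> carrier_mat n m" using assms by simp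
  show "map_mat G (map_mat (inv_into UNIV G) P) = P"
    by (rule eq_matI) (simp_all add: surj_f_inv_f[OF surj_G])
qed

lemma lift_mat_selfadjoint:
  assumes P: "P \<in> carrier_mat n n" "mat_star P = P"
  obtains T where "T \<in> carrier_mat n n" "mat_star T = T" "map_mat G T = P"
proof -
  obtain T where T: "T \<in> carrier_mat n n" "map_mat G T = P" using P(1) by (rule lift_mat)
  let ?T = "scaleR_mat (1/2) (T + mat_star T)"
  have Tij: "G (T $$ (i, j)) = P $$ (i, j)" if "i < n" "j < n" for i j
    using that T by auto
  have Pij: "star (P $$ (j, i)) = P $$ (i, j)" if "i < n" "j < n" for i j
  proof -
    have "star (P $$ (j, i)) = mat_star P $$ (i, j)" using P(1) that by simp
    then show ?thesis by (simp only: P(2))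
  qed
  show ?thesis
  proof (rule that)
    show "?T \<in> carrier_mat n n" using T(1) by simp
    show "mat_star ?T = ?T"
      by (rule eq_matI) (use T(1) in \<open>auto simp: star_scaleR star_add star_star add.commute\<close>)
    show "map_mat G ?T = P"
      by (rule eq_matI) (use T(1) P(1) in \<open>auto simp: star_hom_scaleR[OF G(1)] star_hom_add[OF G(1)]
        star_hom_star[OF G(1)] Tij Pij simp flip: scaleR_2\<close>)
  qed
qed

lemma exp_lift_of_lift:
  assumes T: "T \<in> carrier_mat n n" "mat_star T = T" "map_mat G T = P" and P: "P * P = P"
  shows "map_mat F_inv (exp2pi T) \<in> unitaries_dim n"
    and "map_mat F (map_mat F_inv (exp2pi T)) = exp2pi T"
    and "exp_lift P (map_mat F_inv (exp2pi T))"
proof -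
  show 1: "map_mat F_inv (exp2pi T) \<in> unitaries_dim n" "map_mat F (map_mat F_inv (exp2pi T)) = exp2pi T"
    by (rule unitary_pullback[OF mat_cexp_unitary[OF T(1,2)] exp2pi_range[OF T(1,3) P]]; assumption)+
  then show "exp_lift P (map_mat F_inv (exp2pi T))"
    unfolding exp_lift_def using T unitaries_dim_unitaries by blast
qed

lemma exp_lift_exists:
  assumes "P \<in> projections"
  obtains u where "exp_lift P u"
  using assms by (metis projectionsE lift_mat_selfadjoint exp_lift_of_lift(3))

lemma exp_liftE:
  assumes "exp_lift P u" "P \<in> carrier_mat n n"
  obtains T where "T \<in> carrier_mat n n" "mat_star T = T" "map_mat G T = P" "map_mat F u = exp2pi T"
    "u \<in> unitaries_dim n"
proof -
  obtain T where T: "mat_star T = T" "map_mat G T = P" "map_mat F u = exp2pi T" and u: "u \<in> unitaries"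
    using assms(1) unfolding exp_lift_def by blast
  have Tc: "T \<in> carrier_mat n n" using T(2) assms(2) by auto
  have "dim_row u = n" using arg_cong[OF T(3), of dim_row] Tc by simp
  with u have "u \<in> unitaries_dim n" by (simp add: unitaries_iff)
  with that T Tc show ?thesis by blast
qed

lemma exp_lift_unitaries: "exp_lift P u \<Longrightarrow> u \<in> unitaries"
  unfolding exp_lift_def by blast

lemma exp_lift_sum:
  assumes "exp_lift P u" "exp_lift Q v" and P: "P \<in> projections" and Q: "Q \<in> projections"
  shows "exp_lift (P \<oplus>\<^sub>m Q) (u \<oplus>\<^sub>m v)"
proof -
  obtain n m where c: "P \<in> carrier_mat n n" "Q \<in> carrier_mat m m" using P Q by (metis projectionsE)
  obtain T where T: "T \<in> carrier_mat n n" "mat_star T = T" "map_mat G T = P" "map_mat F u = exp2pi T"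
    "u \<in> unitaries_dim n" by (rule exp_liftE[OF assms(1) c(1)])
  obtain S where S: "S \<in> carrier_mat m m" "mat_star S = S" "map_mat G S = Q" "map_mat F v = exp2pi S"
    "v \<in> unitaries_dim m" by (rule exp_liftE[OF assms(2) c(2)])
  have "u \<oplus>\<^sub>m v \<in> unitaries" using sum_unitaries_dim[OF T(5) S(5)] by (rule unitaries_dim_unitaries)
  moreover have "mat_star (T \<oplus>\<^sub>m S) = T \<oplus>\<^sub>m S" using T S by (simp add: mat_star_sum)
  moreover have "map_mat G (T \<oplus>\<^sub>m S) = P \<oplus>\<^sub>m Q" using T S by (simp add: map_mat_sum star_hom_zero[OF
      G(1)])
  moreover have "map_mat F (u \<oplus>\<^sub>m v) = exp2pi (T \<oplus>\<^sub>m S)"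
    using T S by (simp add: map_mat_sum star_hom_zero[OF F(1)] mat_cexp_sum)
  ultimately show ?thesis unfolding exp_lift_def by blast
qed

text \<open>The lifts behind \<open>u\<close> and \<open>v\<close> are arbitrary, so the case
  \<open>P = Q\<close> also yields independence of the lift.\<close>

lemma exp_lift_mvn:
  assumes mvn: "mvn P Q" and P: "P \<in> projections" and Q: "Q \<in> projections"
    and u: "exp_lift P u" and v: "exp_lift Q v"
  shows "(u, v) \<in> K1_rel"
proof -
  obtain n where P: "P \<in> carrier_mat n n" "mat_star P = P" "P * P = P" using P by (rule projectionsE)
  obtain m where Q: "Q \<in> carrier_mat m m" "mat_star Q = Q" "Q * Q = Q" using Q by (rule projectionsE)
  obtain T where T: "T \<in> carrier_mat n n" "mat_star T = T" "map_mat G T = P" "map_mat F u = exp2pi T"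
    "u \<in> unitaries_dim n" by (rule exp_liftE[OF u P(1)])
  obtain T' where T': "T' \<in> carrier_mat m m" "mat_star T' = T'" "map_mat G T' = Q" "map_mat F v =
      exp2pi T'"
    "v \<in> unitaries_dim m" by (rule exp_liftE[OF v Q(1)])
  obtain V where V: "V \<in> carrier_mat m n" "mat_star V * V = P" "V * mat_star V = Q" "V * P = V" "Q *
      V = V"
    by (rule mvn_partial_isometry[OF mvn P Q(1,3)])
  obtain S where S: "S \<in> carrier_mat m n" "map_mat G S = V" using V(1) by (rule lift_mat)
  define q where "q t = sqrt (t * (1 - t))" for t :: real
  \<comment> \<open>A self-adjoint lift of the projection path that starts at \<open>T\<close> plus
    a zero block and ends at a zero block plus \<open>T'\<close>. Only its image under
    \<open>G\<close> consists of projections, which suffices for the exponentials to come from the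
    ideal side.\<close>
  define L where "L t = four_block_mat (scaleR_mat (1 - t) T) (scaleR_mat (q t) (mat_star S))
    (scaleR_mat (q t) S) (scaleR_mat t T')" for t
  define c where "c t = map_mat F_inv (exp2pi (L t))" for t
  have Lc: "L t \<in> carrier_mat (n + m) (n + m)" for t
    unfolding L_def using T(1) T'(1) by simp
  have sc: "mat_star (scaleR_mat r A) = scaleR_mat r (mat_star A)" for r and A :: "'a mat"
    by (rule eq_matI) (simp_all add: star_scaleR)
  have Ls: "mat_star (L t) = L t" for t
    unfolding L_def using T T' S
    by (subst mat_star_four_block[of _ n n _ m _ m]) (simp_all add: sc)
  have Gsc: "map_mat G (scaleR_mat r A) = scaleR_mat r (map_mat G A)" for r and A :: "'a mat"
    by (rule eq_matI) (simp_all add: star_hom_scaleR[OF G(1)])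
  have GL: "map_mat G (L t) = four_block_mat (scaleR_mat (1 - t) P) (scaleR_mat (q t) (mat_star V))
    (scaleR_mat (q t) V) (scaleR_mat t Q)" for t
    unfolding L_def using T T' S
    by (subst map_four_block_mat[of _ n n _ m _ m])
      (simp_all add: Gsc map_mat_star_hom_star[OF G(1)])
  have c: "c t \<in> unitaries_dim (n + m)" "map_mat F (c t) = exp2pi (L t)" if "t \<in> {0..1}" for t
    unfolding c_def
    using exp_lift_of_lift(1,2)[OF Lc Ls GL[unfolded q_def]] rotation_projection(2)[OF P Q V, of t] that
    by (simp_all add: q_def)
  have "exp2pi (0\<^sub>m k k) = 1\<^sub>m k" for k by (rule mat_cexp_projection) simp_all
  note exp0 = this
  have "L 0 = T \<oplus>\<^sub>m 0\<^sub>m m m" "L 1 = 0\<^sub>m n n \<oplus>\<^sub>m T'"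
    unfolding L_def mat_sum_def using T(1) T'(1) S(1)
    by (auto intro!: cong_four_block_mat eq_matI simp: q_def)
  then have "map_mat F (c 0) = map_mat F (u \<oplus>\<^sub>m 1\<^sub>m m)" "map_mat F (c 1) = map_mat F (1\<^sub>m n \<oplus>\<^sub>m v)"
    using c(2)[of 0] c(2)[of 1] T T'
    by (simp_all add: mat_cexp_sum[of _ n _ m] exp0 map_mat_sum star_hom_zero[OF F(1)]
        map_mat_one[of F] F(2))
  then have ends: "c 0 = u \<oplus>\<^sub>m 1\<^sub>m m" "c 1 = 1\<^sub>m n \<oplus>\<^sub>m v"
    using map_mat_inj[OF inj_F] by blast+
  have "unitary_homotopic (u \<oplus>\<^sub>m 1\<^sub>m m) (1\<^sub>m n \<oplus>\<^sub>m v)"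
  proof (rule unitary_homotopicI[OF c(1) ends])
    fix i j assume ij: "i < n + m" "j < n + m"
    have "continuous_on {0..1} (\<lambda>t. exp2pi (L t) $$ (i, j))"
    proof (rule continuous_on_mat_cexp[OF Lc _ _ ij])
      fix i j assume ij: "i < n + m" "j < n + m"
      show "continuous_on {0..1} (\<lambda>t. L t $$ (i, j))"
        unfolding L_def
        by (rule continuous_on_four_block[of _ _ n n _ m m])
          (use T(1) T'(1) S(1) ij in \<open>auto intro!: continuous_intros simp: q_def\<close>)
    qed simp
    moreover have Fc: "F (c t $$ (i, j)) = exp2pi (L t) $$ (i, j)" if "t \<in> {0..1}" for t
      by (rule map_mat_indexD[OF c(2)[OF that] unitaries_dimD(1)[OF c(1)[OF that]] ij])
    \<comment> \<open>Continuity is known for the exponentials; isometry of \<open>F\<close> moves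
      it to their preimages.\<close>
    moreover have "dist (c s $$ (i, j)) (c t $$ (i, j)) = dist (F (c s $$ (i, j))) (F (c t $$ (i,
        j)))" for s t
      by (simp add: dist_norm norm_F flip: star_hom_diff[OF F(1)])
    ultimately show "continuous_on {0..1} (\<lambda>t. c t $$ (i, j))"
      unfolding continuous_on_iff by simp
  qed simp_all
  \<comment> \<open>The path ends with \<open>v\<close> in the lower block, while
    \<open>K1_rel\<close> pads on the right.\<close>
  moreover have "unitary_homotopic (1\<^sub>m n \<oplus>\<^sub>m v) (v \<oplus>\<^sub>m 1\<^sub>m n)"
    by (rule unitary_homotopic_swap[OF one_unitaries_dim T'(5)])
  ultimately have "unitary_homotopic (u \<oplus>\<^sub>m 1\<^sub>m m) (v \<oplus>\<^sub>m 1\<^sub>m n)"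
    by (rule unitary_homotopic_trans[OF _ _ mat_sum_carrier[OF unitaries_dimD(1)[OF T(5)]
        one_carrier_mat]])
  then show ?thesis by (rule K1_relI[OF T(5) T'(5) add.commute])
qed

text \<open>Equality of two formal differences in additive form. The stabilizing projection
  \<open>R\<close> is exponentiated along with the others and then cancelled.\<close>

lemma exp_lift_K00_rel:
  assumes rel: "((P, Q), (P', Q')) \<in> K00_rel"
    and u: "exp_lift P u" and v: "exp_lift Q v" and u': "exp_lift P' u'" and v': "exp_lift Q' v'"
  shows "(u \<oplus>\<^sub>m v', u' \<oplus>\<^sub>m v) \<in> K1_rel"
proof -
  obtain R where pr: "P \<in> projections" "Q \<in> projections" "P' \<in> projections" "Q' \<in> projections" "R \<in>
      projections"
    and mvn: "mvn (P \<oplus>\<^sub>m Q' \<oplus>\<^sub>m R) (P' \<oplus>\<^sub>m Q \<oplus>\<^sub>m R)"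
    using rel unfolding K00_rel_def by blast
  obtain w where w: "exp_lift R w" using pr(5) by (rule exp_lift_exists)
  have "(u \<oplus>\<^sub>m v' \<oplus>\<^sub>m w, u' \<oplus>\<^sub>m v \<oplus>\<^sub>m w) \<in> K1_rel"
    by (rule exp_lift_mvn[OF mvn]) (intro exp_lift_sum projections_sum pr u v u' v' w)+
  then have "((u \<oplus>\<^sub>m v') \<oplus>\<^sub>m w, (u' \<oplus>\<^sub>m v) \<oplus>\<^sub>m w) \<in> K1_rel" by (simp add: mat_sum_assoc)
  then show ?thesis
    by (rule K1_rel_cancel)
      (intro sum_unitaries exp_lift_unitaries[OF u] exp_lift_unitaries[OF v]
        exp_lift_unitaries[OF u'] exp_lift_unitaries[OF v'] exp_lift_unitaries[OF w])+
qed

text \<open>The identity is its own lift and exponentiates to itself, so the class subtracted in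
  \<open>qC_generator\<close> has trivial boundary.\<close>

lemma exp_lift_one: "exp_lift (1\<^sub>m n) (1\<^sub>m n)"
  unfolding exp_lift_def
  by (intro conjI one_unitaries exI[of _ "1\<^sub>m n"])
    (simp_all add: map_mat_one star_hom_zero[OF F(1)] star_hom_zero[OF G(1)] F G
        mat_cexp_projection[of _ n])

end

section \<open>Unitaries with orthogonal diagonal blocks\<close>

abbreviation kdelta :: "nat \<Rightarrow> nat \<Rightarrow> 'a::zero_neq_one" where
  "kdelta i j \<equiv> (if i = j then 1 else 0)"

text \<open>Unitarity is restated through \<open>X\<close> alone, free of the unit, because the
  compression applied later to \<open>X\<close> need not carry the identity matrix to
  itself.\<close>

lemma unitary_one_plus_iff:
  fixes X :: "nat \<Rightarrow> nat \<Rightarrow> 'a::unital_cstar_algebra"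
  assumes M: "M \<in> carrier_mat n n" "\<And>i j. i < n \<Longrightarrow> j < n \<Longrightarrow> M $$ (i, j) = kdelta i j + X i j"
  shows "M \<in> unitaries_dim n \<longleftrightarrow> (\<forall>a<n. \<forall>b<n.
    X a b + star (X b a) + (\<Sum>k<n. star (X k a) * X k b) = 0 \<and>
    X a b + star (X b a) + (\<Sum>k<n. X a k * star (X b k)) = 0)"
proof -
  have sM: "mat_star M \<in> carrier_mat n n" using M(1) by simp
  have sdelta: "star (kdelta i j) = (kdelta i j :: 'a)" for i j
    by (simp add: star_one star_zero)
  have 1: "(mat_star M * M) $$ (a, b) = kdelta a b + (X a b + star (X b a) + (\<Sum>k<n. star (X k a) * X
      k b))"
    if ab: "a < n" "b < n" for a b
  proof -
    have "(mat_star M * M) $$ (a, b) = (\<Sum>k<n. star (kdelta k a + X k a) * (kdelta k b + X k b))"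
      unfolding index_mult_mat_sum[OF sM M(1) ab] using ab M by (intro sum.cong) auto
    also have "\<dots> = (\<Sum>k<n. (if k = a then kdelta a b + X a b else 0) + (if k = b then star (X b a) else 0)
        + star (X k a) * X k b)"
      by (rule sum.cong) (auto simp: star_add sdelta star_one star_zero algebra_simps)
    finally show ?thesis using ab by (simp add: sum.distrib add.assoc)
  qed
  have 2: "(M * mat_star M) $$ (a, b) = kdelta a b + (X a b + star (X b a) + (\<Sum>k<n. X a k * star (X
      b k)))"
    if ab: "a < n" "b < n" for a b
  proof -
    have "(M * mat_star M) $$ (a, b) = (\<Sum>k<n. (kdelta a k + X a k) * star (kdelta b k + X b k))"
      unfolding index_mult_mat_sum[OF M(1) sM ab] using ab M by (intro sum.cong) auto
    also have "\<dots> = (\<Sum>k<n. (if k = b then kdelta a b + X a b else 0) + (if k = a then star (X b a) else 0)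
        + X a k * star (X b k))"
      by (rule sum.cong) (auto simp: star_add sdelta star_one star_zero algebra_simps)
    finally show ?thesis using ab by (simp add: sum.distrib add.assoc)
  qed
  have eq: "A = 1\<^sub>m n \<longleftrightarrow> (\<forall>a<n. \<forall>b<n. A $$ (a, b) = kdelta a b)" if "A \<in> carrier_mat n n" for A ::
      "'a mat"
    using that by (auto intro!: eq_matI)
  show ?thesis
    unfolding unitaries_dim_def
    using M(1) sM by (auto simp: eq[OF mult_carrier_mat[OF sM M(1)]] eq[OF mult_carrier_mat[OF M(1)
        sM]] 1 2
        simp del: index_mult_mat)
qed

text \<open>The vectors \<open>e 0\<close>, \<open>e 1\<close> need not be orthogonal: the products of \<open>f\<close> and \<open>g\<close> that would see
  this vanish.\<close>

lemma sum_compressed_mult: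
  fixes f g :: "nat \<Rightarrow> nat \<Rightarrow> 'a::real_normed_algebra" and e :: "nat \<Rightarrow> nat \<Rightarrow> real"
  assumes orth: "\<And>i j k l. i < n \<Longrightarrow> j < n \<Longrightarrow> k < n \<Longrightarrow> l < n \<Longrightarrow> i \<noteq> k \<Longrightarrow> f i j * g k l = 0"
    and e: "\<And>i. i < n \<Longrightarrow> (\<Sum>c<m. e i c * e i c) = 1"
  shows "(\<Sum>c<m. (\<Sum>i<n. \<Sum>j<n. (e i c * e j a) *\<^sub>R f i j) * (\<Sum>k<n. \<Sum>l<n. (e k c * e l b) *\<^sub>R g k l))
    = (\<Sum>j<n. \<Sum>l<n. (e j a * e l b) *\<^sub>R (\<Sum>i<n. f i j * g i l))"
proof -
  define Z where "Z i = (\<Sum>j<n. \<Sum>l<n. (e j a * e l b) *\<^sub>R (f i j * g i l))" for i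
  have inner: "(\<Sum>i<n. \<Sum>j<n. (e i c * e j a) *\<^sub>R f i j) * (\<Sum>k<n. \<Sum>l<n. (e k c * e l b) *\<^sub>R g k l)
      = (\<Sum>i<n. (e i c * e i c) *\<^sub>R Z i)" for c
  proof -
    have "(\<Sum>i<n. \<Sum>j<n. (e i c * e j a) *\<^sub>R f i j) * (\<Sum>k<n. \<Sum>l<n. (e k c * e l b) *\<^sub>R g k l)
      = (\<Sum>i<n. \<Sum>k<n. (\<Sum>j<n. (e i c * e j a) *\<^sub>R f i j) * (\<Sum>l<n. (e k c * e l b) *\<^sub>R g k l))"
      by (rule sum_product)
    also have "\<dots> = (\<Sum>i<n. \<Sum>k<n. if k = i then (e i c * e i c) *\<^sub>R Z i else 0)"
    proof (intro sum.cong refl)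
      fix i k assume ik: "i \<in> {..<n}" "k \<in> {..<n}"
      have "(\<Sum>j<n. (e i c * e j a) *\<^sub>R f i j) * (\<Sum>l<n. (e k c * e l b) *\<^sub>R g k l)
          = (\<Sum>j<n. \<Sum>l<n. ((e i c * e j a) * (e k c * e l b)) *\<^sub>R (f i j * g k l))"
        by (simp add: sum_product mult_ac)
      also have "\<dots> = (if k = i then (e i c * e i c) *\<^sub>R Z i else 0)"
        using ik orth by (auto simp: Z_def scaleR_sum_right mult_ac intro!: sum.neutral sum.cong)
      finally show "(\<Sum>j<n. (e i c * e j a) *\<^sub>R f i j) * (\<Sum>l<n. (e k c * e l b) *\<^sub>R g k l)
          = (if k = i then (e i c * e i c) *\<^sub>R Z i else 0)" .
    qed
    finally show ?thesis by (simp add: sum.delta)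
  qed
  have "(\<Sum>c<m. \<Sum>i<n. (e i c * e i c) *\<^sub>R Z i) = (\<Sum>i<n. (\<Sum>c<m. e i c * e i c) *\<^sub>R Z i)"
    by (subst sum.swap) (simp add: scaleR_sum_left)
  also have "\<dots> = (\<Sum>i<n. Z i)" by (rule sum.cong) (simp_all add: e)
  also have "\<dots> = (\<Sum>j<n. \<Sum>i<n. \<Sum>l<n. (e j a * e l b) *\<^sub>R (f i j * g i l))"
    unfolding Z_def by (rule sum.swap)
  also have "\<dots> = (\<Sum>j<n. \<Sum>l<n. (e j a * e l b) *\<^sub>R (\<Sum>i<n. f i j * g i l))"
    by (rule sum.cong[OF refl], subst sum.swap) (simp add: scaleR_sum_right)
  finally show ?thesis by (simp add: inner)
qed

text \<open>The passage from \<open>d\<close> to \<open>X\<close> is linear, compatible with the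
  involution, and by \<open>sum_compressed_mult\<close> multiplicative on the products of
  \<open>d\<close> with its adjoint in either order. The relations of
  \<open>unitary_one_plus_iff\<close> therefore carry over.\<close>

lemma unitary_compress:
  fixes d :: "nat \<Rightarrow> nat \<Rightarrow> 'a::unital_cstar_algebra" and e :: "nat \<Rightarrow> nat \<Rightarrow> real"
  assumes w: "w \<in> unitaries_dim n" "\<And>i j. i < n \<Longrightarrow> j < n \<Longrightarrow> w $$ (i, j) = kdelta i j + d i j"
    and orth1: "\<And>i j k l. i < n \<Longrightarrow> j < n \<Longrightarrow> k < n \<Longrightarrow> l < n \<Longrightarrow> i \<noteq> k \<Longrightarrow> star (d i j) * d k l = 0"
    and orth2: "\<And>i j k l. i < n \<Longrightarrow> j < n \<Longrightarrow> k < n \<Longrightarrow> l < n \<Longrightarrow> j \<noteq> l \<Longrightarrow> d i j * star (d k l) = 0"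
    and e: "\<And>i. i < n \<Longrightarrow> (\<Sum>c<n. e i c * e i c) = 1"
  shows "Matrix.mat n n (\<lambda>(a, b). kdelta a b + (\<Sum>i<n. \<Sum>j<n. (e i a * e j b) *\<^sub>R d i j)) \<in>
      unitaries_dim n"
proof -
  define X where "X a b = (\<Sum>i<n. \<Sum>j<n. (e i a * e j b) *\<^sub>R d i j)" for a b
  have rel: "d j l + star (d l j) + (\<Sum>i<n. star (d i j) * d i l) = 0"
    "d j l + star (d l j) + (\<Sum>i<n. d j i * star (d l i)) = 0" if "j < n" "l < n" for j l
    using unitary_one_plus_iff[of w n d] w unitaries_dimD(1)[OF w(1)] that by auto
  have sX: "star (X b a) = (\<Sum>j<n. \<Sum>l<n. (e j a * e l b) *\<^sub>R star (d l j))" for a b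
    unfolding X_def by (subst sum.swap) (simp add: star_sum star_scaleR mult.commute)
  have "X a b + star (X b a) + (\<Sum>k<n. star (X k a) * X k b) = 0" for a b
  proof -
    have "(\<Sum>k<n. star (X k a) * X k b) = (\<Sum>k<n. (\<Sum>i<n. \<Sum>j<n. (e i k * e j a) *\<^sub>R star (d i j)) *
        (\<Sum>i<n. \<Sum>l<n. (e i k * e l b) *\<^sub>R d i l))"
      by (simp add: X_def star_sum star_scaleR)
    also have "\<dots> = (\<Sum>j<n. \<Sum>l<n. (e j a * e l b) *\<^sub>R (\<Sum>i<n. star (d i j) * d i l))"
      by (rule sum_compressed_mult[OF orth1 e])
    finally have "X a b + star (X b a) + (\<Sum>k<n. star (X k a) * X k b) =
        (\<Sum>j<n. \<Sum>l<n. (e j a * e l b) *\<^sub>R (d j l + star (d l j) + (\<Sum>i<n. star (d i j) * d i l)))"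
      unfolding sX by (simp add: X_def sum.distrib scaleR_add_right)
    then show ?thesis by (simp add: rel)
  qed
  moreover have "X a b + star (X b a) + (\<Sum>k<n. X a k * star (X b k)) = 0" for a b
  proof -
    have "(\<Sum>k<n. X a k * star (X b k)) = (\<Sum>k<n. (\<Sum>i<n. \<Sum>j<n. (e i k * e j a) *\<^sub>R d j i) *
        (\<Sum>i<n. \<Sum>l<n. (e i k * e l b) *\<^sub>R star (d l i)))"
      unfolding X_def star_sum star_scaleR
      by (subst (1 2) sum.swap) (simp add: mult.commute)
    also have "\<dots> = (\<Sum>j<n. \<Sum>l<n. (e j a * e l b) *\<^sub>R (\<Sum>i<n. d j i * star (d l i)))"
      by (rule sum_compressed_mult[OF orth2 e])
    finally have "X a b + star (X b a) + (\<Sum>k<n. X a k * star (X b k)) =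
        (\<Sum>j<n. \<Sum>l<n. (e j a * e l b) *\<^sub>R (d j l + star (d l j) + (\<Sum>i<n. d j i * star (d l i))))"
      unfolding sX by (simp add: X_def sum.distrib scaleR_add_right)
    then show ?thesis by (simp add: rel)
  qed
  ultimately show ?thesis
    by (subst unitary_one_plus_iff[where X = X]) (simp_all add: X_def)
qed

lemma unitaries_dim_1_iff:
  "Matrix.mat 1 1 (\<lambda>_. u) \<in> unitaries_dim 1 \<longleftrightarrow> star u * u = 1 \<and> u * star u = 1"
proof -
  let ?u = "Matrix.mat 1 1 (\<lambda>_. u)"
  have eq: "A = 1\<^sub>m 1 \<longleftrightarrow> A $$ (0, 0) = 1" if "A \<in> carrier_mat 1 1" for A :: "'a mat"
    using that by (auto intro!: eq_matI)
  have c: "?u \<in> carrier_mat 1 1" "mat_star ?u \<in> carrier_mat 1 1" by simp_all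
  have "(mat_star ?u * ?u) $$ (0, 0) = star u * u" "(?u * mat_star ?u) $$ (0, 0) = u * star u"
    using index_mult_mat_sum[OF c(2,1), of 0 0] index_mult_mat_sum[OF c, of 0 0] by simp_all
  then show ?thesis
    unfolding unitaries_dim_def using c eq[OF mult_carrier_mat[OF c]] eq[OF mult_carrier_mat[OF c(2,1)]]
    by (simp del: index_mult_mat)
qed

text \<open>The orthogonality relations allow both blocks to be rotated into the first one.\<close>

lemma K1_rel_compress:
  fixes d :: "nat \<Rightarrow> nat \<Rightarrow> 'a::unital_cstar_algebra"
  assumes w: "w \<in> unitaries_dim 2" "\<And>i j. i < 2 \<Longrightarrow> j < 2 \<Longrightarrow> w $$ (i, j) = kdelta i j + d i j"
    and orth1: "\<And>i j k l. i < 2 \<Longrightarrow> j < 2 \<Longrightarrow> k < 2 \<Longrightarrow> l < 2 \<Longrightarrow> i \<noteq> k \<Longrightarrow> star (d i j) * d k l = 0"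
    and orth2: "\<And>i j k l. i < 2 \<Longrightarrow> j < 2 \<Longrightarrow> k < 2 \<Longrightarrow> l < 2 \<Longrightarrow> j \<noteq> l \<Longrightarrow> d i j * star (d k l) = 0"
  obtains u where "star u * u = 1" "u * star u = 1" "(w, Matrix.mat 1 1 (\<lambda>_. u)) \<in> K1_rel"
proof -
  \<comment> \<open>\<open>e t 0\<close> stays at (1, 0), while \<open>e t 1\<close> turns from (0,
    1) to (1, 0). At \<open>t = 0\<close> the compression is the original matrix; at
    \<open>t = 1\<close> all four entries are collected in the first position, which produces the
    \<open>u\<close> below.\<close>
  define e :: "real \<Rightarrow> nat \<Rightarrow> nat \<Rightarrow> real" where
    "e t i a = (if i = 0 then kdelta a 0 else if a = 0 then sqrt t else sqrt (1 - t))" for t i a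
  define c where "c t = Matrix.mat 2 2 (\<lambda>(a, b). kdelta a b + (\<Sum>i<2. \<Sum>j<2. (e t i a * e t j b) *\<^sub>R d
      i j))" for t
  define u where "u = 1 + (\<Sum>i<2. \<Sum>j<2. d i j)"
  have less2: "{..<2} = {0, 1 :: nat}" by auto
  have cU: "c t \<in> unitaries_dim 2" if "t \<in> {0..1}" for t
    unfolding c_def
    by (rule unitary_compress[OF w orth1 orth2]) (use that in \<open>auto simp: less2 e_def\<close>)
  have c0: "c 0 = w"
    by (rule eq_matI) (use unitaries_dimD(1)[OF w(1)] in \<open>auto simp: c_def less2 e_def w(2)
        less_2_cases_iff\<close>)
  have c1: "c 1 = Matrix.mat 1 1 (\<lambda>_. u) \<oplus>\<^sub>m 1\<^sub>m 1"
    by (rule eq_matI) (auto simp: c_def less2 e_def mat_sum_index u_def less_Suc_eq)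
  have "unitary_homotopic (w \<oplus>\<^sub>m 1\<^sub>m 0) (Matrix.mat 1 1 (\<lambda>_. u) \<oplus>\<^sub>m 1\<^sub>m 1)"
  proof (rule unitary_homotopicI[where c = c, OF cU _ c1])
    fix i j :: nat assume "i < 2" "j < 2"
    then show "continuous_on {0..1} (\<lambda>t. c t $$ (i, j))"
      by (auto simp: c_def e_def less2 intro!: continuous_intros)
  qed (simp_all add: c0)
  moreover have u: "Matrix.mat 1 1 (\<lambda>_. u) \<in> unitaries_dim 1"
  proof -
    let ?u = "Matrix.mat 1 1 (\<lambda>_. u)"
    have U: "?u \<oplus>\<^sub>m 1\<^sub>m 1 \<in> unitaries_dim 2" using cU[of 1] by (simp add: c1)
    have "mat_star ?u * ?u \<oplus>\<^sub>m 1\<^sub>m 1 = 1\<^sub>m 2" "?u * mat_star ?u \<oplus>\<^sub>m 1\<^sub>m 1 = 1\<^sub>m 2"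
      using unitaries_dimD(2,3)[OF U] by (simp_all add: mat_star_sum[of _ 1 _ 1] mat_sum_mult[of _ 1
          _ 1])
    from this[THEN arg_cong[of _ _ "\<lambda>M. M $$ (0, 0)"]]
    have "(mat_star ?u * ?u) $$ (0, 0) = 1" "(?u * mat_star ?u) $$ (0, 0) = 1"
      by (simp_all add: mat_sum_index)
    then show ?thesis unfolding unitaries_dim_1_iff by (simp_all add: scalar_prod_def mat_star_def)
  qed
  ultimately have "(w, Matrix.mat 1 1 (\<lambda>_. u)) \<in> K1_rel"
    by (intro K1_relI[OF w(1) u, of 0 1]) simp_all
  with u that show ?thesis unfolding unitaries_dim_1_iff by blast
qed

text \<open>\<open>corner p q\<close> is a purely algebraic substitute for the closure of \<open>p A q\<close>.\<close>

definition corner :: "'a::cstar_algebra \<Rightarrow> 'a \<Rightarrow> 'a set" where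
  "corner p q = {a. (\<forall>b. b * p = 0 \<longrightarrow> b * a = 0) \<and> (\<forall>b. q * b = 0 \<longrightarrow> a * b = 0)}"

lemma corner_mem: "p * y * q \<in> corner p q"
proof -
  have "b * (p * y * q) = (b * p) * (y * q)" "(p * y * q) * b = (p * y) * (q * b)" for b
    by (simp_all add: mult.assoc)
  then show ?thesis unfolding corner_def by simp
qed

lemma corner_zero [simp]: "0 \<in> corner p q"
  by (simp add: corner_def)

lemma corner_add: "a \<in> corner p q \<Longrightarrow> b \<in> corner p q \<Longrightarrow> a + b \<in> corner p q"
  by (simp add: corner_def algebra_simps)

lemma corner_scaleC: "a \<in> corner p q \<Longrightarrow> c *\<^sub>C a \<in> corner p q"
  by (simp add: corner_def mult_scaleC_left mult_scaleC_right scaleC_zero_right)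

lemma corner_mult: "a \<in> corner p q \<Longrightarrow> b \<in> corner q' r \<Longrightarrow> a * b \<in> corner p r"
  by (simp add: corner_def mult.assoc) (simp flip: mult.assoc)

lemma corner_sum: "(\<And>x. x \<in> S \<Longrightarrow> f x \<in> corner p q) \<Longrightarrow> sum f S \<in> corner p q"
  by (induction S rule: infinite_finite_induct) (auto intro: corner_add)

lemma corner_suminf:
  assumes "summable f" "\<And>k. f k \<in> corner p q"
  shows "suminf f \<in> corner p q"
  using assms(2) unfolding corner_def
  by (auto simp: suminf_mult2[OF assms(1)] simp flip: suminf_mult[OF assms(1)])

lemma corner_star:
  assumes "a \<in> corner p q" "star p = p" "star q = q"
  shows "star a \<in> corner q p"
  using assms unfolding corner_def
  by (auto) (metis star_mult star_star star_zero)+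

text \<open>Both defining conditions are used in turn: \<open>q\<close> annihilates
  \<open>q'\<close>, hence \<open>b\<close>, and therefore \<open>a\<close> annihilates
  \<open>b\<close>.\<close>

lemma corner_orthogonal:
  assumes "a \<in> corner p q" "b \<in> corner q' r" "q * q' = 0"
  shows "a * b = 0"
  using assms unfolding corner_def by blast

text \<open>\<open>exp(2\<pi>iT) = exp(2\<pi>i D) + C = 1 + C\<close>, where \<open>D\<close> is a diagonal matrix of zeros and ones
  and \<open>C\<close> lies in the corners, because these absorb products.\<close>

lemma mat_cexp_corner:
  fixes T :: "'a::unital_cstar_algebra mat" and p :: "nat \<Rightarrow> 'a"
  assumes T: "T \<in> carrier_mat n n"
    and Y: "\<And>i j. i < n \<Longrightarrow> j < n \<Longrightarrow> T $$ (i, j) - (if i = j \<and> i \<in> S then 1 else 0) \<in> corner (p i) (p j)"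
    and ij: "i < n" "j < n"
  shows "mat_cexp (2 * complex_of_real pi * \<i>) T $$ (i, j) - kdelta i j \<in> corner (p i) (p j)"
proof -
  define D :: "nat \<Rightarrow> nat \<Rightarrow> 'a" where "D i j = (if i = j \<and> i \<in> S then 1 else 0)" for i j
  have pow: "(T ^\<^sub>m Suc k) $$ (i, j) - D i j \<in> corner (p i) (p j)" if "i < n" "j < n" for i j k
    using that
  proof (induction k arbitrary: i j)
    case 0
    then show ?case using T Y by (simp add: D_def)
  next
    case (Suc k)
    define A B where "A l = (T ^\<^sub>m Suc k) $$ (i, l) - D i l" and "B l = T $$ (l, j) - D l j" for l
    have A: "A l \<in> corner (p i) (p l)" and B: "B l \<in> corner (p l) (p j)" if "l < n" for l
      using that Suc Y by (simp_all add: A_def B_def D_def)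
    have "(T ^\<^sub>m Suc (Suc k)) $$ (i, j) = (\<Sum>l<n. (D i l + A l) * (D l j + B l))"
      using index_mult_mat_sum[OF pow_carrier_mat[OF T, of "Suc k"] T Suc.prems] by (simp add: A_def
          B_def)
    also have "\<dots> = (\<Sum>l<n. (if l = i then D i j else 0) + D i l * B l + A l * D l j + A l * B l)"
      by (rule sum.cong) (auto simp: D_def algebra_simps)
    also have "\<dots> = D i j + (\<Sum>l<n. D i l * B l + A l * D l j + A l * B l)"
      using Suc.prems by (simp add: sum.distrib add.assoc)
    finally have "(T ^\<^sub>m Suc (Suc k)) $$ (i, j) - D i j = (\<Sum>l<n. D i l * B l + A l * D l j + A l * B l)"
      by simp
    also have "\<dots> \<in> corner (p i) (p j)"
      using A B by (intro corner_sum corner_add) (auto simp: D_def intro: corner_mult)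
    finally show ?case .
  qed
  define R where "R k = (if k = 0 then 0 else (T ^\<^sub>m k) $$ (i, j) - D i j)" for k
  have R: "R k \<in> corner (p i) (p j)" for k
    using pow[OF ij, of "k - 1"] by (cases k) (simp_all add: R_def)
  have split: "(T ^\<^sub>m k) $$ (i, j) = D i j + R k" if "0 < k" for k using that by (simp add: R_def)
  have "mat_cexp (2 * complex_of_real pi * \<i>) T $$ (i, j) - kdelta i j =
      (\<Sum>k. ((2 * complex_of_real pi * \<i>) ^ k /\<^sub>R fact k) *\<^sub>C R k)"
    using mat_cexp_2pi_index(1)[OF T ij split] ij by (simp add: R_def)
  also have "\<dots> \<in> corner (p i) (p j)"
    by (rule corner_suminf[OF mat_cexp_2pi_index(2)[OF T ij split]]) (simp_all add: R_def
        corner_scaleC R[unfolded R_def])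
  finally show ?thesis .
qed

text \<open>The corners live in the middle algebra. Orthogonality between the entries of the
  exponential minus 1 is read off there and brought to the ideal side by injectivity of
  \<open>F\<close>.\<close>

lemma (in unital_extension) exp_lift_orthogonal:
  fixes T :: "'a mat" and p :: "nat \<Rightarrow> 'a"
  assumes T: "T \<in> carrier_mat 2 2" "mat_star T = T" "map_mat G T = P" and P: "P * P = P"
    and Y: "\<And>i j. i < 2 \<Longrightarrow> j < 2 \<Longrightarrow> T $$ (i, j) - (if i = j \<and> i \<in> S then 1 else 0) \<in> corner (p i) (p j)"
    and p: "\<And>i. i < 2 \<Longrightarrow> star (p i) = p i" "\<And>i j. i < 2 \<Longrightarrow> j < 2 \<Longrightarrow> i \<noteq> j \<Longrightarrow> p i * p j = 0"
  obtains u w where "exp_lift P w" "star u * u = 1" "u * star u = 1" "(w, Matrix.mat 1 1 (\<lambda>_. u)) \<in>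
      K1_rel"
proof -
  define w where "w = map_mat F_inv (exp2pi T)"
  note wl = exp_lift_of_lift[OF T P, folded w_def]
  define d where "d i j = w $$ (i, j) - kdelta i j" for i j
  have Fd: "F (d i j) \<in> corner (p i) (p j)" if "i < 2" "j < 2" for i j
  proof -
    have "F (d i j) = exp2pi T $$ (i, j) - kdelta i j"
      unfolding d_def star_hom_diff[OF F(1)] map_mat_indexD[OF wl(2) unitaries_dimD(1)[OF wl(1)] that]
      using F star_hom_zero[OF F(1)] by simp
    then show ?thesis using mat_cexp_corner[OF T(1) Y that] by simp
  qed
  have Fs: "F (star (d i j)) \<in> corner (p j) (p i)" if "i < 2" "j < 2" for i j
    unfolding star_hom_star[OF F(1)] using Fd[OF that] p(1) that by (simp add: corner_star)
  have zero: "a * b = 0" if "F a \<in> corner q r" "F b \<in> corner r' s" "r * r' = 0" for a b q r r' s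
    using corner_orthogonal[OF that] star_hom_mult[OF F(1)] star_hom_zero[OF F(1)] inj_F by (metis injD)
  show ?thesis
  proof (rule K1_rel_compress[OF wl(1), of d])
    show "star (d i j) * d k l = 0" if "i < 2" "j < 2" "k < 2" "l < 2" "i \<noteq> k" for i j k l
      by (rule zero[OF Fs[OF that(1,2)] Fd[OF that(3,4)] p(2)[OF that(1,3,5)]])
    show "d i j * star (d k l) = 0" if "i < 2" "j < 2" "k < 2" "l < 2" "j \<noteq> l" for i j k l
      by (rule zero[OF Fd[OF that(1,2)] Fs[OF that(3,4)] p(2)[OF that(2,4,5)]])
  qed (use that wl(3) in \<open>auto simp: d_def\<close>)
qed

section \<open>Orthogonal lifts of the generators of qC\<close>

text \<open>The eighth root leaves room to write \<open>x\<^sub>0\<close> as a product with \<open>t\<^sup>1\<^sup>/\<^sup>8 e\<^sub>2\<^sub>2\<close> on the left and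
  \<open>t\<^sup>1\<^sup>/\<^sup>8 e\<^sub>1\<^sub>1\<close> on the right whose middle factor still vanishes at \<open>0\<close>.\<close>

lift_definition root_sgn :: qC is
  "\<lambda>t. if t \<in> {0..1} then root 8 t *\<^sub>R (M2_unit 1 1 - M2_unit 2 2) else 0"
  by (intro conjI continuous_on_if_mem continuous_intros) (auto simp: M2_unit_def)

lift_definition root_abs :: qC is
  "\<lambda>t. if t \<in> {0..1} then root 8 t *\<^sub>R (M2_unit 1 1 + M2_unit 2 2) else 0"
  by (intro conjI continuous_on_if_mem continuous_intros) (auto simp: M2_unit_def)

text \<open>The exponents are arranged so that 1/8 + 6/8 + 1/8 = 1, giving \<open>h0\<close> and
  \<open>k0\<close>, and 1/8 + 2/8 + 1/8 = 1/2, giving \<open>x0\<close> with the middle factor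
  \<open>root_off_diag\<close>.\<close>

lift_definition root_pow6 :: qC is
  "\<lambda>t. if t \<in> {0..1} then root 8 t ^ 6 *\<^sub>R (M2_unit 1 1 + M2_unit 2 2) else 0"
  by (intro conjI continuous_on_if_mem continuous_intros) (auto simp: M2_unit_def)

lift_definition root_off_diag :: qC is
  "\<lambda>t. if t \<in> {0..1} then (root 8 t ^ 2 * sqrt (1 - t)) *\<^sub>R M2_unit 2 1 else 0"
  by (intro conjI continuous_on_if_mem continuous_intros) (auto simp: M2_unit_def)

text \<open>These are t^(1/8) e11 and t^(1/8) e22, written as the positive and negative parts of the
  one self-adjoint element \<open>root_sgn\<close>. Separate lifts of the two would not
  automatically be orthogonal; the parts of a single self-adjoint lift are.\<close>

definition root_corner :: "nat \<Rightarrow> qC" where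
  "root_corner i = (1/2) *\<^sub>R (if i = 0 then root_abs + root_sgn else root_abs - root_sgn)"

lemmas M2_simps = M2_star_def M2_unit_def matrix_matrix_mult_def sum_2 forall_2
  Finite_Cartesian_Product.vec_eq_iff

lemma root_corner_rep:
  "qC_fun (root_corner 0) t = (if t \<in> {0..1} then root 8 t *\<^sub>R M2_unit 1 1 else 0)"
  "qC_fun (root_corner (Suc 0)) t = (if t \<in> {0..1} then root 8 t *\<^sub>R M2_unit 2 2 else 0)"
  by (simp_all add: root_corner_def scaleR_qC.rep_eq plus_qC.rep_eq minus_qC.rep_eq root_abs.rep_eq
      root_sgn.rep_eq
      M2_simps scaleR_conv_of_real[where 'a = complex])

lemma root_corner_simps:
  "root_corner 0 * root_pow6 * root_corner 0 = h0"
  "root_corner 1 * root_pow6 * root_corner 1 = k0"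
  "root_corner 1 * root_off_diag * root_corner 0 = x0"
  "root_corner 0 * star root_off_diag * root_corner 1 = star x0"
proof -
  have r8: "root 8 t ^ 8 = t" if "0 \<le> t" for t using that by (simp add: real_root_pow_pos2)
  have r4: "root 8 t ^ 4 * sqrt (1 - t) = sqrt (t - t\<^sup>2)" if "0 \<le> t" "t \<le> 1" for t
  proof -
    have "(root 8 t ^ 4)\<^sup>2 = t" using r8[OF that(1)] by (simp flip: power_mult)
    moreover have "0 \<le> root 8 t ^ 4" using that by simp
    ultimately have "sqrt t = root 8 t ^ 4" by (rule real_sqrt_unique)
    then have "root 8 t ^ 4 * sqrt (1 - t) = sqrt t * sqrt (1 - t)" by (rule arg_cong[OF sym])
    then show ?thesis by (simp add: power2_eq_square algebra_simps flip: real_sqrt_mult)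
  qed
  have e8: "root 8 t * root 8 t ^ 6 * root 8 t = root 8 t ^ 8" "root 8 t * (root 8 t ^ 6 * root 8 t)
      = root 8 t ^ 8" for t
    by (simp_all add: eval_nat_numeral)
  have e4: "root 8 t * (root 8 t ^ 2 * sqrt (1 - t)) * root 8 t = root 8 t ^ 4 * sqrt (1 - t)"
    "root 8 t * (root 8 t ^ 2 * sqrt (1 - t) * root 8 t) = root 8 t ^ 4 * sqrt (1 - t)" for t
    by (simp_all add: eval_nat_numeral)
  note rep = times_qC.rep_eq star_qC.rep_eq root_corner_rep root_pow6.rep_eq root_off_diag.rep_eq
    h0.rep_eq k0.rep_eq x0.rep_eq
  show "root_corner 0 * root_pow6 * root_corner 0 = h0"
    unfolding qC_fun_inject[symmetric] fun_eq_iff rep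
    using r8 by (auto simp: M2_simps e8 simp flip: of_real_mult of_real_power)
  show "root_corner 1 * root_pow6 * root_corner 1 = k0"
    unfolding qC_fun_inject[symmetric] fun_eq_iff rep One_nat_def
    using r8 by (auto simp: M2_simps e8 simp flip: of_real_mult of_real_power)
  show "root_corner 1 * root_off_diag * root_corner 0 = x0"
    unfolding qC_fun_inject[symmetric] fun_eq_iff rep One_nat_def
    using r4 by (auto simp: M2_simps e4 simp flip: of_real_mult of_real_power)
  show "root_corner 0 * star root_off_diag * root_corner 1 = star x0"
    unfolding qC_fun_inject[symmetric] fun_eq_iff rep One_nat_def
    using r4 by (auto simp: M2_simps e4 simp flip: of_real_mult of_real_power)
qed

section \<open>Pointwise evaluation on the unitization of qC\<close>

lemma star_Unitiz: "star (Unitiz a c) = Unitiz (star a) (cnj c)"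
  by (simp add: star_unitization_def)

lemma star_root: "star root_sgn = root_sgn" "star root_pow6 = root_pow6"
  by (transfer; auto simp: fun_eq_iff M2_simps)+

text \<open>Matrix entries of the unital representation that sends f + c 1 to the matrix f(t) + c 1.
  For varying \<open>t\<close> these separate points and turn identities in the unitization into
  scalar ones.\<close>

definition eval_qC :: "real \<Rightarrow> 2 \<Rightarrow> 2 \<Rightarrow> qC unitization \<Rightarrow> complex" where
  "eval_qC t i j x = qC_fun (base x) t $h i $h j + (if i = j then scal x else 0)"

lemma eval_qC_mult: "eval_qC t i j (x * y) = (\<Sum>k\<in>UNIV. eval_qC t i k x * eval_qC t k j y)"
  using exhaust_2[of i] exhaust_2[of j]
  by (auto simp: eval_qC_def times_unitization_def plus_qC.rep_eq times_qC.rep_eq scaleC_qC.rep_eq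
      matrix_matrix_mult_def sum_2 algebra_simps)

lemma bounded_linear_eval_qC: "bounded_linear (eval_qC t i j)"
proof (rule bounded_linear_intro[where K = 9])
  fix x y :: "qC unitization" and r :: real
  show "eval_qC t i j (x + y) = eval_qC t i j x + eval_qC t i j y"
    by (simp add: eval_qC_def plus_unitization_def plus_qC.rep_eq)
  show "eval_qC t i j (r *\<^sub>R x) = r *\<^sub>R eval_qC t i j x"
    by (simp add: eval_qC_def scaleR_unitization_def scaleR_qC.rep_eq scaleR_add_right)
  have "norm (eval_qC t i j x) \<le> cmod (qC_fun (base x) t $h i $h j) + cmod (if i = j then scal x else 0)"
    unfolding eval_qC_def by (rule norm_triangle_ineq)
  also have "\<dots> \<le> 4 * norm (base x) + norm x"
  proof (rule add_mono)
    show "cmod (qC_fun (base x) t $h i $h j) \<le> 4 * norm (base x)"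
      using M2_entry_le[of "qC_fun (base x) t" i j] M2_norm_ge[of "qC_fun (base x) t"] qC_norm_ge[of
          "base x" t]
      by linarith
    show "cmod (if i = j then scal x else 0) \<le> norm x" using scal_le_norm[of x] by simp
  qed
  \<comment> \<open>The constant is 4 * 2 + 1: 4 compares an entry with the operator norm, 2 comes
    from \<open>base_le_norm\<close>, and 1 from the scalar part.\<close>
  also have "\<dots> \<le> norm x * 9" using base_le_norm[of x] by simp
  finally show "norm (eval_qC t i j x) \<le> norm x * 9" .
qed

lemma eval_qC_eqI:
  assumes "\<And>t i j. t \<in> {0..1} \<Longrightarrow> eval_qC t i j x = eval_qC t i j y"
  shows "x = y"
proof (rule unitization.expand, intro conjI)
  \<comment> \<open>At \<open>t = 0\<close> only the scalar part is visible, and it is subtracted at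
    the other points.\<close>
  have "qC_fun f 0 = 0" for f using qC_fun[of f] by simp
  then show scal: "scal x = scal y" using assms[of 0 1 1] by (simp add: eval_qC_def)
  have "qC_fun (base x) t = qC_fun (base y) t" for t
  proof (cases "t \<in> {0..1}")
    case True
    then show ?thesis
      unfolding Finite_Cartesian_Product.vec_eq_iff
    proof (intro allI)
      show "qC_fun (base x) t $h i $h j = qC_fun (base y) t $h i $h j" for i j
        using assms[OF True, of i j] scal by (simp add: eval_qC_def split: if_splits)
    qed
  next
    case False
    then show ?thesis using qC_fun[of "base x"] qC_fun[of "base y"] by simp
  qed
  then show "base x = base y" by (simp add: qC_fun_inject[symmetric] fun_eq_iff)
qed

lemma eval_qC_one: "eval_qC t i j 1 = (if i = j then 1 else 0)"
  by (simp add: eval_qC_def one_unitization_def zero_qC.rep_eq)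

text \<open>At each point \<open>s * s\<close> is a scalar matrix, so evaluation reduces the series
  to that of \<open>msqrt_real\<close>. The scale \<open>N\<close> is left free since one constant
  has to normalize both \<open>root_sgn\<close> and its lift in another algebra.\<close>

lemma root_abs_eq_msqrt:
  fixes N :: real
  assumes N: "1 \<le> N" "norm (Unitiz root_sgn 0) \<le> N"
  defines "s \<equiv> (1 / N) *\<^sub>R Unitiz root_sgn 0"
  shows "N *\<^sub>R msqrt (s * s) = Unitiz root_abs 0"
proof (rule eval_qC_eqI)
  fix t :: real and i j :: 2 assume t: "t \<in> {0..1}"
  let ?y = "(root 8 t / N)\<^sup>2"
  have s: "star s = s" "norm s \<le> 1"
    using N by (simp_all add: s_def star_scaleR star_Unitiz star_root)
  have n: "norm (s * s - 1) \<le> 1" by (rule norm_one_minus_square_le[OF s])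
  note lin = bounded_linear.linear[OF bounded_linear_eval_qC]
  have es: "eval_qC t i j s = (if i = j then (if i = 1 then root 8 t / N else - (root 8 t / N)) else
      0)" for i j
    unfolding s_def linear_scale[OF lin] unfolding eval_qC_def using t exhaust_2[of i] exhaust_2[of j]
    by (auto simp: root_sgn.rep_eq M2_unit_def scaleR_conv_of_real[where 'a = complex])
  have ess: "eval_qC t i j (s * s - 1) = (if i = j then of_real (?y - 1) else 0)" for i j
    unfolding linear_diff[OF lin] eval_qC_mult eval_qC_one es
    using exhaust_2[of i] exhaust_2[of j] by (auto simp: sum_2 power2_eq_square)
  have pow: "eval_qC t i j ((s * s - 1) ^ n) = (if i = j then of_real ((?y - 1) ^ n) else 0)" for i j n
  proof (induction n arbitrary: i j)
    case (Suc n)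
    then show ?case
      unfolding power_Suc eval_qC_mult ess using exhaust_2[of i] exhaust_2[of j] by (auto simp: sum_2)
  qed (simp add: eval_qC_one)
  have "root 8 t \<le> 1" using t by simp
  then have "root 8 t \<le> N" using N(1) by linarith
  then have y: "0 \<le> ?y" "?y \<le> 1"
    using t N(1) by (auto intro!: power_le_one simp: divide_le_eq_1)
  have "eval_qC t i j (msqrt (s * s)) = (\<Sum>n. (1/2 gchoose n) *\<^sub>R (if i = j then of_real ((?y - 1) ^
      n) else 0))"
    unfolding bounded_linear_msqrt[OF bounded_linear_eval_qC n] pow ..
  also have "\<dots> = (if i = j then of_real (\<Sum>n. (1/2 gchoose n) *\<^sub>R (?y - 1) ^ n) else 0)"
  proof (cases "i = j")
    case True
    have "norm (?y - 1) \<le> 1" using y by simp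
    from suminf_of_real[OF summable_norm_cancel[OF summable_msqrt[OF this]], where 'a = complex]
    show ?thesis using True by (simp add: scaleR_conv_of_real)
  qed simp
  also have "(\<Sum>n. (1/2 gchoose n) *\<^sub>R (?y - 1) ^ n) = root 8 t / N"
    using msqrt_real[OF y] t N by (simp add: msqrt_def)
  finally have "eval_qC t i j (N *\<^sub>R msqrt (s * s)) = N *\<^sub>R (if i = j then of_real (root 8 t / N)
      else 0)"
    by (simp only: linear_scale[OF lin])
  then show "eval_qC t i j (N *\<^sub>R msqrt (s * s)) = eval_qC t i j (Unitiz root_abs 0)"
    using N t exhaust_2[of i] exhaust_2[of j]
    by (auto simp: eval_qC_def root_abs.rep_eq M2_unit_def scaleR_conv_of_real[where 'a = complex])
qed

text \<open>Every entry is brought to the form scalar plus corner element times middle factor times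
  corner element, which can be lifted factor by factor without leaving the corners.\<close>

lemma P0_index:
  "P0 \<in> carrier_mat 2 2"
  "P0 $$ (0, 0) = 1 - Unitiz (root_corner 0) 0 * Unitiz root_pow6 0 * Unitiz (root_corner 0) 0"
  "P0 $$ (0, 1) = Unitiz (root_corner 0) 0 * star (Unitiz root_off_diag 0) * Unitiz (root_corner 1) 0"
  "P0 $$ (1, 0) = Unitiz (root_corner 1) 0 * Unitiz root_off_diag 0 * Unitiz (root_corner 0) 0"
  "P0 $$ (1, 1) = Unitiz (root_corner 1) 0 * Unitiz root_pow6 0 * Unitiz (root_corner 1) 0"
proof -
  have m: "Unitiz a 0 * Unitiz b 0 = Unitiz (a * b) 0" for a b :: qC
    by (simp add: times_unitization_def scaleC_zero_left)
  have st: "star (Unitiz a 0) = Unitiz (star a) 0" for a :: qC by (simp add: star_Unitiz)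
  show "P0 \<in> carrier_mat 2 2" by (simp add: P0_def mat_of_rows_list_def numeral_2_eq_2)
  show "P0 $$ (0, 0) = 1 - Unitiz (root_corner 0) 0 * Unitiz root_pow6 0 * Unitiz (root_corner 0) 0"
    "P0 $$ (0, 1) = Unitiz (root_corner 0) 0 * star (Unitiz root_off_diag 0) * Unitiz (root_corner 1) 0"
    "P0 $$ (1, 0) = Unitiz (root_corner 1) 0 * Unitiz root_off_diag 0 * Unitiz (root_corner 0) 0"
    "P0 $$ (1, 1) = Unitiz (root_corner 1) 0 * Unitiz root_pow6 0 * Unitiz (root_corner 1) 0"
    unfolding m st root_corner_simps by (simp_all add: P0_def mat_of_rows_list_def)
qed

context unital_extension
begin

text \<open>The two elements are the positive and negative parts of a lift of \<open>root_sgn\<close>; its absolute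
  value is a series, hence is mapped to \<open>root_abs\<close>.\<close>

lemma lift_orthogonal:
  assumes \<Phi>: "star_hom \<Phi>" "\<Phi> 1 = 1"
  obtains p :: "nat \<Rightarrow> 'a" where "\<forall>i. star (p i) = p i" "p 0 * p 1 = 0" "p 1 * p 0 = 0"
    "\<forall>i. G (p i) = \<Phi> (Unitiz (root_corner i) 0)"
proof -
  let ?s = "Unitiz root_sgn 0"
  have "star (\<Phi> ?s) = \<Phi> ?s"
    by (simp add: star_Unitiz star_root flip: star_hom_star[OF \<Phi>(1)])
  then obtain s where s: "star s = s" "G s = \<Phi> ?s" by (rule lift_selfadjoint)
  \<comment> \<open>A common scale making both \<open>s\<close> and \<open>root_sgn\<close>
    contractions; the 1 secures division by \<open>N\<close> and the hypothesis of
    \<open>root_abs_eq_msqrt\<close>.\<close>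
  define N where "N = max 1 (max (norm s) (norm ?s))"
  have N: "1 \<le> N" "norm s \<le> N" "norm ?s \<le> N" by (simp_all add: N_def)
  define r where "r = (1 / N) *\<^sub>R s"
  have r: "star r = r" "norm r \<le> 1" using s N by (simp_all add: r_def star_scaleR)
  have nr: "norm (r * r - 1) \<le> 1" by (rule norm_one_minus_square_le[OF r])
  define m where "m = N *\<^sub>R msqrt (r * r)"
  have sr: "s = N *\<^sub>R r" using N by (simp add: r_def)
  have m: "star m = m" "m * s = s * m" "m * m = s * s"
    using star_msqrt[OF nr] msqrt_commute[OF nr, of r] msqrt_square[OF nr] r
    by (simp_all add: m_def sr star_scaleR star_mult mult.assoc)
  let ?r = "(1 / N) *\<^sub>R ?s"
  have nr': "norm (?r * ?r - 1) \<le> 1"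
    by (rule norm_one_minus_square_le) (use N in \<open>simp_all add: star_scaleR star_Unitiz star_root\<close>)
  have Gr: "G r = \<Phi> ?r"
    by (simp add: r_def star_hom_scaleR[OF G(1)] star_hom_scaleR[OF \<Phi>(1)] s)
  have "G m = N *\<^sub>R msqrt (\<Phi> (?r * ?r))"
    unfolding m_def star_hom_scaleR[OF G(1)]
      msqrt_hom[OF unital_star_hom_bounded_linear[OF G] star_hom_mult[OF G(1)] G(2) nr]
    by (simp only: star_hom_mult[OF G(1)] star_hom_mult[OF \<Phi>(1)] Gr)
  also have "\<dots> = \<Phi> (N *\<^sub>R msqrt (?r * ?r))"
    unfolding star_hom_scaleR[OF \<Phi>(1)]
      msqrt_hom[OF unital_star_hom_bounded_linear[OF \<Phi>] star_hom_mult[OF \<Phi>(1)] \<Phi>(2) nr'] ..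
  also have "\<dots> = \<Phi> (Unitiz root_abs 0)" by (simp only: root_abs_eq_msqrt[OF N(1,3)])
  finally have Gm: "G m = \<Phi> (Unitiz root_abs 0)" .
  \<comment> \<open>With \<open>m\<close> as absolute value of \<open>s\<close>, orthogonality is (m
    + s)(m - s) = m m - s s = 0, where \<open>m\<close> and \<open>s\<close> commute.\<close>
  define p where "p i = (1/2) *\<^sub>R (if i = 0 then m + s else m - s)" for i :: nat
  have c: "Unitiz (root_corner i) 0 = (1/2) *\<^sub>R (if i = 0 then Unitiz root_abs 0 + ?s else Unitiz
      root_abs 0 - ?s)" for i
    by (simp add: root_corner_def unitization_defs)
  show ?thesis
  proof (rule that)
    show "\<forall>i. star (p i) = p i" by (simp add: p_def star_scaleR star_add star_diff m s)
    show "p 0 * p 1 = 0" "p 1 * p 0 = 0" by (simp_all add: p_def algebra_simps m)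
    show "\<forall>i. G (p i) = \<Phi> (Unitiz (root_corner i) 0)"
      unfolding c by (simp add: p_def star_hom_scaleR[OF G(1)] star_hom_scaleR[OF \<Phi>(1)]
          star_hom_add[OF G(1)]
        star_hom_add[OF \<Phi>(1)] star_hom_diff[OF G(1)] star_hom_diff[OF \<Phi>(1)] Gm s)
  qed
qed

lemma exp_lift_P0:
  assumes \<Phi>: "star_hom \<Phi>" "\<Phi> 1 = 1"
  obtains u w where "exp_lift (map_mat \<Phi> P0) w" "star u * u = 1" "u * star u = 1"
    "(w, Matrix.mat 1 1 (\<lambda>_. u)) \<in> K1_rel"
proof -
  obtain p :: "nat \<Rightarrow> 'a" where p: "\<forall>i. star (p i) = p i" "p 0 * p 1 = 0" "p 1 * p 0 = 0"
    "\<forall>i. G (p i) = \<Phi> (Unitiz (root_corner i) 0)"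
    by (rule lift_orthogonal[OF \<Phi>])
  have "star (\<Phi> (Unitiz root_pow6 0)) = \<Phi> (Unitiz root_pow6 0)"
    by (simp add: star_Unitiz star_root flip: star_hom_star[OF \<Phi>(1)])
  then obtain y where y: "star y = y" "G y = \<Phi> (Unitiz root_pow6 0)" by (rule lift_selfadjoint)
  obtain z where z: "G z = \<Phi> (Unitiz root_off_diag 0)" using surj_G by (metis surjD)
  \<comment> \<open>Lifts of the middle factors in \<open>P0_index\<close>: the minus sign belongs
    to \<open>1 - h0\<close>, and \<open>star z\<close> in the upper right keeps \<open>T\<close>
    self-adjoint.\<close>
  define Y where "Y i j = (if i = 0 then if j = 0 then - y else star z else if j = 0 then z else y)"
      for i j :: nat
  define T where "T = Matrix.mat 2 2 (\<lambda>(i, j). (if i = j \<and> i \<in> {0} then 1 else 0) + p i * Y i j * p j)"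
  have Tc: "T \<in> carrier_mat 2 2" by (simp add: T_def)
  have Ts: "mat_star T = T"
    by (rule eq_matI) (auto simp: T_def Y_def star_add star_mult star_one star_zero star_star
        star_minus y p mult.assoc)
  have TP: "map_mat G T = map_mat \<Phi> P0"
  proof (rule eq_matI)
    fix i j assume "i < dim_row (map_mat \<Phi> P0)" "j < dim_col (map_mat \<Phi> P0)"
    then have ij: "i < 2" "j < 2" using P0_index(1) by auto
    have "G (T $$ (i, j)) = \<Phi> (P0 $$ (i, j))"
      using ij unfolding less_2_cases_iff
      by (auto simp: T_def Y_def P0_index(2-5)[unfolded One_nat_def] star_hom_add[OF G(1)]
          star_hom_mult[OF G(1)] star_hom_star[OF G(1)] G(2) star_hom_diff[OF G(1)]
        star_hom_zero[OF G(1)] linear_neg[OF star_hom_linear[OF G(1)]] star_hom_diff[OF \<Phi>(1)]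
            star_hom_mult[OF \<Phi>(1)]
        star_hom_star[OF \<Phi>(1)] \<Phi>(2) p(4) y z)
    then show "map_mat G T $$ (i, j) = map_mat \<Phi> P0 $$ (i, j)" using ij Tc P0_index(1) by auto
  qed (use Tc P0_index(1) in auto)
  have "P0 * P0 = P0" using P0_projection unfolding projections_def by blast
  then have P: "map_mat \<Phi> P0 * map_mat \<Phi> P0 = map_mat \<Phi> P0"
    using map_mat_star_hom_mult[OF \<Phi>(1) P0_index(1) P0_index(1)] by simp
  show ?thesis
  proof (rule exp_lift_orthogonal[OF Tc Ts TP P, of "{0}" p])
    show "T $$ (i, j) - (if i = j \<and> i \<in> {0} then 1 else 0) \<in> corner (p i) (p j)" if "i < 2" "j < 2"
        for i j
      using corner_mem[of "p i" "Y i j" "p j"] that by (simp add: T_def)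
    show "p i * p j = 0" if "i < 2" "j < 2" "i \<noteq> j" for i j
      using that p(2,3) by (auto simp: less_2_cases_iff)
  qed (use p that in auto)
qed

end


section \<open>The boundary map on K0\<close>

lemma star_hom_map_unitization:
  fixes f :: "'a::cstar_algebra \<Rightarrow> 'b::cstar_algebra"
  assumes f: "star_hom f"
  shows "star_hom (map_unitization f)" "map_unitization f 1 = 1"
  using f
  by (auto simp: star_hom_def unitization_cdefs unitization.map_sel intro!: unitization.expand)
    (simp_all add: star_hom_zero[OF f])

text \<open>The image of the unitized ideal is the zero set of the continuous map taking
  \<open>a\<close> to the non-scalar part of its image, hence closed; this is what makes the
  injective \<open>map_unitization \<iota>\<close> isometric.\<close>

lemma unital_extension_map_unitization:
  fixes \<iota> :: "'i::cstar_algebra \<Rightarrow> 'a::cstar_algebra" and \<pi> :: "'a \<Rightarrow> 'b::cstar_algebra"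
  assumes "short_exact \<iota> \<pi>"
  shows "unital_extension (map_unitization \<iota>) (map_unitization \<pi>)"
proof -
  have h: "star_hom \<iota>" "star_hom \<pi>" and inj: "inj \<iota>" and ran: "range \<iota> = {a. \<pi> a = 0}" and surj: "surj \<pi>"
    using assms unfolding short_exact_def by auto
  note F = star_hom_map_unitization[OF h(1)] and G = star_hom_map_unitization[OF h(2)]
  have inj_F: "inj (map_unitization \<iota>)" by (rule unitization.inj_map[OF inj])
  have range_F: "range (map_unitization \<iota>) = {a. base (map_unitization \<pi> a) = 0}"
  proof (intro equalityI subsetI)
    fix a :: "'a unitization" assume "a \<in> {a. base (map_unitization \<pi> a) = 0}"
    then have "base a \<in> range \<iota>" by (simp add: unitization.map_sel ran)
    then obtain x where "base a = \<iota> x" by blast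
    then have "a = map_unitization \<iota> (Unitiz x (scal a))" by (cases a) simp
    then show "a \<in> range (map_unitization \<iota>)" by blast
  qed (use ran in \<open>auto simp: unitization.map_sel\<close>)
  have "bounded_linear (base :: 'b unitization \<Rightarrow> 'b)"
    by (rule bounded_linear_intro[where K = 2])
      (use base_le_norm in \<open>simp_all add: unitization_defs mult.commute\<close>)
  then have "continuous_on UNIV (\<lambda>a. base (map_unitization \<pi> a))"
    by (intro bounded_linear.continuous_on[of base] bounded_linear.continuous_on[OF
        unital_star_hom_bounded_linear[OF G]]) auto
  then have "closed (range (map_unitization \<iota>))"
    unfolding range_F by (intro closed_Collect_eq) auto
  note norm_F = unital_star_hom_inj_isometric[OF F inj_F this]
  show ?thesis
  proof
    show "surj (map_unitization \<pi>)"
    proof (rule surjI)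
      show "map_unitization \<pi> (map_unitization (inv_into UNIV \<pi>) b) = b" for b
        by (cases b) (simp add: surj_f_inv_f[OF surj])
    qed
    show "a \<in> range (map_unitization \<iota>)" if "map_unitization \<pi> a = c *\<^sub>C 1" for a c
      using that unfolding range_F by (simp add: unitization_cdefs scaleC_zero_right)
  qed (fact F G inj_F norm_F)+
qed

text \<open>\<open>K0_map\<close> pushes forward every representative of the generator and not only
  \<open>P0\<close>, so arbitrary related pairs have to be followed through the
  homomorphism.\<close>

lemma K00_rel_map:
  fixes f :: "'a::unital_cstar_algebra \<Rightarrow> 'b::unital_cstar_algebra"
  assumes f: "star_hom f" "f 1 = 1" and rel: "((P, Q), (P', Q')) \<in> K00_rel"
  shows "((map_mat f P, map_mat f Q), (map_mat f P', map_mat f Q')) \<in> K00_rel"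
proof -
  have proj: "map_mat f E \<in> projections" if E: "E \<in> projections" for E
  proof -
    obtain n where "E \<in> carrier_mat n n" "mat_star E = E" "E * E = E" using E by (rule projectionsE)
    then show ?thesis
      unfolding projections_def
      using map_mat_star_hom_mult[OF f(1), of E n n E n] map_mat_star_hom_star[OF f(1), of E]
      by (auto intro!: exI[of _ n])
  qed
  have mvn: "mvn (map_mat f D) (map_mat f E)" if DE: "mvn D E" for D E
  proof -
    obtain V where V: "V \<in> carrier_mat (dim_row E) (dim_row D)" "mat_star V * V = D" "V * mat_star V = E"
      using DE unfolding mvn_def by blast
    have "mat_star (map_mat f V) * map_mat f V = map_mat f D" "map_mat f V * mat_star (map_mat f V)
        = map_mat f E"
      using map_mat_star_hom_mult[OF f(1) mat_star_carrier[OF V(1)] V(1)]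
        map_mat_star_hom_mult[OF f(1) V(1) mat_star_carrier[OF V(1)]] V(2,3)
      by (simp_all add: map_mat_star_hom_star[OF f(1)])
    then show ?thesis unfolding mvn_def using V(1) by (intro bexI[of _ "map_mat f V"]) auto
  qed
  obtain R where pr: "P \<in> projections" "Q \<in> projections" "P' \<in> projections" "Q' \<in> projections" "R \<in>
      projections"
    and R: "mvn (P \<oplus>\<^sub>m Q' \<oplus>\<^sub>m R) (P' \<oplus>\<^sub>m Q \<oplus>\<^sub>m R)"
    using rel unfolding K00_rel_def by blast
  show ?thesis
    unfolding K00_rel_def using mvn[OF R] pr proj
    by (auto simp: map_mat_sum star_hom_zero[OF f(1)])
qed

lemma K00_rel_refl:
  assumes "P \<in> projections" "Q \<in> projections"
  shows "((P, Q), (P, Q)) \<in> K00_rel"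
  unfolding K00_rel_def using assms by (auto intro!: bexI[of _ P] mvn_refl projections_sum)

theorem theorem3p1:
  fixes \<iota> :: "'i::cstar_algebra \<Rightarrow> 'a::cstar_algebra"
    and \<pi> :: "'a \<Rightarrow> 'b::cstar_algebra"
    and \<phi> :: "qC \<Rightarrow> 'b"
    and x :: "('b unitization mat \<times> 'b unitization mat) set"
  assumes "short_exact \<iota> \<pi>"
    and "x \<in> carrier K0"
    and "star_hom \<phi>"
    and "x = K0_map \<phi> qC_generator"
  shows "\<exists>u :: 'i unitization. star u * u = 1 \<and> u * star u = 1 \<and>
    exp_map \<iota> \<pi> x = K1_class (Matrix.mat 1 1 (\<lambda>_. u))"
proof -
  interpret E: unital_extension "map_unitization \<iota>" "map_unitization \<pi>"
    by (rule unital_extension_map_unitization[OF assms(1)])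
  interpret K: comm_group "K1 :: 'i unitization mat set monoid" by (rule comm_group_K1)
  have exp_rep: "exp_rep \<iota> \<pi> = E.exp_lift"
    by (simp add: fun_eq_iff exp_rep_def E.exp_lift_def)
  let ?\<Phi> = "map_unitization \<phi>"
  note \<Phi> = star_hom_map_unitization[OF assms(3)]
  let ?P = "map_mat ?\<Phi> P0" and ?Q = "map_mat ?\<Phi> (1\<^sub>m 1)"
  obtain u w where w: "E.exp_lift ?P w" and u: "star u * u = 1" "u * star u = 1"
    and wu: "(w, Matrix.mat 1 1 (\<lambda>_. u)) \<in> K1_rel"
    by (rule E.exp_lift_P0[OF \<Phi>])
  have x: "x = (\<Union>(P, Q)\<in>K00_rel `` {(P0, 1\<^sub>m 1)}. K00_rel `` {(map_mat ?\<Phi> P, map_mat ?\<Phi> Q)})"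
    unfolding assms(4) K0_map_def K00_map_def qC_generator_def K00_diff_def ..
  have rel0: "((P0, 1\<^sub>m 1), (P0, 1\<^sub>m 1)) \<in> K00_rel"
    by (rule K00_rel_refl[OF P0_projection one_projection])
  have v: "E.exp_lift ?Q (1\<^sub>m 1)"
    using E.exp_lift_one[of 1] by (simp add: map_mat_one \<Phi> star_hom_zero)
  \<comment> \<open>Well-definedness of the boundary on differences: the additive relation of
    \<open>exp_lift_K00_rel\<close> solved inside the abelian group.\<close>
  have diff: "K1_class a \<otimes>\<^bsub>K1\<^esub> inv\<^bsub>K1\<^esub> K1_class b = K1_class a' \<otimes>\<^bsub>K1\<^esub> inv\<^bsub>K1\<^esub> K1_class b'"
    if rel: "((P, Q), (P', Q')) \<in> K00_rel"
      and l: "E.exp_lift P a" "E.exp_lift Q b" "E.exp_lift P' a'" "E.exp_lift Q' b'" for P Q P' Q' a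
          b a' b'
  proof -
    have U: "a \<in> unitaries" "b \<in> unitaries" "a' \<in> unitaries" "b' \<in> unitaries"
      using l E.exp_lift_unitaries by blast+
    note C = U[THEN K1_class_carrier]
    have "K1_class a \<otimes>\<^bsub>K1\<^esub> K1_class b' = K1_class a' \<otimes>\<^bsub>K1\<^esub> K1_class b"
      using E.exp_lift_K00_rel[OF rel l] U by (simp add: K1_class_mult K1_class_eq_iff sum_unitaries)
    then show ?thesis
      using C by (smt (verit) K.inv_closed K.inv_solve_right K.m_assoc K.m_closed K.m_comm)
  qed
  have w1: "K1_class w \<otimes>\<^bsub>K1\<^esub> inv\<^bsub>K1\<^esub> K1_class (1\<^sub>m 1) = K1_class w"
    using K1_class_carrier[OF E.exp_lift_unitaries[OF w]] by (simp add: K1_class_one)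
  have "exp_map \<iota> \<pi> x = K1_class w"
    unfolding exp_map_def exp_rep
  proof (rule the_equality)
    have "(?P, ?Q) \<in> x"
      unfolding x using rel0 K00_rel_map[OF \<Phi> rel0] by blast
    then show "\<exists>P Q u v. (P, Q) \<in> x \<and> E.exp_lift P u \<and> E.exp_lift Q v \<and>
        K1_class w = K1_class u \<otimes>\<^bsub>K1\<^esub> inv\<^bsub>K1\<^esub> K1_class v"
      using w v w1 by metis
  next
    fix y assume "\<exists>P Q u v. (P, Q) \<in> x \<and> E.exp_lift P u \<and> E.exp_lift Q v \<and>
        y = K1_class u \<otimes>\<^bsub>K1\<^esub> inv\<^bsub>K1\<^esub> K1_class v"
    then obtain P' Q' a' b' where x': "(P', Q') \<in> x" and a': "E.exp_lift P' a'" and b': "E.exp_lift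
        Q' b'"
      and y: "y = K1_class a' \<otimes>\<^bsub>K1\<^esub> inv\<^bsub>K1\<^esub> K1_class b'"
      by blast
    obtain P Q where PQ: "((P0, 1\<^sub>m 1), (P, Q)) \<in> K00_rel"
      and PQ': "((map_mat ?\<Phi> P, map_mat ?\<Phi> Q), (P', Q')) \<in> K00_rel"
      using x' unfolding x by blast
    have "map_mat ?\<Phi> P \<in> projections" "map_mat ?\<Phi> Q \<in> projections"
      using PQ' unfolding K00_rel_def by blast+
    then obtain a b where a: "E.exp_lift (map_mat ?\<Phi> P) a" and b: "E.exp_lift (map_mat ?\<Phi> Q) b"
      by (metis E.exp_lift_exists)
    \<comment> \<open>The representative is reached from the image of \<open>P0\<close> by two
      relations, one before and one after mapping. They are chained through the exponentials of the
      intermediate pair, as equalities in \<open>K1\<close>.\<close>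
    show "y = K1_class w"
      using diff[OF PQ' a b a' b'] diff[OF K00_rel_map[OF \<Phi> PQ] w v a b] y w1 by simp
  qed
  also have "\<dots> = K1_class (Matrix.mat 1 1 (\<lambda>_. u))"
    using wu by (simp add: K1_class_eq_iff K1_rel_unitaries)
  finally show ?thesis using u by blast
qed

end
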